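(* Let $\alpha>2$ and $g(x)=\|x\|^{-\alpha}$, and let the transmitters form a Neyman-Scott cluster process $\phi$ with parent intensity $\lambda_p$, a Poisson number of points per cluster with mean $\bar c$, and isotropic scattering density $f$. Let $z\in\mathbb{R}^2$, and let $F_h$ be the CDF of the power fading coefficient. Then the lower bound $\bar F_I^{l}(y)$ and the upper bound $\bar F_I^{u}(y)$ on the CCDF $\bar F_I(y)$ of the interference at $z$, namely $$\bar F_I^{l}(y)=1-\mathcal{G}\Big(F_h\Big(\frac{y}{g(\cdot-z)}\Big)\Big),\qquad \bar F_I^{u}(y)=1-(1-\varphi(y))\,\mathcal{G}\Big(F_h\Big(\frac{y}{g(\cdot-z)}\Big)\Big),$$ $$\varphi(y)=\frac{1}{y\lambda}\int_{\mathbb{R}^2}g(x-z)\rho^{(2)}(x)\int_0^{y/g(x-z)}\nu\,dF_h(\nu)\,dx,$$ scale as follows for $y\to\infty$: $$\bar F_I^{l}(y)\sim\theta_1y^{-2/\alpha},\qquad \bar F_I^{u}(y)\sim(\theta_1+\theta_2)y^{-2/\alpha},$$ where $\theta_1=\pi\bar c\,[(f*f)(z)+\lambda_p]\int_0^\infty\nu^{2/\alpha}\,dF_h(\nu)$ and $\theta_2=2\theta_1/(\alpha-2)$.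
   Context: Neyman-Scott cluster process: the parents form a stationary Poisson point process on $\mathbb{R}^2$ of intensity $\lambda_p>0$; to each parent $x$ is attached an independent cluster with a Poisson number (mean $\bar c>0$) of points located at $x$ plus i.i.d. displacements with isotropic probability density $f$; $\phi$ is the union of all clusters (parents not included), with intensity $\lambda=\lambda_p\bar c$. The interference at $z$ is $I_\phi(z)=\sum_{x\in\phi}h_xg(x-z)$, where the power fading coefficients $h_x$ are i.i.d. nonnegative with CDF $F_h$, independent of $\phi$; $\bar F_I(y)=\mathbb{P}(I_\phi(z)\ge y)$ is computed under the reduced Palm distribution of $\phi$ at the origin (conditioning on a point at the origin and removing it). $E_0^{!}$ is the corresponding expectation: $E_0^![F(\phi)]=\frac{1}{\lambda|B|}E\sum_{x\in\phi\cap B}F((\phi-x)\setminus\{0\})$ for any Borel $B$ of finite positive area. The conditional generating functional is $\mathcal{G}(v)=E_0^{!}(\prod_{x\in\phi}v(x))$. For this process it equals $$\mathcal{G}(v)=\exp\Big(-\lambda_p\int_{\mathbb{R}^2}[1-M((v*f)(x))]\,dx\Big)\int_{\mathbb{R}^2}M((v*f)(y))f(y)\,dy,\quad M(t)=e^{-\bar c(1-t)} .$$ The second order product density is $\rho^{(2)}(x)=\lambda^2+\lambda\bar c\,(f*f)(x)$. $*$ is convolution on $\mathbb{R}^2$, and $a(y)\sim b(y)$ means $a(y)/b(y)\to1$ as $y\to\infty$.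
   Formalization: Two assumptions are added: the integral of ν^(2/α) dF_h(ν) is finite, and f*f is continuous at z (automatic if f is bounded or square integrable); without them θ₁ can be infinite, e.g. at z=0 when f is not square integrable. *)

theory Defs
  imports "HOL-Probability.Probability"
begin

type_synonym plane = "real ^ 2"

text \<open>A point process on a probability space is a random set of points. The counts are stated on
  bounded Borel sets, where the configuration is almost surely finite. The Poisson weights are
  written out because \<open>poisson_pmf\<close> requires a positive rate, while Lebesgue null sets \<open>A\<close> have
  rate \<open>0\<close> (here \<open>0 ^ 0 = 1\<close> gives the point mass at \<open>0\<close>).\<close>

definition poisson_process :: "'w measure \<Rightarrow> real \<Rightarrow> ('w \<Rightarrow> plane set) \<Rightarrow> bool" where
  "poisson_process M l P \<longleftrightarrow>
     (AE \<omega> in M. \<forall>A. bounded A \<longrightarrow> finite (P \<omega> \<inter> A)) \<and>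
     (\<forall>A\<in>sets borel. bounded A \<longrightarrow>
        (\<lambda>\<omega>. card (P \<omega> \<inter> A)) \<in> measurable M (count_space UNIV) \<and>
        (\<forall>k. measure M {\<omega> \<in> space M. card (P \<omega> \<inter> A) = k} =
             (l * measure lborel A) ^ k / fact k * exp (- (l * measure lborel A)))) \<and>
     (\<forall>A :: nat \<Rightarrow> plane set. (\<forall>i. A i \<in> sets borel \<and> bounded (A i)) \<longrightarrow> disjoint_family A \<longrightarrow>
        prob_space.indep_vars M (\<lambda>_. count_space UNIV) (\<lambda>i \<omega>. card (P \<omega> \<inter> A i)) UNIV)"

definition isotropic_density :: "(plane \<Rightarrow> real) \<Rightarrow> bool" where
  "isotropic_density f \<longleftrightarrow>
     f \<in> borel_measurable borel \<and> (\<forall>x. 0 \<le> f x) \<and>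
     integrable lborel f \<and> (\<integral>x. f x \<partial>lborel) = 1 \<and>
     (\<forall>x y. norm x = norm y \<longrightarrow> f x = f y)"

text \<open>The law of one cluster: a Poisson number \<open>n\<close> of points and, independently, an i.i.d. sequence
  of displacements with density \<open>f\<close>, of which only the first \<open>n\<close> are used.\<close>

definition cluster_law :: "real \<Rightarrow> (plane \<Rightarrow> real) \<Rightarrow> (nat \<times> (nat \<Rightarrow> plane)) measure" where
  "cluster_law c f =
     measure_pmf (poisson_pmf c) \<Otimes>\<^sub>M (\<Pi>\<^sub>M j\<in>(UNIV::nat set). density lborel (\<lambda>x. ennreal (f x)))"

text \<open>The parents are enumerated without repetition by \<open>X\<close>. The cluster of the parent \<open>X i\<close> consists
  of the points \<open>X i + D i j\<close> with \<open>j < N i\<close>. The clusters \<open>(N i, D i)\<close> are i.i.d. with law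
  \<open>cluster_law c f\<close> and independent of the whole parent sequence; the equation between the joint
  law and the product measure says exactly this.\<close>

definition neyman_scott_process ::
    "'w measure \<Rightarrow> real \<Rightarrow> real \<Rightarrow> (plane \<Rightarrow> real) \<Rightarrow> ('w \<Rightarrow> plane set) \<Rightarrow> bool" where
  "neyman_scott_process M lp c f \<phi> \<longleftrightarrow>
     (\<exists>(X :: nat \<Rightarrow> 'w \<Rightarrow> plane) (N :: nat \<Rightarrow> 'w \<Rightarrow> nat) (D :: nat \<Rightarrow> nat \<Rightarrow> 'w \<Rightarrow> plane).
        poisson_process M lp (\<lambda>\<omega>. range (\<lambda>i. X i \<omega>)) \<and>
        (AE \<omega> in M. inj (\<lambda>i. X i \<omega>)) \<and>
        (\<lambda>\<omega> i. X i \<omega>) \<in> measurable M (\<Pi>\<^sub>M i\<in>UNIV. borel) \<and>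
        (\<lambda>\<omega> i. (N i \<omega>, \<lambda>j. D i j \<omega>)) \<in> measurable M (\<Pi>\<^sub>M i\<in>UNIV. cluster_law c f) \<and>
        distr M ((\<Pi>\<^sub>M i\<in>UNIV. borel) \<Otimes>\<^sub>M (\<Pi>\<^sub>M i\<in>UNIV. cluster_law c f))
            (\<lambda>\<omega>. (\<lambda>i. X i \<omega>, \<lambda>i. (N i \<omega>, \<lambda>j. D i j \<omega>))) =
          distr M (\<Pi>\<^sub>M i\<in>UNIV. borel) (\<lambda>\<omega> i. X i \<omega>) \<Otimes>\<^sub>M (\<Pi>\<^sub>M i\<in>UNIV. cluster_law c f) \<and>
        (\<forall>\<omega>\<in>space M. \<phi> \<omega> = {X i \<omega> + D i j \<omega> | i j. j < N i \<omega>}))"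

text \<open>The reduced Palm expectation at the origin of a stationary process \<open>\<phi>\<close> of intensity \<open>l\<close>,
  computed from the sampling window \<open>B\<close> (Borel, of finite positive area).\<close>

definition reduced_palm_expectation ::
    "'w measure \<Rightarrow> ('w \<Rightarrow> plane set) \<Rightarrow> real \<Rightarrow> plane set \<Rightarrow> (plane set \<Rightarrow> real) \<Rightarrow> real" where
  "reduced_palm_expectation M \<phi> l B F =
     1 / (l * measure lborel B) *
     (\<integral>\<omega>. (\<Sum>\<^sub>\<infinity>x\<in>\<phi> \<omega> \<inter> B. F ((\<lambda>y. y - x) ` \<phi> \<omega> - {0})) \<partial>M)"

text \<open>Unordered product over a possibly infinite set, the multiplicative analogue of \<open>infsum\<close>.
  It is only used for \<open>[0,1]\<close>-valued \<open>v\<close>, where the limit always exists.\<close>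

definition config_prod :: "(plane \<Rightarrow> real) \<Rightarrow> plane set \<Rightarrow> real" where
  "config_prod v \<psi> = Lim (finite_subsets_at_top \<psi>) (\<lambda>S. \<Prod>x\<in>S. v x)"

definition cond_gen_functional ::
    "'w measure \<Rightarrow> ('w \<Rightarrow> plane set) \<Rightarrow> real \<Rightarrow> plane set \<Rightarrow> (plane \<Rightarrow> real) \<Rightarrow> real" where
  "cond_gen_functional M \<phi> l B v = reduced_palm_expectation M \<phi> l B (config_prod v)"

definition convolve :: "(plane \<Rightarrow> real) \<Rightarrow> (plane \<Rightarrow> real) \<Rightarrow> plane \<Rightarrow> real" where
  "convolve u v x = (\<integral>y. u y * v (x - y) \<partial>lborel)"

text \<open>Here \<open>lp\<close> is the parent intensity and \<open>c\<close> the mean cluster size, so the intensity of the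
  process is \<open>lp * c\<close>. By stationarity the density depends only on the difference \<open>x\<close> of the two points.\<close>

definition product_density2 :: "real \<Rightarrow> real \<Rightarrow> (plane \<Rightarrow> real) \<Rightarrow> plane \<Rightarrow> real" where
  "product_density2 lp c f x = (lp * c)\<^sup>2 + (lp * c) * c * convolve f f x"

text \<open>At the single point \<open>0\<close>, where the path loss is infinite, it takes the value \<open>0 powr (-\<alpha>) = 0\<close>.
  There \<open>y / path_loss \<alpha> 0 = 0\<close>, which agrees with \<open>y / \<infinity> = 0\<close>.\<close>

definition path_loss :: "real \<Rightarrow> plane \<Rightarrow> real" where
  "path_loss \<alpha> x = norm x powr (- \<alpha>)"

text \<open>In the following \<open>H\<close> is the law of the power fading coefficient, so that \<open>cdf H\<close> is its CDF
  and integration against \<open>H\<close> is integration with respect to the CDF.\<close>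

definition ccdf_lower ::
    "'w measure \<Rightarrow> ('w \<Rightarrow> plane set) \<Rightarrow> real \<Rightarrow> real \<Rightarrow> plane set \<Rightarrow>
     real measure \<Rightarrow> real \<Rightarrow> plane \<Rightarrow> real \<Rightarrow> real" where
  "ccdf_lower M \<phi> lp c B H \<alpha> z y =
     1 - cond_gen_functional M \<phi> (lp * c) B (\<lambda>x. cdf H (y / path_loss \<alpha> (x - z)))"

definition markov_term ::
    "real \<Rightarrow> real \<Rightarrow> (plane \<Rightarrow> real) \<Rightarrow> real measure \<Rightarrow> real \<Rightarrow> plane \<Rightarrow> real \<Rightarrow> real" where
  "markov_term lp c f H \<alpha> z y =
     1 / (y * (lp * c)) *
     (\<integral>x. path_loss \<alpha> (x - z) * product_density2 lp c f x *
           (LINT \<nu>:{0..y / path_loss \<alpha> (x - z)}|H. \<nu>) \<partial>lborel)"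

definition ccdf_upper ::
    "'w measure \<Rightarrow> ('w \<Rightarrow> plane set) \<Rightarrow> real \<Rightarrow> real \<Rightarrow> (plane \<Rightarrow> real) \<Rightarrow> plane set \<Rightarrow>
     real measure \<Rightarrow> real \<Rightarrow> plane \<Rightarrow> real \<Rightarrow> real" where
  "ccdf_upper M \<phi> lp c f B H \<alpha> z y =
     1 - (1 - markov_term lp c f H \<alpha> z y) *
         cond_gen_functional M \<phi> (lp * c) B (\<lambda>x. cdf H (y / path_loss \<alpha> (x - z)))"

definition theta1 ::
    "real \<Rightarrow> real \<Rightarrow> (plane \<Rightarrow> real) \<Rightarrow> real measure \<Rightarrow> real \<Rightarrow> plane \<Rightarrow> real" where
  "theta1 lp c f H \<alpha> z =
     pi * c * (convolve f f z + lp) * (LINT \<nu>:{0..}|H. \<nu> powr (2 / \<alpha>))"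

definition theta2 ::
    "real \<Rightarrow> real \<Rightarrow> (plane \<Rightarrow> real) \<Rightarrow> real measure \<Rightarrow> real \<Rightarrow> plane \<Rightarrow> real" where
  "theta2 lp c f H \<alpha> z = 2 * theta1 lp c f H \<alpha> z / (\<alpha> - 2)"

end

theory Submission
  imports Defs
begin

text \<open>Let \<open>u\<^sub>y(x) = P(h > y \<parallel>x - z\<parallel>\<^sup>\<alpha>)\<close>, so that the conditional generating functional \<open>G\<close> is
  evaluated at \<open>1 - u\<^sub>y\<close>. The Bonferroni inequalities bound \<open>1 - G\<close> from above by the reduced Palm
  expectation \<open>\<Phi>(y)\<close> of the sum of \<open>u\<^sub>y\<close> over the points, and from below by \<open>\<Phi>(y)\<close> minus the same
  expectation of the sum over pairs. The first is an integral against the second factorial moment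
  measure, \<open>\<Phi>(y) = \<integral>u\<^sub>y(x) (\<lambda> + c (f * f)(x)) dx\<close>. The second is an integral against the third one
  and is at most \<open>\<Phi>(y) (\<Phi>(y) + c \<delta>(y))\<close>, where \<open>\<delta>(y)\<close> is the supremum of the convolution of \<open>u\<^sub>y\<close>
  and \<open>f\<close>, which tends to \<open>0\<close> because \<open>f\<close> is integrable and the integral of \<open>u\<^sub>y\<close> tends to \<open>0\<close>.
  Hence \<open>1 - G \<sim> \<Phi>\<close>.

  Integrating over the fading variable last, \<open>y\<^bsup>2/\<alpha>\<^esup> \<Phi>(y) = E(h\<^bsup>2/\<alpha>\<^esup> W((h/y)\<^bsup>1/\<alpha>\<^esup>))\<close>, where \<open>r\<^sup>2 W(r)\<close> is
  the integral of \<open>\<lambda> + c (f * f)\<close> over the ball of radius \<open>r\<close> around \<open>z\<close>; as \<open>W\<close> is bounded and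
  continuous at \<open>0\<close>, dominated convergence gives \<open>\<theta>\<^sub>1\<close>. Finally
  \<open>\<phi>(y) = \<integral>\<^sub>0\<^sup>1 \<Phi>(\<tau> y) d\<tau> - \<Phi>(y)\<close>, which gives \<open>(\<alpha>/(\<alpha> - 2) - 1) \<theta>\<^sub>1 = \<theta>\<^sub>2\<close>.\<close>

section \<open>Sums over countable index types and Poisson means\<close>

text \<open>The Palm average runs over the points in a window \<open>B\<close>, so expanding the
  product to second order produces factorial moments of order two and three of the whole process.
  They are reduced to those of the parents and of one cluster. The parents are given only through
  their counts in bounded Borel sets, so their factorial moment measures are first recovered from
  these counts.

  The delicate part of the third moment comes from two points that share a cluster: it is linear,
  not quadratic, in the mass of \<open>u\<close>, and an unbounded \<open>f\<close> gives no rate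
  for it. Cutting \<open>f\<close> at a high level shows that it is still of smaller order than
  \<Phi>.

  Continuity of \<open>f * f\<close> at \<open>z\<close> acts twice: it gives the limit of
  \<open>W\<close> at 0 and bounds \<open>W\<close> for small radii. For large radii the bound comes
  from the total mass 1 of \<open>f * f\<close>. If the fading vanishes almost surely, then
  \<theta>1 = 0 and the claim concerns functions that are eventually 0; this case is split off at
  the end.

  Sums over points are integrals in [0,\<infinity>] against counting measure, so that Tonelli and
  monotone convergence apply without summability conditions.\<close>

abbreviation esum :: "('a \<Rightarrow> ennreal) \<Rightarrow> ennreal" (binder "\<Sum>\<^sup>+" 10) where
  "esum g \<equiv> \<integral>\<^sup>+i. g i \<partial>count_space UNIV"

lemma esum_swap:
  "(\<Sum>\<^sup>+(i::'a::countable). \<Sum>\<^sup>+(j::'b). g i j) = (\<Sum>\<^sup>+j. \<Sum>\<^sup>+i. g i j)"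
  by (rule nn_integral_count_space_nn_integral[symmetric]) auto

lemma esum_prod: "(\<Sum>\<^sup>+p. g p) = (\<Sum>\<^sup>+(i::'a::countable). \<Sum>\<^sup>+(j::'b::countable). g (i, j))"
proof -
  interpret sigma_finite_measure "count_space (UNIV::'b set)"
    by (rule sigma_finite_measure_count_space_countable) simp
  show ?thesis
    by (subst nn_integral_count_space_prod_eq[symmetric], subst nn_integral_fst[symmetric])
      (auto simp: measurable_pair_measure_countable1 pair_measure_countable)
qed

lemma borel_measurable_esum[measurable (raw)]:
  fixes g :: "'w \<Rightarrow> 'i::countable \<Rightarrow> ennreal"
  assumes "\<And>i. (\<lambda>\<omega>. g \<omega> i) \<in> borel_measurable M"
  shows "(\<lambda>\<omega>. \<Sum>\<^sup>+i. g \<omega> i) \<in> borel_measurable M"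
proof -
  interpret sigma_finite_measure "count_space (UNIV::'i set)"
    by (rule sigma_finite_measure_count_space_countable) simp
  have "(\<lambda>(i, \<omega>). g \<omega> i) \<in> borel_measurable (count_space UNIV \<Otimes>\<^sub>M M)"
    by (rule measurable_pair_measure_countable1) (use assms in auto)
  from measurable_compose[OF measurable_pair_swap' this]
  have "case_prod g \<in> borel_measurable (M \<Otimes>\<^sub>M count_space UNIV)"
    by (simp add: case_prod_beta')
  then show ?thesis by (rule borel_measurable_nn_integral)
qed

lemma nn_integral_esum:
  fixes g :: "'i::countable \<Rightarrow> 'w \<Rightarrow> ennreal"
  assumes "\<And>i. g i \<in> borel_measurable M"
  shows "(\<integral>\<^sup>+\<omega>. (\<Sum>\<^sup>+i. g i \<omega>) \<partial>M) = (\<Sum>\<^sup>+i. \<integral>\<^sup>+\<omega>. g i \<omega> \<partial>M)"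
  by (rule nn_integral_count_space_nn_integral) (use assms in auto)

lemma nn_integral_esum2:
  fixes g :: "'i::countable \<Rightarrow> 'j::countable \<Rightarrow> 'w \<Rightarrow> ennreal"
  assumes [measurable]: "\<And>i j. g i j \<in> borel_measurable M"
  shows "(\<integral>\<^sup>+\<omega>. (\<Sum>\<^sup>+i. \<Sum>\<^sup>+j. g i j \<omega>) \<partial>M) = (\<Sum>\<^sup>+i. \<Sum>\<^sup>+j. \<integral>\<^sup>+\<omega>. g i j \<omega> \<partial>M)"
  by (subst nn_integral_esum) (auto intro!: nn_integral_cong nn_integral_esum)

lemma nn_integral_esum3:
  fixes g :: "'i::countable \<Rightarrow> 'j::countable \<Rightarrow> 'k::countable \<Rightarrow> 'w \<Rightarrow> ennreal"
  assumes [measurable]: "\<And>i j k. g i j k \<in> borel_measurable M"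
  shows "(\<integral>\<^sup>+\<omega>. (\<Sum>\<^sup>+i. \<Sum>\<^sup>+j. \<Sum>\<^sup>+k. g i j k \<omega>) \<partial>M) = (\<Sum>\<^sup>+i. \<Sum>\<^sup>+j. \<Sum>\<^sup>+k. \<integral>\<^sup>+\<omega>. g i j k \<omega> \<partial>M)"
  by (subst nn_integral_esum) (auto intro!: nn_integral_cong nn_integral_esum2)

lemma esum_single: "(\<Sum>\<^sup>+k. if k = i then g k else 0) = g i"
proof -
  have "(\<Sum>\<^sup>+k. if k = i then g k else 0) = (\<Sum>k\<in>{i}. if k = i then g k else 0)"
    by (rule nn_integral_count_space') auto
  then show ?thesis by simp
qed

section \<open>Counting ordered tuples of distinct indices\<close>

lemma esum_of_bool: "finite S \<Longrightarrow> (\<Sum>\<^sup>+k. of_bool (k \<in> S)) = of_nat (card S)"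
  using nn_integral_count_space'[of S UNIV "\<lambda>k. of_bool (k \<in> S) :: ennreal"] by simp

text \<open>Only the number \<open>w\<close> of partners of an element of \<open>I\<close> matters,
  and it must be the same for all of them. This covers both uses: \<open>J\<close> disjoint from
  \<open>I\<close>, with \<open>w = card J\<close>, and \<open>J = I\<close>, with
  \<open>w = card I - 1\<close>.\<close>

lemma card_distinct_pairs:
  assumes "finite I" "finite J" "\<And>i. i \<in> I \<Longrightarrow> card (J - {i}) = w"
  shows "(\<Sum>\<^sup>+i. \<Sum>\<^sup>+k. of_bool (i \<noteq> k \<and> i \<in> I \<and> k \<in> J)) = of_nat (card I) * of_nat w"
proof -
  have "(\<Sum>\<^sup>+k. of_bool (i \<noteq> k \<and> i \<in> I \<and> k \<in> J)) = of_bool (i \<in> I) * of_nat w" for i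
  proof -
    have "(\<Sum>\<^sup>+k. of_bool (i \<noteq> k \<and> i \<in> I \<and> k \<in> J)) =
        (\<Sum>\<^sup>+k. of_bool (i \<in> I) * (of_bool (k \<in> J - {i}) :: ennreal))"
      by (rule nn_integral_cong) auto
    also have "\<dots> = of_bool (i \<in> I) * of_nat (card (J - {i}))"
      by (subst nn_integral_cmult, simp, subst esum_of_bool) (use assms(2) in auto)
    finally show ?thesis using assms(3)[of i] by (cases "i \<in> I") auto
  qed
  then show ?thesis using assms(1) by (simp add: nn_integral_multc esum_of_bool)
qed

text \<open>The indices are chosen one after the other, with \<open>w\<close> choices for the second
  and \<open>v\<close> for the third whatever came before. Every pattern of equal or disjoint sets
  among \<open>I\<close>, \<open>J\<close>, \<open>L\<close> is an instance.\<close>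

lemma card_distinct_triples:
  assumes "finite I" "finite J" "finite L" "\<And>i. i \<in> I \<Longrightarrow> card (J - {i}) = w"
    and "\<And>i k. i \<in> I \<Longrightarrow> k \<in> J \<Longrightarrow> i \<noteq> k \<Longrightarrow> card (L - {i, k}) = v"
  shows "(\<Sum>\<^sup>+i. \<Sum>\<^sup>+k. \<Sum>\<^sup>+m. of_bool (i \<noteq> k \<and> i \<noteq> m \<and> k \<noteq> m \<and> i \<in> I \<and> k \<in> J \<and> m \<in> L)) =
    of_nat (card I) * of_nat w * of_nat v"
proof -
  have "(\<Sum>\<^sup>+m. of_bool (i \<noteq> k \<and> i \<noteq> m \<and> k \<noteq> m \<and> i \<in> I \<and> k \<in> J \<and> m \<in> L)) =
      of_bool (i \<noteq> k \<and> i \<in> I \<and> k \<in> J) * of_nat v" for i k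
  proof -
    have "(\<Sum>\<^sup>+m. of_bool (i \<noteq> k \<and> i \<noteq> m \<and> k \<noteq> m \<and> i \<in> I \<and> k \<in> J \<and> m \<in> L)) =
        (\<Sum>\<^sup>+m. of_bool (i \<noteq> k \<and> i \<in> I \<and> k \<in> J) * (of_bool (m \<in> L - {i, k}) :: ennreal))"
      by (rule nn_integral_cong) auto
    also have "\<dots> = of_bool (i \<noteq> k \<and> i \<in> I \<and> k \<in> J) * of_nat (card (L - {i, k}))"
      by (subst nn_integral_cmult, simp, subst esum_of_bool) (use assms(3) in auto)
    finally show ?thesis using assms(5)[of i k] by (cases "i \<noteq> k \<and> i \<in> I \<and> k \<in> J") auto
  qed
  then show ?thesis
    using card_distinct_pairs[OF assms(1,2,4)] by (simp add: nn_integral_multc del: of_bool_conj)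
qed

section \<open>Factorial moments of the Poisson law\<close>

lemma poisson_sums_binomial:
  fixes m :: real
  shows "(\<lambda>k. real (k choose n) * (m ^ k / fact k * exp (- m))) sums (m ^ n / fact n)"
proof -
  have "(\<lambda>k. m ^ k / fact k) sums exp m"
    using exp_converges[of m] by (simp add: field_simps scaleR_conv_of_real)
  then have "(\<lambda>k. m ^ n / fact n * exp (- m) * (m ^ k / fact k)) sums (m ^ n / fact n * exp (- m) * exp m)"
    by (rule sums_mult)
  moreover have "m ^ n / fact n * exp (- m) * exp m = m ^ n / fact n"
    by (simp add: mult.assoc mult_exp_exp del: times_divide_eq_left)
  \<comment> \<open>Terms with index below \<open>n\<close> vanish, so only the shifted series
    counts; the binomial coefficient cancels the factorial and leaves the exponential
    series.\<close>
  moreover have "real (k + n choose n) * (m ^ (k + n) / fact (k + n) * exp (- m)) =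
      m ^ n / fact n * exp (- m) * (m ^ k / fact k)" for k
    by (simp add: binomial_fact power_add field_simps)
  ultimately have "(\<lambda>k. real (k + n choose n) * (m ^ (k + n) / fact (k + n) * exp (- m))) sums (m ^ n / fact n)"
    by (simp only:)
  then show ?thesis
    by (subst (asm) sums_zero_iff_shift) auto
qed

text \<open>The weights are written out because the rate will be an intensity times an area, and the
  area may be 0.\<close>

definition poisson_mean :: "real \<Rightarrow> (nat \<Rightarrow> ennreal) \<Rightarrow> ennreal" where
  "poisson_mean m g = (\<Sum>\<^sup>+k. g k * ennreal (m ^ k / fact k * exp (- m)))"

lemma poisson_mean_binomial:
  assumes "0 \<le> m"
  shows "poisson_mean m (\<lambda>k. of_nat (k choose n)) = ennreal (m ^ n / fact n)"
  unfolding poisson_mean_def nn_integral_count_space_nat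
  using poisson_sums_binomial[of n m] assms
  by (simp add: ennreal_of_nat_eq_real_of_nat ennreal_mult[symmetric] sums_ennreal sums_unique2
      suminf_ennreal2 sums_summable sums_unique[symmetric])

lemma poisson_mean_1:
  assumes "0 \<le> m" shows "poisson_mean m of_nat = ennreal m"
  using poisson_mean_binomial[OF assms, of 1] by simp

lemma poisson_mean_cmult: "poisson_mean m (\<lambda>k. C * g k) = C * poisson_mean m g"
  unfolding poisson_mean_def by (simp add: nn_integral_cmult[symmetric] mult.assoc)

text \<open>The falling factorial \<open>k * (k - 1)\<close> is \<open>2 * (k choose 2)\<close>,
  also at \<open>k = 0\<close> with truncated subtraction. Its mean is the same as that of a product
  of two independent counts of mean \<open>m\<close>.\<close>

lemma poisson_mean_2:
  assumes "0 \<le> m"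
  shows "poisson_mean m (\<lambda>k. of_nat k * of_nat (k - 1)) = ennreal m * ennreal m"
proof -
  have "of_nat k * of_nat (k - 1) = (2 * of_nat (k choose 2) :: ennreal)" for k
  proof -
    have "k * (k - 1) = 2 * (k choose 2)" by (cases k) (simp_all add: choose_two)
    then show ?thesis by (metis of_nat_mult of_nat_numeral)
  qed
  then have "poisson_mean m (\<lambda>k. of_nat k * of_nat (k - 1)) = 2 * ennreal (m ^ 2 / fact 2)"
    using assms by (simp only: poisson_mean_cmult poisson_mean_binomial)
  also have "\<dots> = ennreal (2 * (m ^ 2 / fact 2))"
    using assms by (subst ennreal_mult) auto
  also have "\<dots> = ennreal m * ennreal m"
    using assms by (simp add: ennreal_mult power2_eq_square)
  finally show ?thesis .
qed

lemma poisson_mean_3: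
  assumes "0 \<le> m"
  shows "poisson_mean m (\<lambda>k. of_nat k * of_nat (k - 1) * of_nat (k - 2)) = ennreal m * ennreal m * ennreal m"
proof -
  have "of_nat k * of_nat (k - 1) * of_nat (k - 2) = (6 * of_nat (k choose 3) :: ennreal)" for k
  proof -
    have "k * (k - 1) * (k - 2) = 6 * (k choose 3)"
    proof (cases "k < 3")
      case True
      then have "k = 0 \<or> k = 1 \<or> k = 2" by auto
      then show ?thesis by auto
    next
      case False
      then obtain j where j: "k = Suc (Suc (Suc j))"
        by (metis Suc_le_D not_less numeral_3_eq_3 Suc_le_mono)
      have "3 * (k choose 3) = k * ((k - 1) choose 2)"
        using Suc_times_binomial_eq[of "k - 1" 2] j by (simp add: numeral_3_eq_3 numeral_2_eq_2 mult.commute)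
      then have "6 * (k choose 3) = k * (2 * ((k - 1) choose 2))" by simp
      moreover have "2 * ((k - 1) choose 2) = (k - 1) * (k - 2)" using j by (simp add: choose_two)
      ultimately have "6 * (k choose 3) = k * ((k - 1) * (k - 2))" by (simp only:)
      then show ?thesis by (simp add: mult.assoc)
    qed
    then show ?thesis by (metis of_nat_mult of_nat_numeral)
  qed
  then have "poisson_mean m (\<lambda>k. of_nat k * of_nat (k - 1) * of_nat (k - 2)) = 6 * ennreal (m ^ 3 / fact 3)"
    using assms by (simp only: poisson_mean_cmult poisson_mean_binomial)
  also have "\<dots> = ennreal (6 * (m ^ 3 / fact 3))"
    using assms by (subst ennreal_mult) auto
  also have "\<dots> = ennreal m * ennreal m * ennreal m"
    using assms by (simp add: ennreal_mult power3_eq_cube fact_numeral)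
  finally show ?thesis .
qed

section \<open>Product measures\<close>

text \<open>The hypotheses of the uniqueness theorem for measures on an intersection-stable
  generator, bundled so that they pass to products. The sequence is increasing so that diagonal
  products exhaust the product space.\<close>

definition exhausting_generator :: "'a measure \<Rightarrow> 'a set set \<Rightarrow> (nat \<Rightarrow> 'a set) \<Rightarrow> bool" where
  "exhausting_generator A G Q \<longleftrightarrow> Int_stable G \<and> G \<subseteq> Pow (space A) \<and> sets A = sigma_sets (space A) G \<and>
     range Q \<subseteq> G \<and> (\<Union>n. Q n) = space A \<and> incseq Q"

lemma exhausting_generator_eqI:
  assumes "exhausting_generator A G Q" "sets M = sets A" "sets N = sets A"
    and "\<And>X. X \<in> G \<Longrightarrow> emeasure M X = emeasure N X" "\<And>n. emeasure M (Q n) \<noteq> \<infinity>"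
  shows "M = N"
  by (rule measure_eqI_generator_eq[where E = G and \<Omega> = "space A" and A = Q])
    (use assms in \<open>auto simp: exhausting_generator_def\<close>)

lemma exhausting_generator_pair:
  assumes "exhausting_generator A G Q" "exhausting_generator A' G' Q'"
  shows "exhausting_generator (A \<Otimes>\<^sub>M A') {a \<times> b | a b. a \<in> G \<and> b \<in> G'} (\<lambda>n. Q n \<times> Q' n)"
proof -
  let ?G = "{a \<times> b | a b. a \<in> G \<and> b \<in> G'}"
  note G = assms[unfolded exhausting_generator_def]
  from G have stable: "Int_stable G" "Int_stable G'" and union: "(\<Union>n. Q n) = space A" "(\<Union>n. Q' n) = space A'"
    and inc: "incseq Q" "incseq Q'" and sub: "G \<subseteq> Pow (space A)" "G' \<subseteq> Pow (space A')"
    and range: "range Q \<subseteq> G" "range Q' \<subseteq> G'"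
    and sets: "sets A = sigma_sets (space A) G" "sets A' = sigma_sets (space A') G'" by simp_all
  have "Int_stable ?G"
  proof (rule Int_stableI)
    fix x y assume "x \<in> ?G" "y \<in> ?G"
    then obtain a b a' b' where "x = a \<times> b" "y = a' \<times> b'" "a \<in> G" "b \<in> G'" "a' \<in> G" "b' \<in> G'" by blast
    then have "x \<inter> y = (a \<inter> a') \<times> (b \<inter> b')" "a \<inter> a' \<in> G" "b \<inter> b' \<in> G'"
      using stable by (auto simp: Int_stable_def)
    then show "x \<inter> y \<in> ?G" by blast
  qed
  moreover have "?G \<subseteq> Pow (space (A \<Otimes>\<^sub>M A'))"
    using sub unfolding space_pair_measure by blast
  moreover have "sets (A \<Otimes>\<^sub>M A') = sigma_sets (space (A \<Otimes>\<^sub>M A')) ?G"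
  proof -
    have "sets (A \<Otimes>\<^sub>M A') = sets (sigma (space A \<times> space A') ?G)"
      by (rule sets_pair_eq[where Ca = "range Q" and Cb = "range Q'"]) (use sub range sets union in auto)
    also have "\<dots> = sigma_sets (space A \<times> space A') ?G"
      using sub by (intro sets_measure_of) blast
    finally show ?thesis by (simp add: space_pair_measure)
  qed
  moreover have "range (\<lambda>n. Q n \<times> Q' n) \<subseteq> ?G" using range by blast
  moreover have "(\<Union>n. Q n \<times> Q' n) = space (A \<Otimes>\<^sub>M A')"
  proof (intro equalityI subsetI)
    fix t assume "t \<in> space (A \<Otimes>\<^sub>M A')"
    then have "fst t \<in> (\<Union>n. Q n)" "snd t \<in> (\<Union>n. Q' n)" using union by (auto simp: space_pair_measure)
    then obtain i j where "fst t \<in> Q i" "snd t \<in> Q' j" by blast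
    \<comment> \<open>The components lie in \<open>Q i\<close> and \<open>Q' j\<close> with
      different indices; monotonicity moves both to the common index \<open>i + j\<close>.\<close>
    then have "fst t \<in> Q (i + j)" "snd t \<in> Q' (i + j)"
      using incseqD[OF inc(1), of i "i + j"] incseqD[OF inc(2), of j "i + j"] by auto
    then show "t \<in> (\<Union>n. Q n \<times> Q' n)" by (auto simp: mem_Times_iff)
  next
    fix t assume "t \<in> (\<Union>n. Q n \<times> Q' n)"
    then have "fst t \<in> (\<Union>n. Q n)" "snd t \<in> (\<Union>n. Q' n)" by (auto simp: mem_Times_iff)
    then show "t \<in> space (A \<Otimes>\<^sub>M A')" using union by (auto simp: space_pair_measure mem_Times_iff)
  qed
  moreover have "incseq (\<lambda>n. Q n \<times> Q' n)"
    using inc unfolding incseq_def by (meson Sigma_mono)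
  ultimately show ?thesis unfolding exhausting_generator_def by blast
qed

text \<open>Distinct coordinates of a product measure are independent: over a box the event is a
  cylinder on three indices, whose measure is a product, and boxes determine the joint law.\<close>

lemma PiM_three_coordinates:
  assumes "prob_space \<nu>" and ijk: "i \<noteq> j" "i \<noteq> k" "j \<noteq> k"
  shows "distr (\<Pi>\<^sub>M i\<in>(UNIV::'i set). \<nu>) (\<nu> \<Otimes>\<^sub>M \<nu> \<Otimes>\<^sub>M \<nu>) (\<lambda>x. (x i, x j, x k)) = \<nu> \<Otimes>\<^sub>M \<nu> \<Otimes>\<^sub>M \<nu>"
proof -
  interpret prob_space \<nu> by fact
  interpret P: product_prob_space "\<lambda>_::'i. \<nu>" UNIV ..
  interpret V2: pair_prob_space \<nu> \<nu> ..
  let ?D = "distr (\<Pi>\<^sub>M i\<in>UNIV. \<nu>) (\<nu> \<Otimes>\<^sub>M \<nu> \<Otimes>\<^sub>M \<nu>) (\<lambda>x. (x i, x j, x k))"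
  have rect: "emeasure ?D (a \<times> b \<times> c) = emeasure (\<nu> \<Otimes>\<^sub>M \<nu> \<Otimes>\<^sub>M \<nu>) (a \<times> b \<times> c)"
    if [measurable]: "a \<in> sets \<nu>" "b \<in> sets \<nu>" "c \<in> sets \<nu>" for a b c
  proof -
    let ?X = "\<lambda>r. if r = i then a else if r = j then b else c"
    have "emeasure ?D (a \<times> b \<times> c) =
        emeasure (\<Pi>\<^sub>M i\<in>UNIV. \<nu>) ((\<lambda>x. (x i, x j, x k)) -` (a \<times> b \<times> c) \<inter> space (\<Pi>\<^sub>M i\<in>UNIV. \<nu>))"
      by (rule emeasure_distr) measurable
    also have "(\<lambda>x. (x i, x j, x k)) -` (a \<times> b \<times> c) \<inter> space (\<Pi>\<^sub>M i\<in>UNIV. \<nu>) =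
        {x\<in>space (\<Pi>\<^sub>M i\<in>UNIV. \<nu>). \<forall>r\<in>{i, j, k}. x r \<in> ?X r}"
      using ijk by auto
    also have "emeasure (\<Pi>\<^sub>M i\<in>UNIV. \<nu>) \<dots> = (\<Prod>r\<in>{i, j, k}. emeasure \<nu> (?X r))"
      by (rule P.emeasure_PiM_Collect) auto
    also have "\<dots> = emeasure \<nu> a * (emeasure \<nu> b * emeasure \<nu> c)"
      using ijk by auto
    finally show ?thesis by (simp add: V2.emeasure_pair_measure_Times emeasure_pair_measure_Times)
  qed
  show ?thesis
  proof (rule exhausting_generator_eqI)
    have "exhausting_generator \<nu> (sets \<nu>) (\<lambda>_. space \<nu>)"
      by (simp add: exhausting_generator_def sets.Int_stable sets.space_closed sets.sigma_sets_eq)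
    then show "exhausting_generator (\<nu> \<Otimes>\<^sub>M \<nu> \<Otimes>\<^sub>M \<nu>) {a \<times> b | a b. a \<in> sets \<nu> \<and> b \<in> {a \<times> b | a b. a \<in> sets \<nu> \<and> b \<in> sets \<nu>}}
        (\<lambda>n. space \<nu> \<times> space \<nu> \<times> space \<nu>)" by (intro exhausting_generator_pair)
    show "emeasure ?D (space \<nu> \<times> space \<nu> \<times> space \<nu>) \<noteq> \<infinity>" for n :: nat
      by (subst rect) (auto simp: V2.emeasure_pair_measure_Times emeasure_pair_measure_Times emeasure_space_1)
  qed (use rect in auto)
qed

lemma nn_integral_PiM_three_coordinates:
  assumes "prob_space \<nu>" and ijk: "i \<noteq> j" "i \<noteq> k" "j \<noteq> k"
    and F: "F \<in> borel_measurable (\<nu> \<Otimes>\<^sub>M \<nu> \<Otimes>\<^sub>M \<nu>)"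
  shows "(\<integral>\<^sup>+x. F (x i, x j, x k) \<partial>(\<Pi>\<^sub>M i\<in>(UNIV::'i set). \<nu>)) = (\<integral>\<^sup>+a. \<integral>\<^sup>+b. \<integral>\<^sup>+c. F (a, b, c) \<partial>\<nu> \<partial>\<nu> \<partial>\<nu>)"
proof -
  interpret prob_space \<nu> by fact
  interpret V2: pair_prob_space \<nu> \<nu> ..
  note F[measurable]
  have "(\<integral>\<^sup>+x. F (x i, x j, x k) \<partial>(\<Pi>\<^sub>M i\<in>(UNIV::'i set). \<nu>)) =
      (\<integral>\<^sup>+t. F t \<partial>distr (\<Pi>\<^sub>M i\<in>(UNIV::'i set). \<nu>) (\<nu> \<Otimes>\<^sub>M \<nu> \<Otimes>\<^sub>M \<nu>) (\<lambda>x. (x i, x j, x k)))"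
    by (subst nn_integral_distr) auto
  also have "\<dots> = (\<integral>\<^sup>+t. F t \<partial>(\<nu> \<Otimes>\<^sub>M \<nu> \<Otimes>\<^sub>M \<nu>))"
    using PiM_three_coordinates[OF assms(1) ijk] by simp
  also have "\<dots> = (\<integral>\<^sup>+a. \<integral>\<^sup>+q. F (a, q) \<partial>(\<nu> \<Otimes>\<^sub>M \<nu>) \<partial>\<nu>)"
    by (subst V2.nn_integral_fst[symmetric]) auto
  also have "\<dots> = (\<integral>\<^sup>+a. \<integral>\<^sup>+b. \<integral>\<^sup>+c. F (a, b, c) \<partial>\<nu> \<partial>\<nu> \<partial>\<nu>)"
    by (intro nn_integral_cong, subst nn_integral_fst[symmetric]) auto
  finally show ?thesis .
qed

lemma nn_integral_PiM_two_coordinates: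
  assumes "prob_space \<nu>" and ij: "i \<noteq> j"
    and F: "F \<in> borel_measurable (\<nu> \<Otimes>\<^sub>M \<nu>)"
  shows "(\<integral>\<^sup>+x. F (x i, x j) \<partial>(\<Pi>\<^sub>M i\<in>(UNIV::nat set). \<nu>)) = (\<integral>\<^sup>+a. \<integral>\<^sup>+b. F (a, b) \<partial>\<nu> \<partial>\<nu>)"
proof -
  interpret prob_space \<nu> by fact
  note F[measurable]
  \<comment> \<open>\<open>Suc (i + j)\<close> is a third index different from both; its coordinate
    integrates to 1.\<close>
  show ?thesis
    using nn_integral_PiM_three_coordinates[OF assms(1), of i j "Suc (i + j)" "\<lambda>(a, b, c). F (a, b)"] ij
    by (simp add: emeasure_space_1)
qed

lemma nn_integral_PiM_coordinate:
  assumes "prob_space \<nu>" and F: "F \<in> borel_measurable \<nu>"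
  shows "(\<integral>\<^sup>+x. F (x (i::nat)) \<partial>(\<Pi>\<^sub>M i\<in>UNIV. \<nu>)) = (\<integral>\<^sup>+a. F a \<partial>\<nu>)"
proof -
  interpret prob_space \<nu> by fact
  note F[measurable]
  show ?thesis
    using nn_integral_PiM_two_coordinates[OF assms(1), of i "Suc i" "\<lambda>(a, b). F a"]
    by (simp add: emeasure_space_1)
qed

section \<open>Factorial moments of a Poisson process\<close>

text \<open>A countable sum of weighted image measures, realised as one image of a density on the
  product with counting measure. It turns sums of expectations into integrals against a single
  measure, so that an identity checked on sets extends to all measurable \<open>F\<close>.\<close>

lemma weighted_image_measure:
  fixes h :: "'t::countable \<Rightarrow> 'w \<Rightarrow> 'b" and w :: "'t \<Rightarrow> ennreal"
  assumes "sigma_finite_measure M" and h[measurable]: "\<And>t. h t \<in> measurable M N"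
  obtains \<mu> where "sets \<mu> = sets N"
    "\<And>F. F \<in> borel_measurable N \<Longrightarrow> (\<integral>\<^sup>+x. F x \<partial>\<mu>) = (\<Sum>\<^sup>+t. w t * (\<integral>\<^sup>+\<omega>. F (h t \<omega>) \<partial>M))"
proof
  interpret sigma_finite_measure M by fact
  let ?P = "count_space UNIV \<Otimes>\<^sub>M M"
  let ?\<mu> = "distr (density ?P (\<lambda>(t, \<omega>). w t)) N (\<lambda>(t, \<omega>). h t \<omega>)"
  have [measurable]: "(\<lambda>(t, \<omega>). h t \<omega>) \<in> measurable ?P N"
    by (rule measurable_pair_measure_countable1) auto
  show "sets ?\<mu> = sets N" by simp
  fix F :: "'b \<Rightarrow> ennreal" assume [measurable]: "F \<in> borel_measurable N"
  have "(\<integral>\<^sup>+x. F x \<partial>?\<mu>) = (\<integral>\<^sup>+p. w (fst p) * F (h (fst p) (snd p)) \<partial>?P)"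
    by (subst nn_integral_distr) (auto simp: nn_integral_density split_beta')
  also have "\<dots> = (\<Sum>\<^sup>+t. \<integral>\<^sup>+\<omega>. w t * F (h t \<omega>) \<partial>M)"
    by (subst nn_integral_fst[symmetric]) (auto simp: split_beta')
  also have "\<dots> = (\<Sum>\<^sup>+t. w t * (\<integral>\<^sup>+\<omega>. F (h t \<omega>) \<partial>M))"
    by (intro nn_integral_cong nn_integral_cmult) measurable
  finally show "(\<integral>\<^sup>+x. F x \<partial>?\<mu>) = (\<Sum>\<^sup>+t. w t * (\<integral>\<^sup>+\<omega>. F (h t \<omega>) \<partial>M))" .
qed

lemma nn_integral_nat_valued:
  assumes [measurable]: "K \<in> measurable M (count_space UNIV)"
  shows "(\<integral>\<^sup>+\<omega>. g (K \<omega>) \<partial>M) = (\<Sum>\<^sup>+(k::nat). g k * emeasure M {\<omega>\<in>space M. K \<omega> = k})"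
proof -
  have "(\<integral>\<^sup>+\<omega>. g (K \<omega>) \<partial>M) = (\<integral>\<^sup>+\<omega>. (\<Sum>\<^sup>+k. g k * indicator {\<omega>\<in>space M. K \<omega> = k} \<omega>) \<partial>M)"
  proof (rule nn_integral_cong)
    fix \<omega> assume "\<omega> \<in> space M"
    then have "(\<Sum>\<^sup>+k. g k * indicator {\<omega>\<in>space M. K \<omega> = k} \<omega>) = (\<Sum>\<^sup>+k. if k = K \<omega> then g k else 0)"
      by (intro nn_integral_cong) (auto simp: indicator_def)
    then show "g (K \<omega>) = (\<Sum>\<^sup>+k. g k * indicator {\<omega>\<in>space M. K \<omega> = k} \<omega>)" by (simp add: esum_single)
  qed
  also have "\<dots> = (\<Sum>\<^sup>+k. g k * emeasure M {\<omega>\<in>space M. K \<omega> = k})"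
    by (subst nn_integral_count_space_nn_integral) (auto simp: nn_integral_cmult)
  finally show ?thesis .
qed

text \<open>Poisson counts are specified on bounded sets, so measures are identified on this
  generator; balls provide the exhausting sequence of finite measure.\<close>

lemma bounded_borel_generator:
  "exhausting_generator lborel {A \<in> sets borel. bounded (A :: plane set)} (\<lambda>n. cball 0 (real n))"
proof -
  let ?G = "{A \<in> sets borel. bounded (A :: plane set)}"
  have UN: "(\<Union>n. cball (0::plane) (real n)) = space lborel"
    by (auto simp: real_arch_simple)
  have sets: "sets lborel = sigma_sets (space lborel) ?G"
  proof (intro equalityI subsetI)
    fix A :: "plane set" assume A: "A \<in> sets lborel"
    have "A = (\<Union>n. A \<inter> cball 0 (real n))" using UN by auto
    also have "\<dots> \<in> sigma_sets (space lborel) ?G"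
      using A by (intro sigma_sets.Union sigma_sets.Basic) (auto simp: bounded_Int)
    finally show "A \<in> sigma_sets (space lborel) ?G" .
  next
    fix A assume "A \<in> sigma_sets (space lborel) ?G"
    then have "A \<in> sigma_sets (space lborel) (sets lborel)"
      by (rule sigma_sets_mono'[THEN subsetD, rotated]) auto
    then show "A \<in> sets lborel" using sets.sigma_sets_eq by blast
  qed
  have "Int_stable ?G" "range (\<lambda>n. cball 0 (real n)) \<subseteq> ?G" "incseq (\<lambda>n. cball (0::plane) (real n))"
    by (auto simp: Int_stable_def bounded_Int incseq_def)
  with sets UN show ?thesis unfolding exhausting_generator_def by (intro conjI) simp_all
qed

locale poisson_points = prob_space M for M :: "'w measure" +
  fixes l :: real and X :: "nat \<Rightarrow> 'w \<Rightarrow> plane"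
  assumes l_pos: "0 < l"
    and poisson: "poisson_process M l (\<lambda>\<omega>. range (\<lambda>i. X i \<omega>))"
    and inj_points: "AE \<omega> in M. inj (\<lambda>i. X i \<omega>)"
    and X_measurable[measurable]: "\<And>i. X i \<in> borel_measurable M"
begin

definition count :: "plane set \<Rightarrow> 'w \<Rightarrow> nat" where
  "count A \<omega> = card (range (\<lambda>i. X i \<omega>) \<inter> A)"

lemma count_measurable[measurable]:
  "A \<in> sets borel \<Longrightarrow> bounded A \<Longrightarrow> count A \<in> measurable M (count_space UNIV)"
  using poisson unfolding poisson_process_def count_def[abs_def] by blast

text \<open>The process counts locations while the sums run over indices; both agree where the
  enumeration is injective. The exceptional null set does not depend on \<open>A\<close>, so all
  bounded sets are handled at once.\<close>

lemma AE_count: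
  "AE \<omega> in M. \<forall>A. bounded A \<longrightarrow> finite {i. X i \<omega> \<in> A} \<and> card {i. X i \<omega> \<in> A} = count A \<omega>"
proof -
  have "AE \<omega> in M. \<forall>A. bounded A \<longrightarrow> finite (range (\<lambda>i. X i \<omega>) \<inter> A)"
    using poisson unfolding poisson_process_def by blast
  with inj_points show ?thesis
  proof eventually_elim
    case (elim \<omega>)
    show ?case
    proof (intro allI impI)
      fix A :: "plane set" assume "bounded A"
      have inj: "inj_on (\<lambda>i. X i \<omega>) {i. X i \<omega> \<in> A}" using elim(1) by (auto simp: inj_on_def)
      have img: "(\<lambda>i. X i \<omega>) ` {i. X i \<omega> \<in> A} = range (\<lambda>i. X i \<omega>) \<inter> A" by auto
      have "finite {i. X i \<omega> \<in> A}"
        using elim(2) \<open>bounded A\<close> finite_image_iff[OF inj] by (simp add: img)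
      with card_image[OF inj] show "finite {i. X i \<omega> \<in> A} \<and> card {i. X i \<omega> \<in> A} = count A \<omega>"
        by (simp add: img count_def)
    qed
  qed
qed

lemma nn_integral_count:
  assumes "A \<in> sets borel" "bounded A"
  shows "(\<integral>\<^sup>+\<omega>. g (count A \<omega>) \<partial>M) = poisson_mean (l * measure lborel A) g"
proof -
  have "measure M {\<omega>\<in>space M. count A \<omega> = k} =
      (l * measure lborel A) ^ k / fact k * exp (- (l * measure lborel A))" for k
    using poisson assms unfolding poisson_process_def count_def[abs_def] by blast
  then show ?thesis
    using assms by (simp add: nn_integral_nat_valued poisson_mean_def emeasure_eq_measure)
qed

lemma nn_integral_prod_count:
  fixes E :: "nat \<Rightarrow> plane set"
  assumes "finite I" and E: "\<And>e. E e \<in> sets borel" "\<And>e. bounded (E e)" "disjoint_family E"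
  shows "(\<integral>\<^sup>+\<omega>. (\<Prod>e\<in>I. g e (count (E e) \<omega>)) \<partial>M) = (\<Prod>e\<in>I. poisson_mean (l * measure lborel (E e)) (g e))"
proof -
  have "indep_vars (\<lambda>_. count_space UNIV) (\<lambda>e. count (E e)) UNIV"
    using poisson[unfolded poisson_process_def, THEN conjunct2, THEN conjunct2, rule_format, of E] E
    unfolding count_def[abs_def] by simp
  then have "indep_vars (\<lambda>_. count_space UNIV) (\<lambda>e. count (E e)) I"
    by (rule indep_vars_subset) simp
  then have "indep_vars (\<lambda>_. borel) (\<lambda>e \<omega>. g e (count (E e) \<omega>)) I"
    by (rule indep_vars_compose2) simp
  from indep_vars_nn_integral[OF assms(1) this] show ?thesis
    using E by (simp add: nn_integral_count)
qed

section \<open>Factorial moment measures of the parents up to order three\<close>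

lemma ennreal_mean:
  assumes "bounded A"
  shows "ennreal (l * measure lborel A) = ennreal l * emeasure lborel A"
proof -
  have "emeasure lborel A \<noteq> \<infinity>" using emeasure_bounded_finite[OF assms] by auto
  then show ?thesis using l_pos by (simp add: ennreal_mult emeasure_eq_ennreal_measure)
qed

text \<open>Campbell's formula: the intensity measure agrees with \<open>l\<close> times Lebesgue
  measure on bounded Borel sets, hence everywhere.\<close>

lemma nn_integral_points:
  assumes [measurable]: "F \<in> borel_measurable borel"
  shows "(\<Sum>\<^sup>+i. \<integral>\<^sup>+\<omega>. F (X i \<omega>) \<partial>M) = ennreal l * (\<integral>\<^sup>+x. F x \<partial>lborel)"
proof -
  obtain \<mu> where sets[measurable_cong]: "sets \<mu> = sets borel"
    and \<mu>: "\<And>F. F \<in> borel_measurable borel \<Longrightarrow> (\<integral>\<^sup>+x. F x \<partial>\<mu>) = (\<Sum>\<^sup>+i. 1 * (\<integral>\<^sup>+\<omega>. F (X i \<omega>) \<partial>M))"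
    using weighted_image_measure[OF sigma_finite_measure_axioms, of X borel "\<lambda>_. 1"] by auto
  have "\<mu> = scale_measure (ennreal l) lborel"
  proof (rule exhausting_generator_eqI[OF bounded_borel_generator])
    show eq: "emeasure \<mu> A = emeasure (scale_measure (ennreal l) lborel) A" if "A \<in> {A \<in> sets borel. bounded A}" for A
    proof -
      from that have A[measurable]: "A \<in> sets borel" and bd: "bounded A" by auto
      have "emeasure \<mu> A = (\<integral>\<^sup>+x. indicator A x \<partial>\<mu>)" using A sets by simp
      also have "\<dots> = (\<Sum>\<^sup>+i. \<integral>\<^sup>+\<omega>. of_bool (i \<in> {i. X i \<omega> \<in> A}) \<partial>M)"
        by (simp add: \<mu> indicator_def of_bool_def)
      also have "\<dots> = (\<integral>\<^sup>+\<omega>. (\<Sum>\<^sup>+i. of_bool (i \<in> {i. X i \<omega> \<in> A})) \<partial>M)"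
        by (subst nn_integral_count_space_nn_integral) auto
      also have "\<dots> = (\<integral>\<^sup>+\<omega>. of_nat (count A \<omega>) \<partial>M)"
        using AE_count
      proof (intro nn_integral_cong_AE, eventually_elim)
        case (elim \<omega>)
        then show ?case using bd by (subst esum_of_bool) auto
      qed
      also have "\<dots> = ennreal l * emeasure lborel A"
        using bd l_pos by (simp add: nn_integral_count poisson_mean_1 ennreal_mean)
      finally show ?thesis by simp
    qed
    show "emeasure \<mu> (cball 0 (real n)) \<noteq> \<infinity>" for n
      using emeasure_bounded_finite[of "cball (0::plane) (real n)"] by (subst eq) (auto simp: ennreal_mult_eq_top_iff)
  qed (use sets in simp_all)
  then show ?thesis using \<mu>[OF assms] by (simp add: nn_integral_scale_measure)
qed

lemma emeasure_lborel_Times2: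
  assumes [measurable]: "a \<in> sets borel" "b \<in> sets borel"
  shows "emeasure (lborel \<Otimes>\<^sub>M lborel) (a \<times> b) = emeasure lborel (a::plane set) * emeasure lborel (b::plane set)"
  by (rule lborel.emeasure_pair_measure_Times) auto

lemma emeasure_lborel_Times3:
  assumes [measurable]: "a \<in> sets borel" "b \<in> sets borel" "c \<in> sets borel"
  shows "emeasure (lborel \<Otimes>\<^sub>M lborel \<Otimes>\<^sub>M lborel) (a \<times> b \<times> c) =
    emeasure lborel (a::plane set) * (emeasure lborel (b::plane set) * emeasure lborel (c::plane set))"
proof -
  have "emeasure (lborel \<Otimes>\<^sub>M lborel) (a \<times> b \<times> c) = emeasure lborel a * emeasure lborel (b \<times> c)"
    by (rule lborel.emeasure_pair_measure_Times) (auto simp: borel_Times)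
  then show ?thesis using emeasure_lborel_Times2[OF assms(2,3)] by (simp add: lborel_prod)
qed

lemma disjoint_Times_family:
  fixes E :: "'i \<Rightarrow> 'a set" and E' :: "'j \<Rightarrow> 'b set"
  assumes "disjoint_family E" "disjoint_family E'"
  shows "disjoint_family_on (\<lambda>t. E (fst t) \<times> E' (snd t)) S"
unfolding disjoint_family_on_def
proof (intro ballI impI)
  fix s t :: "'i \<times> 'j" assume "s \<noteq> t"
  then consider "fst s \<noteq> fst t" | "snd s \<noteq> snd t" by (auto simp: prod_eq_iff)
  then show "E (fst s) \<times> E' (snd s) \<inter> E (fst t) \<times> E' (snd t) = {}"
  proof cases
    case 1
    then have "E (fst s) \<inter> E (fst t) = {}" using assms(1) by (auto simp: disjoint_family_on_def)
    then show ?thesis by blast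
  next
    case 2
    then have "E' (snd s) \<inter> E' (snd t) = {}" using assms(2) by (auto simp: disjoint_family_on_def)
    then show ?thesis by blast
  qed
qed

text \<open>One product formula, with two reasons: for different cells the counts are independent,
  and for a single cell the second factorial moment of a Poisson count is the square of its
  mean.\<close>

lemma pair_count_disjoint_or_equal:
  fixes E :: "nat \<Rightarrow> plane set"
  assumes E: "\<And>e. E e \<in> sets borel" "\<And>e. bounded (E e)" "disjoint_family E"
  shows "(\<integral>\<^sup>+\<omega>. (\<Sum>\<^sup>+i. \<Sum>\<^sup>+k. of_bool (i \<noteq> k \<and> X i \<omega> \<in> E a \<and> X k \<omega> \<in> E b)) \<partial>M) =
    (ennreal l * emeasure lborel (E a)) * (ennreal l * emeasure lborel (E b))"
proof -
  let ?n = "\<lambda>e \<omega>. count (E e) \<omega>"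
  let ?I = "\<lambda>\<omega> e. {i. X i \<omega> \<in> E e}"
  have disj: "X i \<omega> \<in> E e \<Longrightarrow> X i \<omega> \<in> E e' \<Longrightarrow> e = e'" for i \<omega> e e'
    using E(3) by (auto simp: disjoint_family_on_def)
  have cnt: "AE \<omega> in M. \<forall>e. finite (?I \<omega> e) \<and> card (?I \<omega> e) = ?n e \<omega>"
    using AE_count by eventually_elim (use E(2) in blast)
  have nonneg: "0 \<le> l * measure lborel (E e)" for e using l_pos by simp
  show ?thesis
  proof (cases "a = b")
    case True
    have "(\<integral>\<^sup>+\<omega>. (\<Sum>\<^sup>+i. \<Sum>\<^sup>+k. of_bool (i \<noteq> k \<and> X i \<omega> \<in> E a \<and> X k \<omega> \<in> E b)) \<partial>M) =
        (\<integral>\<^sup>+\<omega>. of_nat (?n a \<omega>) * of_nat (?n a \<omega> - 1) \<partial>M)"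
      using cnt
    proof (intro nn_integral_cong_AE, eventually_elim)
      case (elim \<omega>)
      then show ?case
        using card_distinct_pairs[of "?I \<omega> a" "?I \<omega> a" "?n a \<omega> - 1"] True by (simp add: card_Diff_singleton)
    qed
    also have "\<dots> = ennreal (l * measure lborel (E a)) * ennreal (l * measure lborel (E a))"
      using nn_integral_count[OF E(1,2), of "\<lambda>k. of_nat k * of_nat (k - 1)" a] poisson_mean_2[OF nonneg, of a] by simp
    finally show ?thesis using E(2) True by (simp add: ennreal_mean)
  next
    case False
    have "(\<integral>\<^sup>+\<omega>. (\<Sum>\<^sup>+i. \<Sum>\<^sup>+k. of_bool (i \<noteq> k \<and> X i \<omega> \<in> E a \<and> X k \<omega> \<in> E b)) \<partial>M) =
        (\<integral>\<^sup>+\<omega>. (\<Prod>e\<in>{a, b}. of_nat (?n e \<omega>)) \<partial>M)"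
      using cnt
    proof (intro nn_integral_cong_AE, eventually_elim)
      case (elim \<omega>)
      have "card (?I \<omega> b - {i}) = ?n b \<omega>" if "i \<in> ?I \<omega> a" for i
      proof -
        have "?I \<omega> b - {i} = ?I \<omega> b" using disj[of i \<omega> a b] that False by auto
        then show ?thesis using elim by simp
      qed
      then show ?case
        using card_distinct_pairs[of "?I \<omega> a" "?I \<omega> b" "?n b \<omega>"] elim False by simp
    qed
    also have "\<dots> = (\<Prod>e\<in>{a, b}. poisson_mean (l * measure lborel (E e)) of_nat)"
      by (rule nn_integral_prod_count) (use E in auto)
    finally show ?thesis using E(2) False nonneg by (simp add: poisson_mean_1 ennreal_mean)
  qed
qed

lemma nn_integral_point_pairs:
  assumes [measurable]: "F \<in> borel_measurable (borel \<Otimes>\<^sub>M borel)"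
  shows "(\<Sum>\<^sup>+i. \<Sum>\<^sup>+k. of_bool (i \<noteq> k) * (\<integral>\<^sup>+\<omega>. F (X i \<omega>, X k \<omega>) \<partial>M)) =
    ennreal l ^ 2 * (\<integral>\<^sup>+x. \<integral>\<^sup>+y. F (x, y) \<partial>lborel \<partial>lborel)"
proof -
  let ?w = "\<lambda>(i::nat, k::nat). of_bool (i \<noteq> k) :: ennreal"
  obtain \<mu> where sets[measurable_cong]: "sets \<mu> = sets (borel \<Otimes>\<^sub>M borel)"
    and \<mu>: "\<And>F. F \<in> borel_measurable (borel \<Otimes>\<^sub>M borel) \<Longrightarrow> (\<integral>\<^sup>+x. F x \<partial>\<mu>) =
      (\<Sum>\<^sup>+t. ?w t * (\<integral>\<^sup>+\<omega>. F (X (fst t) \<omega>, X (snd t) \<omega>) \<partial>M))"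
    by (rule weighted_image_measure[OF sigma_finite_measure_axioms,
          of "\<lambda>t \<omega>. (X (fst t) \<omega>, X (snd t) \<omega>)" "borel \<Otimes>\<^sub>M borel" ?w]) auto
  let ?\<nu> = "scale_measure (ennreal l ^ 2) (lborel \<Otimes>\<^sub>M lborel)"
  have atoms: "emeasure \<mu> (E a \<times> E b) = emeasure ?\<nu> (E a \<times> E b)"
    if E: "\<And>e. E e \<in> sets borel" "\<And>e. bounded (E e)" "disjoint_family E" for E :: "nat \<Rightarrow> plane set" and a b
  proof -
    note [measurable] = E(1)
    have "emeasure \<mu> (E a \<times> E b) = (\<Sum>\<^sup>+i. \<Sum>\<^sup>+k. of_bool (i \<noteq> k) * (\<integral>\<^sup>+\<omega>. indicator (E a \<times> E b) (X i \<omega>, X k \<omega>) \<partial>M))"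
      using \<mu>[of "indicator (E a \<times> E b)"] by (simp add: esum_prod)
    also have "\<dots> = (\<Sum>\<^sup>+i. \<Sum>\<^sup>+k. (\<integral>\<^sup>+\<omega>. of_bool (i \<noteq> k \<and> X i \<omega> \<in> E a \<and> X k \<omega> \<in> E b) \<partial>M))"
      by (intro nn_integral_cong, subst nn_integral_cmult[symmetric])
        (auto simp: indicator_def intro!: nn_integral_cong)
    also have "\<dots> = (\<integral>\<^sup>+\<omega>. (\<Sum>\<^sup>+i. \<Sum>\<^sup>+k. of_bool (i \<noteq> k \<and> X i \<omega> \<in> E a \<and> X k \<omega> \<in> E b)) \<partial>M)"
      by (rule nn_integral_esum2[symmetric]) measurable
    also have "\<dots> = (ennreal l * emeasure lborel (E a)) * (ennreal l * emeasure lborel (E b))"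
      by (rule pair_count_disjoint_or_equal) (fact E)+
    finally show ?thesis by (simp add: emeasure_lborel_Times2 power2_eq_square mult_ac)
  qed
  have rect: "emeasure \<mu> (A \<times> B) = emeasure ?\<nu> (A \<times> B)"
    if A: "A \<in> {A \<in> sets borel. bounded A}" and B: "B \<in> {A \<in> sets borel. bounded A}" for A B
  proof -
    \<comment> \<open>\<open>A\<close> and \<open>B\<close> may overlap, and then their counts are
      neither equal nor independent. The cells \<open>A \<inter> B\<close>, \<open>A - B\<close>,
      \<open>B - A\<close> are pairwise equal or disjoint, as \<open>atoms\<close> requires;
      \<open>A\<close> consists of cells 0 and 1, \<open>B\<close> of cells 0 and 2.\<close>
    define E where "E = (\<lambda>e::nat. if e = 0 then A \<inter> B else if e = 1 then A - B else if e = 2 then B - A else {})"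
    have E: "\<And>e. E e \<in> sets borel" "\<And>e. bounded (E e)" "disjoint_family E"
      using A B by (auto simp: E_def bounded_Int bounded_diff disjoint_family_on_def)
    have dec: "A \<times> B = (\<Union>t\<in>{0, 1} \<times> {0, 2}. E (fst t) \<times> E (snd t))"
      by (auto simp: E_def)
    have disj: "disjoint_family_on (\<lambda>t. E (fst t) \<times> E (snd t)) ({0, 1} \<times> {0, 2})"
      by (rule disjoint_Times_family[OF E(3,3)])
    have "emeasure \<mu> (A \<times> B) = (\<Sum>t\<in>{0, 1} \<times> {0, 2}. emeasure \<mu> (E (fst t) \<times> E (snd t)))"
      unfolding dec using E sets by (intro sum_emeasure[symmetric] disj) auto
    also have "\<dots> = (\<Sum>t\<in>{0, 1} \<times> {0, 2}. emeasure ?\<nu> (E (fst t) \<times> E (snd t)))"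
      using atoms[OF E] by simp
    also have "\<dots> = emeasure ?\<nu> (A \<times> B)"
      unfolding dec using E by (intro sum_emeasure disj) auto
    finally show ?thesis .
  qed
  have "\<mu> = ?\<nu>"
  proof (rule exhausting_generator_eqI[OF exhausting_generator_pair[OF bounded_borel_generator bounded_borel_generator]])
    show "emeasure \<mu> (cball 0 (real n) \<times> cball 0 (real n)) \<noteq> \<infinity>" for n
      using emeasure_bounded_finite[of "cball (0::plane) (real n)"]
      by (subst rect) (auto simp: emeasure_lborel_Times2 ennreal_mult_eq_top_iff power2_eq_square)
    show "sets \<mu> = sets (lborel \<Otimes>\<^sub>M lborel)" using sets by simp
  qed (use rect in auto)
  then show ?thesis
    using \<mu>[OF assms] by (simp add: nn_integral_scale_measure esum_prod lborel.nn_integral_fst)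
qed

text \<open>Each coincidence pattern of the three cells reduces to independent factorial moments:
  one of order three, one of order two with one of order one, or three of order one.\<close>

lemma triple_count_disjoint_or_equal:
  fixes E :: "nat \<Rightarrow> plane set"
  assumes E: "\<And>e. E e \<in> sets borel" "\<And>e. bounded (E e)" "disjoint_family E"
  shows "(\<integral>\<^sup>+\<omega>. (\<Sum>\<^sup>+i. \<Sum>\<^sup>+k. \<Sum>\<^sup>+m. of_bool (i \<noteq> k \<and> i \<noteq> m \<and> k \<noteq> m \<and>
      X i \<omega> \<in> E a \<and> X k \<omega> \<in> E b \<and> X m \<omega> \<in> E d)) \<partial>M) =
    (ennreal l * emeasure lborel (E a)) * (ennreal l * emeasure lborel (E b)) * (ennreal l * emeasure lborel (E d))"
    (is "?L = _")
proof -
  let ?n = "\<lambda>e \<omega>. count (E e) \<omega>"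
  let ?I = "\<lambda>\<omega> e. {i. X i \<omega> \<in> E e}"
  have disj: "X i \<omega> \<in> E e \<Longrightarrow> X i \<omega> \<in> E e' \<Longrightarrow> e = e'" for i \<omega> e e'
    using E(3) by (auto simp: disjoint_family_on_def)
  have cnt: "AE \<omega> in M. \<forall>e. finite (?I \<omega> e) \<and> card (?I \<omega> e) = ?n e \<omega>"
    using AE_count by eventually_elim (use E(2) in blast)
  have nonneg: "0 \<le> l * measure lborel (E e)" for e using l_pos by simp
  \<comment> \<open>Removing an index lowers the count of a cell exactly when that index lies in the
    cell; for two removed indices the corrections add up in \<open>card2\<close>.\<close>
  have card1: "card (?I \<omega> e - {i}) = ?n e \<omega> - (if e = e' then 1 else 0)"
    if "\<forall>e. finite (?I \<omega> e) \<and> card (?I \<omega> e) = ?n e \<omega>" "i \<in> ?I \<omega> e'" for \<omega> e e' i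
  proof (cases "e = e'")
    case False
    then have "?I \<omega> e - {i} = ?I \<omega> e" using disj[of i \<omega> e' e] that(2) by auto
    then show ?thesis using that(1) False by simp
  qed (use that in \<open>simp add: card_Diff_singleton\<close>)
  have card2: "card (?I \<omega> e - {i, k}) = ?n e \<omega> - (if e = e' then 1 else 0) - (if e = e'' then 1 else 0)"
    if fin: "\<forall>e. finite (?I \<omega> e) \<and> card (?I \<omega> e) = ?n e \<omega>"
      and "i \<in> ?I \<omega> e'" "k \<in> ?I \<omega> e''" "i \<noteq> k" for \<omega> e e' e'' i k
  proof (cases "e = e''")
    case False
    then have "?I \<omega> e - {i, k} = ?I \<omega> e - {i}" using disj[of k \<omega> e'' e] that(3) by auto
    then show ?thesis using card1[OF fin that(2), of e] False by simp
  next
    case True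
    then have "k \<in> ?I \<omega> e - {i}" using that by auto
    moreover have "?I \<omega> e - {i, k} = ?I \<omega> e - {i} - {k}" by auto
    ultimately show ?thesis using card1[OF fin that(2), of e] True by simp
  qed
  have *: "?L = (\<integral>\<^sup>+\<omega>. of_nat (?n a \<omega>) * of_nat (?n b \<omega> - (if b = a then 1 else 0)) *
      of_nat (?n d \<omega> - (if d = a then 1 else 0) - (if d = b then 1 else 0)) \<partial>M)" (is "_ = ?R")
    using cnt
  proof (intro nn_integral_cong_AE, eventually_elim)
    case (elim \<omega>)
    show ?case
      using card_distinct_triples[of "?I \<omega> a" "?I \<omega> b" "?I \<omega> d", OF _ _ _ card1[OF elim(2)] card2[OF elim(2)]]
        elim by simp
  qed
  consider "a = b" "b = d" | "a = b" "a \<noteq> d" | "a = d" "a \<noteq> b" | "b = d" "a \<noteq> b" | "a \<noteq> b" "a \<noteq> d" "b \<noteq> d" by blast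
  then show ?thesis
  proof cases
    case 1
    then show ?thesis
      using nn_integral_count[OF E(1,2), of "\<lambda>k. of_nat k * of_nat (k - 1) * of_nat (k - 2)" a]
        poisson_mean_3[OF nonneg, of a] E(2) unfolding * by (simp add: ennreal_mean numeral_2_eq_2)
  next
    case 2
    have "?R = (\<integral>\<^sup>+\<omega>. (\<Prod>e\<in>{a, d}. (\<lambda>k. of_nat k * (if e = a then of_nat (k - 1) else 1)) (?n e \<omega>)) \<partial>M)"
      using 2 by (intro nn_integral_cong) auto
    also have "\<dots> = (\<Prod>e\<in>{a, d}. poisson_mean (l * measure lborel (E e)) (\<lambda>k. of_nat k * (if e = a then of_nat (k - 1) else 1)))"
      by (rule nn_integral_prod_count) (use E in auto)
    finally show ?thesis using E(2) 2 nonneg unfolding * by (auto simp: poisson_mean_1 poisson_mean_2[unfolded One_nat_def] ennreal_mean)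
  next
    case 3
    have "?R = (\<integral>\<^sup>+\<omega>. (\<Prod>e\<in>{a, b}. (\<lambda>k. of_nat k * (if e = a then of_nat (k - 1) else 1)) (?n e \<omega>)) \<partial>M)"
      using 3 by (intro nn_integral_cong) (auto simp: mult_ac)
    also have "\<dots> = (\<Prod>e\<in>{a, b}. poisson_mean (l * measure lborel (E e)) (\<lambda>k. of_nat k * (if e = a then of_nat (k - 1) else 1)))"
      by (rule nn_integral_prod_count) (use E in auto)
    finally show ?thesis using E(2) 3 nonneg unfolding * by (auto simp: poisson_mean_1 poisson_mean_2[unfolded One_nat_def] ennreal_mean mult_ac)
  next
    case 4
    have "?R = (\<integral>\<^sup>+\<omega>. (\<Prod>e\<in>{a, b}. (\<lambda>k. of_nat k * (if e = b then of_nat (k - 1) else 1)) (?n e \<omega>)) \<partial>M)"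
      using 4 by (intro nn_integral_cong) (auto simp: mult_ac)
    also have "\<dots> = (\<Prod>e\<in>{a, b}. poisson_mean (l * measure lborel (E e)) (\<lambda>k. of_nat k * (if e = b then of_nat (k - 1) else 1)))"
      by (rule nn_integral_prod_count) (use E in auto)
    finally show ?thesis using E(2) 4 nonneg unfolding * by (auto simp: poisson_mean_1 poisson_mean_2[unfolded One_nat_def] ennreal_mean mult_ac)
  next
    case 5
    have "?R = (\<integral>\<^sup>+\<omega>. (\<Prod>e\<in>{a, b, d}. of_nat (?n e \<omega>)) \<partial>M)"
      using 5 by (intro nn_integral_cong) (auto simp: mult_ac)
    also have "\<dots> = (\<Prod>e\<in>{a, b, d}. poisson_mean (l * measure lborel (E e)) of_nat)"
      by (rule nn_integral_prod_count) (use E in auto)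
    finally show ?thesis using E(2) 5 nonneg unfolding * by (auto simp: poisson_mean_1 ennreal_mean mult_ac)
  qed
qed

lemma nn_integral_point_triples:
  assumes [measurable]: "F \<in> borel_measurable (borel \<Otimes>\<^sub>M borel \<Otimes>\<^sub>M borel)"
  shows "(\<Sum>\<^sup>+i. \<Sum>\<^sup>+k. \<Sum>\<^sup>+m. of_bool (i \<noteq> k \<and> i \<noteq> m \<and> k \<noteq> m) * (\<integral>\<^sup>+\<omega>. F (X i \<omega>, X k \<omega>, X m \<omega>) \<partial>M)) =
    ennreal l ^ 3 * (\<integral>\<^sup>+x. \<integral>\<^sup>+y. \<integral>\<^sup>+w. F (x, y, w) \<partial>lborel \<partial>lborel \<partial>lborel)"
proof -
  have LL: "sigma_finite_measure (lborel \<Otimes>\<^sub>M lborel :: (plane \<times> plane) measure)"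
    unfolding lborel_prod by (rule sigma_finite_lborel)
  let ?w = "\<lambda>(i::nat, k::nat, m::nat). of_bool (i \<noteq> k \<and> i \<noteq> m \<and> k \<noteq> m) :: ennreal"
  let ?B3 = "borel \<Otimes>\<^sub>M borel \<Otimes>\<^sub>M borel :: (plane \<times> plane \<times> plane) measure"
  obtain \<mu> where sets[measurable_cong]: "sets \<mu> = sets ?B3"
    and \<mu>: "\<And>F. F \<in> borel_measurable ?B3 \<Longrightarrow> (\<integral>\<^sup>+x. F x \<partial>\<mu>) =
      (\<Sum>\<^sup>+t. ?w t * (\<integral>\<^sup>+\<omega>. F (X (fst t) \<omega>, X (fst (snd t)) \<omega>, X (snd (snd t)) \<omega>) \<partial>M))"
    by (rule weighted_image_measure[OF sigma_finite_measure_axioms,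
          of "\<lambda>t \<omega>. (X (fst t) \<omega>, X (fst (snd t)) \<omega>, X (snd (snd t)) \<omega>)" ?B3 ?w]) auto
  let ?\<nu> = "scale_measure (ennreal l ^ 3) (lborel \<Otimes>\<^sub>M lborel \<Otimes>\<^sub>M lborel)"
  have atoms: "emeasure \<mu> (E a \<times> E b \<times> E d) = emeasure ?\<nu> (E a \<times> E b \<times> E d)"
    if E: "\<And>e. E e \<in> sets borel" "\<And>e. bounded (E e)" "disjoint_family E" for E :: "nat \<Rightarrow> plane set" and a b d
  proof -
    note [measurable] = E(1)
    have "emeasure \<mu> (E a \<times> E b \<times> E d) = (\<Sum>\<^sup>+i. \<Sum>\<^sup>+k. \<Sum>\<^sup>+m. of_bool (i \<noteq> k \<and> i \<noteq> m \<and> k \<noteq> m) *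
        (\<integral>\<^sup>+\<omega>. indicator (E a \<times> E b \<times> E d) (X i \<omega>, X k \<omega>, X m \<omega>) \<partial>M))"
      using \<mu>[of "indicator (E a \<times> E b \<times> E d)"] by (simp add: esum_prod del: of_bool_conj)
    also have "\<dots> = (\<Sum>\<^sup>+i. \<Sum>\<^sup>+k. \<Sum>\<^sup>+m. (\<integral>\<^sup>+\<omega>. of_bool (i \<noteq> k \<and> i \<noteq> m \<and> k \<noteq> m \<and>
        X i \<omega> \<in> E a \<and> X k \<omega> \<in> E b \<and> X m \<omega> \<in> E d) \<partial>M))"
      by (intro nn_integral_cong, subst nn_integral_cmult[symmetric])
        (auto simp: indicator_def intro!: nn_integral_cong)
    also have "\<dots> = (\<integral>\<^sup>+\<omega>. (\<Sum>\<^sup>+i. \<Sum>\<^sup>+k. \<Sum>\<^sup>+m. of_bool (i \<noteq> k \<and> i \<noteq> m \<and> k \<noteq> m \<and>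
        X i \<omega> \<in> E a \<and> X k \<omega> \<in> E b \<and> X m \<omega> \<in> E d)) \<partial>M)"
      by (rule nn_integral_esum3[symmetric]) measurable
    also have "\<dots> = (ennreal l * emeasure lborel (E a)) * (ennreal l * emeasure lborel (E b)) * (ennreal l * emeasure lborel (E d))"
      by (rule triple_count_disjoint_or_equal) (fact E)+
    finally show ?thesis by (simp add: emeasure_lborel_Times3 power3_eq_cube mult_ac)
  qed
  have rect: "emeasure \<mu> (A \<times> B \<times> C) = emeasure ?\<nu> (A \<times> B \<times> C)"
    if A: "A \<in> {A \<in> sets borel. bounded A}" and B: "B \<in> {A \<in> sets borel. bounded A}"
      and C: "C \<in> {A \<in> sets borel. bounded A}" for A B C
  proof -
    \<comment> \<open>The seven atoms of the algebra generated by \<open>A\<close>,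
      \<open>B\<close>, \<open>C\<close>: cell 0 is the triple intersection, cells 1 to 3 are
      pairwise intersections without the third set, cells 4 to 6 lie in one set alone. Boxes of
      atoms fall under \<open>atoms\<close>.\<close>
    define E where "E = (\<lambda>e::nat. if e = 0 then A \<inter> B \<inter> C else if e = 1 then A \<inter> B - C else if e = 2 then A \<inter> C - B
      else if e = 3 then B \<inter> C - A else if e = 4 then A - B - C else if e = 5 then B - A - C
      else if e = 6 then C - A - B else {})"
    have "disjoint_family E"
      unfolding disjoint_family_on_def E_def by (simp, safe)
    then have E: "\<And>e. E e \<in> sets borel" "\<And>e. bounded (E e)" "disjoint_family E"
      using A B C by (auto simp: E_def bounded_Int bounded_diff)
    let ?S = "{0, 1, 2, 4} \<times> {0, 1, 3, 5} \<times> {0, 2, 3, 6} :: (nat \<times> nat \<times> nat) set"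
    let ?E = "\<lambda>t. E (fst t) \<times> E (fst (snd t)) \<times> E (snd (snd t))"
    have "(\<Union>t\<in>I \<times> J \<times> K. ?E t) = (\<Union>e\<in>I. E e) \<times> (\<Union>e\<in>J. E e) \<times> (\<Union>e\<in>K. E e)" for I J K
      by (auto simp: mem_Times_iff)
    then have "(\<Union>t\<in>?S. ?E t) = (\<Union>e\<in>{0, 1, 2, 4}. E e) \<times> (\<Union>e\<in>{0, 1, 3, 5}. E e) \<times> (\<Union>e\<in>{0, 2, 3, 6}. E e)" .
    moreover have "(\<Union>e\<in>{0, 1, 2, 4}. E e) = A" "(\<Union>e\<in>{0, 1, 3, 5}. E e) = B" "(\<Union>e\<in>{0, 2, 3, 6}. E e) = C"
      by (auto simp: E_def)
    ultimately have dec: "A \<times> B \<times> C = (\<Union>t\<in>?S. ?E t)" by simp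
    have disj2: "disjoint_family (\<lambda>t. E (fst t) \<times> E (snd t))"
      by (rule disjoint_Times_family[OF E(3,3)])
    have disj: "disjoint_family_on ?E ?S"
      by (rule disjoint_Times_family[OF E(3) disj2])
    have "emeasure \<mu> (A \<times> B \<times> C) = (\<Sum>t\<in>?S. emeasure \<mu> (?E t))"
      unfolding dec using E sets by (intro sum_emeasure[symmetric] disj) auto
    also have "\<dots> = (\<Sum>t\<in>?S. emeasure ?\<nu> (?E t))"
      by (rule sum.cong[OF refl]) (rule atoms[OF E])
    also have "\<dots> = emeasure ?\<nu> (A \<times> B \<times> C)"
      unfolding dec using E by (intro sum_emeasure disj) auto
    finally show ?thesis .
  qed
  have "\<mu> = ?\<nu>"
  proof (rule exhausting_generator_eqI[OF exhausting_generator_pair[OF bounded_borel_generator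
          exhausting_generator_pair[OF bounded_borel_generator bounded_borel_generator]]])
    show "emeasure \<mu> (cball 0 (real n) \<times> cball 0 (real n) \<times> cball 0 (real n)) \<noteq> \<infinity>" for n
      using emeasure_bounded_finite[of "cball (0::plane) (real n)"]
      by (subst rect) (auto simp: emeasure_lborel_Times3 ennreal_mult_eq_top_iff power3_eq_cube)
    show "sets \<mu> = sets (lborel \<Otimes>\<^sub>M lborel \<Otimes>\<^sub>M lborel)" using sets by simp
  qed (use rect in auto)
  then have "(\<Sum>\<^sup>+i. \<Sum>\<^sup>+k. \<Sum>\<^sup>+m. of_bool (i \<noteq> k \<and> i \<noteq> m \<and> k \<noteq> m) * (\<integral>\<^sup>+\<omega>. F (X i \<omega>, X k \<omega>, X m \<omega>) \<partial>M)) =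
      ennreal l ^ 3 * (\<integral>\<^sup>+t. F t \<partial>(lborel \<Otimes>\<^sub>M lborel \<Otimes>\<^sub>M lborel))"
    using \<mu>[OF assms] by (simp add: nn_integral_scale_measure esum_prod del: of_bool_conj)
  also have "(\<integral>\<^sup>+t. F t \<partial>(lborel \<Otimes>\<^sub>M lborel \<Otimes>\<^sub>M lborel)) = (\<integral>\<^sup>+x. \<integral>\<^sup>+q. F (x, q) \<partial>(lborel \<Otimes>\<^sub>M lborel) \<partial>lborel)"
    by (rule sigma_finite_measure.nn_integral_fst[OF LL, symmetric]) simp
  also have "\<dots> = (\<integral>\<^sup>+x. \<integral>\<^sup>+y. \<integral>\<^sup>+w. F (x, y, w) \<partial>lborel \<partial>lborel \<partial>lborel)"
    by (intro nn_integral_cong lborel.nn_integral_fst[symmetric]) simp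
  finally show ?thesis .
qed

end

section \<open>Factorial moments of a Neyman-Scott process\<close>

abbreviation displacement_law :: "(plane \<Rightarrow> real) \<Rightarrow> plane measure" where
  "displacement_law f \<equiv> density lborel (\<lambda>x. ennreal (f x))"

lemma prob_space_displacement_law:
  assumes "isotropic_density f" shows "prob_space (displacement_law f)"
proof
  have [measurable]: "f \<in> borel_measurable borel" and "integrable lborel f" "\<And>x. 0 \<le> f x" "(\<integral>x. f x \<partial>lborel) = 1"
    using assms unfolding isotropic_density_def by blast+
  then have "(\<integral>\<^sup>+x. ennreal (f x) \<partial>lborel) = 1"
    by (subst nn_integral_eq_integral) auto
  then show "emeasure (displacement_law f) (space (displacement_law f)) = 1"
    by (simp add: emeasure_density)
qed

lemma sets_cluster_law [measurable_cong]:
  "sets (cluster_law c f) = sets (count_space UNIV \<Otimes>\<^sub>M (\<Pi>\<^sub>M j\<in>UNIV. borel))"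
  unfolding cluster_law_def by (intro sets_pair_measure_cong sets_PiM_cong) auto

lemma prob_space_cluster_law:
  assumes "isotropic_density f" shows "prob_space (cluster_law c f)"
proof -
  interpret D: prob_space "displacement_law f" by (rule prob_space_displacement_law) fact
  interpret P: product_prob_space "\<lambda>_::nat. displacement_law f" UNIV ..
  interpret PP: pair_prob_space "measure_pmf (poisson_pmf c)" "\<Pi>\<^sub>M j\<in>(UNIV::nat set). displacement_law f" ..
  show ?thesis unfolding cluster_law_def by (rule PP.prob_space_axioms)
qed

lemma nn_integral_poisson_pmf:
  assumes "0 < c"
  shows "(\<integral>\<^sup>+n. g n \<partial>measure_pmf (poisson_pmf c)) = poisson_mean c g"
  using assms by (simp add: nn_integral_measure_pmf poisson_mean_def mult.commute)

lemma nn_integral_cluster_law: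
  assumes f: "isotropic_density f" and "G \<in> borel_measurable (count_space UNIV \<Otimes>\<^sub>M (\<Pi>\<^sub>M j\<in>UNIV. borel))"
  shows "(\<integral>\<^sup>+\<kappa>. G \<kappa> \<partial>cluster_law c f) =
    (\<integral>\<^sup>+n. \<integral>\<^sup>+d. G (n, d) \<partial>(\<Pi>\<^sub>M j\<in>UNIV. displacement_law f) \<partial>measure_pmf (poisson_pmf c))"
proof -
  interpret D: prob_space "displacement_law f" by (rule prob_space_displacement_law) fact
  interpret P: product_prob_space "\<lambda>_::nat. displacement_law f" UNIV ..
  have "G \<in> borel_measurable (cluster_law c f)"
    using assms(2) by (simp add: measurable_cong_sets[OF sets_cluster_law refl])
  then show ?thesis
    unfolding cluster_law_def by (rule P.nn_integral_fst[symmetric])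
qed

text \<open>Given the number \<open>n\<close> of points, each of the first \<open>n\<close>
  displacements has law \<open>displacement_law f\<close>, so the sum has mean \<open>n\<close>
  times a constant, and the Poisson mean of \<open>n\<close> is \<open>c\<close>.\<close>

lemma cluster_moment1:
  assumes f: "isotropic_density f" and c: "0 < c" and [measurable]: "F \<in> borel_measurable borel"
  shows "(\<integral>\<^sup>+\<kappa>. (\<Sum>\<^sup>+j. of_bool (j < fst \<kappa>) * F (snd \<kappa> j)) \<partial>cluster_law c f) =
    ennreal c * (\<integral>\<^sup>+a. F a \<partial>displacement_law f)"
proof -
  let ?C = "\<integral>\<^sup>+a. F a \<partial>displacement_law f"
  note D = prob_space_displacement_law[OF f]
  have *: "(\<integral>\<^sup>+\<kappa>. of_bool (j < fst \<kappa>) * F (snd \<kappa> j) \<partial>cluster_law c f) =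
      (\<integral>\<^sup>+n. of_bool (j < n) * ?C \<partial>measure_pmf (poisson_pmf c))" for j
    by (subst nn_integral_cluster_law[OF f])
      (auto simp: nn_integral_cmult nn_integral_PiM_coordinate[OF D])
  have "(\<integral>\<^sup>+\<kappa>. (\<Sum>\<^sup>+j. of_bool (j < fst \<kappa>) * F (snd \<kappa> j)) \<partial>cluster_law c f) =
      (\<Sum>\<^sup>+j. \<integral>\<^sup>+\<kappa>. of_bool (j < fst \<kappa>) * F (snd \<kappa> j) \<partial>cluster_law c f)"
    by (rule nn_integral_esum) measurable
  also have "\<dots> = (\<integral>\<^sup>+n. (\<Sum>\<^sup>+j. of_bool (j < n) * ?C) \<partial>measure_pmf (poisson_pmf c))"
    unfolding * by (rule nn_integral_esum[symmetric]) simp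
  also have "\<dots> = (\<integral>\<^sup>+n. ?C * of_nat n \<partial>measure_pmf (poisson_pmf c))"
  proof (rule nn_integral_cong)
    fix n :: nat
    show "(\<Sum>\<^sup>+j. of_bool (j < n) * ?C) = ?C * of_nat n"
      using esum_of_bool[of "{..<n}"] by (simp add: nn_integral_multc mult.commute)
  qed
  finally show ?thesis
    unfolding nn_integral_poisson_pmf[OF c] poisson_mean_cmult poisson_mean_1[OF less_imp_le[OF c]]
    by (simp only: mult.commute)
qed

text \<open>Distinct displacements are independent of each other and of the number \<open>n\<close>,
  so every ordered pair contributes the same constant; there are \<open>n * (n - 1)\<close> pairs,
  with Poisson mean \<open>c^2\<close>.\<close>

lemma cluster_moment2:
  assumes f: "isotropic_density f" and c: "0 < c" and [measurable]: "F \<in> borel_measurable (borel \<Otimes>\<^sub>M borel)"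
  shows "(\<integral>\<^sup>+\<kappa>. (\<Sum>\<^sup>+j. \<Sum>\<^sup>+k. of_bool (j \<noteq> k \<and> j < fst \<kappa> \<and> k < fst \<kappa>) * F (snd \<kappa> j, snd \<kappa> k)) \<partial>cluster_law c f) =
    ennreal c ^ 2 * (\<integral>\<^sup>+a. \<integral>\<^sup>+b. F (a, b) \<partial>displacement_law f \<partial>displacement_law f)"
proof -
  let ?C = "\<integral>\<^sup>+a. \<integral>\<^sup>+b. F (a, b) \<partial>displacement_law f \<partial>displacement_law f"
  let ?b = "\<lambda>n j k. of_bool (j \<noteq> k \<and> j < n \<and> k < n) :: ennreal"
  note D = prob_space_displacement_law[OF f]
  have *: "(\<integral>\<^sup>+\<kappa>. ?b (fst \<kappa>) j k * F (snd \<kappa> j, snd \<kappa> k) \<partial>cluster_law c f) =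
      (\<integral>\<^sup>+n. ?b n j k * ?C \<partial>measure_pmf (poisson_pmf c))" for j k
  proof (subst nn_integral_cluster_law[OF f])
    show "(\<integral>\<^sup>+n. \<integral>\<^sup>+d. ?b (fst (n, d)) j k * F (snd (n, d) j, snd (n, d) k) \<partial>(\<Pi>\<^sub>M j\<in>UNIV. displacement_law f) \<partial>measure_pmf (poisson_pmf c)) =
        (\<integral>\<^sup>+n. ?b n j k * ?C \<partial>measure_pmf (poisson_pmf c))"
      by (cases "j = k")
        (auto simp: nn_integral_cmult nn_integral_PiM_two_coordinates[OF D] simp del: of_bool_conj)
  qed measurable
  have "(\<integral>\<^sup>+\<kappa>. (\<Sum>\<^sup>+j. \<Sum>\<^sup>+k. ?b (fst \<kappa>) j k * F (snd \<kappa> j, snd \<kappa> k)) \<partial>cluster_law c f) =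
      (\<Sum>\<^sup>+j. \<Sum>\<^sup>+k. \<integral>\<^sup>+\<kappa>. ?b (fst \<kappa>) j k * F (snd \<kappa> j, snd \<kappa> k) \<partial>cluster_law c f)"
    by (rule nn_integral_esum2) measurable
  also have "\<dots> = (\<integral>\<^sup>+n. (\<Sum>\<^sup>+j. \<Sum>\<^sup>+k. ?b n j k * ?C) \<partial>measure_pmf (poisson_pmf c))"
    unfolding * by (rule nn_integral_esum2[symmetric]) simp
  also have "\<dots> = (\<integral>\<^sup>+n. ?C * (of_nat n * of_nat (n - 1)) \<partial>measure_pmf (poisson_pmf c))"
  proof (rule nn_integral_cong)
    fix n :: nat
    show "(\<Sum>\<^sup>+j. \<Sum>\<^sup>+k. ?b n j k * ?C) = ?C * (of_nat n * of_nat (n - 1))"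
      using card_distinct_pairs[of "{..<n}" "{..<n}" "n - 1"]
      by (simp add: nn_integral_multc mult.commute card_Diff_singleton del: of_bool_conj)
  qed
  finally show ?thesis
    unfolding nn_integral_poisson_pmf[OF c] poisson_mean_cmult poisson_mean_2[OF less_imp_le[OF c]]
    by (simp only: mult.commute power2_eq_square)
qed

lemma cluster_moment3:
  assumes f: "isotropic_density f" and c: "0 < c"
    and [measurable]: "F \<in> borel_measurable (borel \<Otimes>\<^sub>M borel \<Otimes>\<^sub>M borel)"
  shows "(\<integral>\<^sup>+\<kappa>. (\<Sum>\<^sup>+j. \<Sum>\<^sup>+k. \<Sum>\<^sup>+m. of_bool (j \<noteq> k \<and> j \<noteq> m \<and> k \<noteq> m \<and> j < fst \<kappa> \<and> k < fst \<kappa> \<and> m < fst \<kappa>) *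
      F (snd \<kappa> j, snd \<kappa> k, snd \<kappa> m)) \<partial>cluster_law c f) =
    ennreal c ^ 3 * (\<integral>\<^sup>+a. \<integral>\<^sup>+b. \<integral>\<^sup>+d. F (a, b, d) \<partial>displacement_law f \<partial>displacement_law f \<partial>displacement_law f)"
proof -
  let ?C = "\<integral>\<^sup>+a. \<integral>\<^sup>+b. \<integral>\<^sup>+d. F (a, b, d) \<partial>displacement_law f \<partial>displacement_law f \<partial>displacement_law f"
  let ?b = "\<lambda>n j k m. of_bool (j \<noteq> k \<and> j \<noteq> m \<and> k \<noteq> m \<and> j < n \<and> k < n \<and> m < n) :: ennreal"
  note D = prob_space_displacement_law[OF f]
  have *: "(\<integral>\<^sup>+\<kappa>. ?b (fst \<kappa>) j k m * F (snd \<kappa> j, snd \<kappa> k, snd \<kappa> m) \<partial>cluster_law c f) =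
      (\<integral>\<^sup>+n. ?b n j k m * ?C \<partial>measure_pmf (poisson_pmf c))" for j k m
  proof (subst nn_integral_cluster_law[OF f])
    show "(\<integral>\<^sup>+n. \<integral>\<^sup>+d. ?b (fst (n, d)) j k m * F (snd (n, d) j, snd (n, d) k, snd (n, d) m) \<partial>(\<Pi>\<^sub>M j\<in>UNIV. displacement_law f) \<partial>measure_pmf (poisson_pmf c)) =
        (\<integral>\<^sup>+n. ?b n j k m * ?C \<partial>measure_pmf (poisson_pmf c))"
      by (cases "j \<noteq> k \<and> j \<noteq> m \<and> k \<noteq> m")
        (auto simp: nn_integral_cmult nn_integral_PiM_three_coordinates[OF D] simp del: of_bool_conj)
  qed measurable
  have "(\<integral>\<^sup>+\<kappa>. (\<Sum>\<^sup>+j. \<Sum>\<^sup>+k. \<Sum>\<^sup>+m. ?b (fst \<kappa>) j k m * F (snd \<kappa> j, snd \<kappa> k, snd \<kappa> m)) \<partial>cluster_law c f) =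
      (\<Sum>\<^sup>+j. \<Sum>\<^sup>+k. \<Sum>\<^sup>+m. \<integral>\<^sup>+\<kappa>. ?b (fst \<kappa>) j k m * F (snd \<kappa> j, snd \<kappa> k, snd \<kappa> m) \<partial>cluster_law c f)"
    by (rule nn_integral_esum3) measurable
  also have "\<dots> = (\<integral>\<^sup>+n. (\<Sum>\<^sup>+j. \<Sum>\<^sup>+k. \<Sum>\<^sup>+m. ?b n j k m * ?C) \<partial>measure_pmf (poisson_pmf c))"
    unfolding * by (rule nn_integral_esum3[symmetric]) simp
  also have "\<dots> = (\<integral>\<^sup>+n. ?C * (of_nat n * of_nat (n - 1) * of_nat (n - 2)) \<partial>measure_pmf (poisson_pmf c))"
  proof (rule nn_integral_cong)
    fix n :: nat
    show "(\<Sum>\<^sup>+j. \<Sum>\<^sup>+k. \<Sum>\<^sup>+m. ?b n j k m * ?C) = ?C * (of_nat n * of_nat (n - 1) * of_nat (n - 2))"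
    proof -
      have "(\<Sum>\<^sup>+j. \<Sum>\<^sup>+k. \<Sum>\<^sup>+m. ?b n j k m * ?C) = (\<Sum>\<^sup>+j. \<Sum>\<^sup>+k. \<Sum>\<^sup>+m. ?b n j k m) * ?C"
        by (simp add: nn_integral_multc del: of_bool_conj)
      also have "(\<Sum>\<^sup>+j. \<Sum>\<^sup>+k. \<Sum>\<^sup>+m. ?b n j k m) = of_nat n * of_nat (n - 1) * of_nat (n - 2)"
        using card_distinct_triples[of "{..<n}" "{..<n}" "{..<n}" "n - 1" "n - 2"]
        by (simp add: card_Diff_singleton card_Diff_subset numeral_2_eq_2 del: of_bool_conj)
      finally show ?thesis by (simp only: mult.commute)
    qed
  qed
  finally show ?thesis
    unfolding nn_integral_poisson_pmf[OF c] poisson_mean_cmult poisson_mean_3[OF less_imp_le[OF c]]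
    by (simp only: mult.commute power3_eq_cube)
qed

section \<open>Parents with independent cluster marks\<close>

locale neyman_scott_points = poisson_points M l X for M :: "'w measure" and l X +
  fixes c :: real and f :: "plane \<Rightarrow> real" and N :: "nat \<Rightarrow> 'w \<Rightarrow> nat" and D :: "nat \<Rightarrow> nat \<Rightarrow> 'w \<Rightarrow> plane"
  assumes c_pos: "0 < c" and f: "isotropic_density f"
    and marks_measurable: "(\<lambda>\<omega> i. (N i \<omega>, \<lambda>j. D i j \<omega>)) \<in> measurable M (\<Pi>\<^sub>M i\<in>UNIV. cluster_law c f)"
    and joint_law: "distr M ((\<Pi>\<^sub>M i\<in>UNIV. borel) \<Otimes>\<^sub>M (\<Pi>\<^sub>M i\<in>UNIV. cluster_law c f))
            (\<lambda>\<omega>. (\<lambda>i. X i \<omega>, \<lambda>i. (N i \<omega>, \<lambda>j. D i j \<omega>))) =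
          distr M (\<Pi>\<^sub>M i\<in>UNIV. borel) (\<lambda>\<omega> i. X i \<omega>) \<Otimes>\<^sub>M (\<Pi>\<^sub>M i\<in>UNIV. cluster_law c f)"
begin

abbreviation "C \<equiv> cluster_law c f"

abbreviation "\<nu> \<equiv> displacement_law f"

definition Z :: "nat \<Rightarrow> 'w \<Rightarrow> plane \<times> nat \<times> (nat \<Rightarrow> plane)" where
  "Z i \<omega> = (X i \<omega>, N i \<omega>, \<lambda>j. D i j \<omega>)"

lemma f_measurable[measurable]: "f \<in> borel_measurable borel" and f_nonneg: "0 \<le> f x"
  using f unfolding isotropic_density_def by blast+

lemma mark_measurable[measurable]: "(\<lambda>\<omega>. (N i \<omega>, \<lambda>j. D i j \<omega>)) \<in> measurable M C"
  using measurable_compose[OF marks_measurable measurable_component_singleton[of i]] by simp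

lemma N_measurable[measurable]: "N i \<in> measurable M (count_space UNIV)"
  using measurable_compose[OF mark_measurable[of i], of fst "count_space UNIV"] by simp

lemma D_measurable[measurable]: "D i j \<in> borel_measurable M"
  using measurable_compose[OF mark_measurable[of i], of "\<lambda>\<kappa>. snd \<kappa> j" borel] by simp

lemma Z_measurable[measurable]: "Z i \<in> measurable M (borel \<Otimes>\<^sub>M C)"
  unfolding Z_def[abs_def] by measurable

text \<open>Independence of parents and marks in integrated form: with the parent sequence held
  fixed, the mark sequence is integrated out under its own product law.\<close>

lemma nn_integral_joint:
  assumes [measurable]: "G \<in> borel_measurable ((\<Pi>\<^sub>M i\<in>UNIV. borel) \<Otimes>\<^sub>M (\<Pi>\<^sub>M i\<in>UNIV. C))"
  shows "(\<integral>\<^sup>+\<omega>. G (\<lambda>i. X i \<omega>, \<lambda>i. (N i \<omega>, \<lambda>j. D i j \<omega>)) \<partial>M) =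
    (\<integral>\<^sup>+\<omega>. \<integral>\<^sup>+q. G (\<lambda>i. X i \<omega>, q) \<partial>(\<Pi>\<^sub>M i\<in>UNIV. C) \<partial>M)"
proof -
  interpret C: prob_space C by (rule prob_space_cluster_law[OF f])
  interpret P: product_prob_space "\<lambda>_::nat. C" UNIV ..
  have X[measurable]: "(\<lambda>\<omega> i. X i \<omega>) \<in> measurable M (\<Pi>\<^sub>M i\<in>UNIV. borel)"
    by (rule measurable_PiM_single') auto
  note marks_measurable[measurable]
  have "(\<integral>\<^sup>+\<omega>. G (\<lambda>i. X i \<omega>, \<lambda>i. (N i \<omega>, \<lambda>j. D i j \<omega>)) \<partial>M) =
      (\<integral>\<^sup>+t. G t \<partial>(distr M (\<Pi>\<^sub>M i\<in>UNIV. borel) (\<lambda>\<omega> i. X i \<omega>) \<Otimes>\<^sub>M (\<Pi>\<^sub>M i\<in>UNIV. C)))"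
    unfolding joint_law[symmetric] by (subst nn_integral_distr) auto
  also have "\<dots> = (\<integral>\<^sup>+x. \<integral>\<^sup>+q. G (x, q) \<partial>(\<Pi>\<^sub>M i\<in>UNIV. C) \<partial>distr M (\<Pi>\<^sub>M i\<in>UNIV. borel) (\<lambda>\<omega> i. X i \<omega>))"
    by (rule P.nn_integral_fst[symmetric]) measurable
  also have "\<dots> = (\<integral>\<^sup>+\<omega>. \<integral>\<^sup>+q. G (\<lambda>i. X i \<omega>, q) \<partial>(\<Pi>\<^sub>M i\<in>UNIV. C) \<partial>M)"
    by (subst nn_integral_distr) auto
  finally show ?thesis .
qed

text \<open>Averaging over the mark turns \<open>F\<close> into a function of the parent position
  alone, to which Campbell's formula applies.\<close>

lemma marked_points:
  assumes [measurable]: "F \<in> borel_measurable (borel \<Otimes>\<^sub>M C)"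
  shows "(\<integral>\<^sup>+\<omega>. (\<Sum>\<^sup>+i. F (Z i \<omega>)) \<partial>M) = ennreal l * (\<integral>\<^sup>+x. \<integral>\<^sup>+\<kappa>. F (x, \<kappa>) \<partial>C \<partial>lborel)"
proof -
  interpret C: prob_space C by (rule prob_space_cluster_law[OF f])
  define F' where "F' x = (\<integral>\<^sup>+\<kappa>. F (x, \<kappa>) \<partial>C)" for x
  have [measurable]: "F' \<in> borel_measurable borel" unfolding F'_def[abs_def] by measurable
  have "(\<integral>\<^sup>+\<omega>. F (Z i \<omega>) \<partial>M) = (\<integral>\<^sup>+\<omega>. F' (X i \<omega>) \<partial>M)" for i
    using nn_integral_joint[of "\<lambda>(x, q). F (x i, q i)"]
    by (simp add: Z_def F'_def nn_integral_PiM_coordinate[OF C.prob_space_axioms, of "\<lambda>\<kappa>. F (X i _, \<kappa>)"])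
  then have "(\<Sum>\<^sup>+i. \<integral>\<^sup>+\<omega>. F (Z i \<omega>) \<partial>M) = ennreal l * (\<integral>\<^sup>+x. F' x \<partial>lborel)"
    using nn_integral_points[of F'] by simp
  then show ?thesis by (subst nn_integral_esum) (auto simp: F'_def)
qed

text \<open>Different parents carry independent marks, so the two marks are integrated out
  separately; on the diagonal the factor \<open>of_bool (i \<noteq> k)\<close> is 0.\<close>

lemma marked_pairs:
  assumes [measurable]: "F \<in> borel_measurable ((borel \<Otimes>\<^sub>M C) \<Otimes>\<^sub>M borel \<Otimes>\<^sub>M C)"
  shows "(\<integral>\<^sup>+\<omega>. (\<Sum>\<^sup>+i. \<Sum>\<^sup>+k. of_bool (i \<noteq> k) * F (Z i \<omega>, Z k \<omega>)) \<partial>M) =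
    ennreal l ^ 2 * (\<integral>\<^sup>+x. \<integral>\<^sup>+y. \<integral>\<^sup>+\<kappa>. \<integral>\<^sup>+\<kappa>'. F ((x, \<kappa>), (y, \<kappa>')) \<partial>C \<partial>C \<partial>lborel \<partial>lborel)"
proof -
  interpret C: prob_space C by (rule prob_space_cluster_law[OF f])
  define F' where "F' t = (\<integral>\<^sup>+\<kappa>. \<integral>\<^sup>+\<kappa>'. F ((fst t, \<kappa>), (snd t, \<kappa>')) \<partial>C \<partial>C)" for t
  have [measurable]: "F' \<in> borel_measurable (borel \<Otimes>\<^sub>M borel)" unfolding F'_def[abs_def] by measurable
  have "of_bool (i \<noteq> k) * (\<integral>\<^sup>+\<omega>. F (Z i \<omega>, Z k \<omega>) \<partial>M) =
      of_bool (i \<noteq> k) * (\<integral>\<^sup>+\<omega>. F' (X i \<omega>, X k \<omega>) \<partial>M)" for i k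
    using nn_integral_joint[of "\<lambda>(x, q). F ((x i, q i), (x k, q k))"]
    by (cases "i = k")
      (auto simp: Z_def F'_def nn_integral_PiM_two_coordinates[OF C.prob_space_axioms, of i k "\<lambda>(\<kappa>, \<kappa>'). F ((X i _, \<kappa>), (X k _, \<kappa>'))", simplified])
  then have "(\<Sum>\<^sup>+i. \<Sum>\<^sup>+k. \<integral>\<^sup>+\<omega>. of_bool (i \<noteq> k) * F (Z i \<omega>, Z k \<omega>) \<partial>M) =
      ennreal l ^ 2 * (\<integral>\<^sup>+x. \<integral>\<^sup>+y. F' (x, y) \<partial>lborel \<partial>lborel)"
    using nn_integral_point_pairs[of F'] by (simp add: nn_integral_cmult)
  then show ?thesis by (subst nn_integral_esum2) (auto simp: F'_def)
qed

lemma marked_triples: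
  assumes [measurable]: "F \<in> borel_measurable ((borel \<Otimes>\<^sub>M C) \<Otimes>\<^sub>M (borel \<Otimes>\<^sub>M C) \<Otimes>\<^sub>M borel \<Otimes>\<^sub>M C)"
  shows "(\<integral>\<^sup>+\<omega>. (\<Sum>\<^sup>+i. \<Sum>\<^sup>+k. \<Sum>\<^sup>+m. of_bool (i \<noteq> k \<and> i \<noteq> m \<and> k \<noteq> m) * F (Z i \<omega>, Z k \<omega>, Z m \<omega>)) \<partial>M) =
    ennreal l ^ 3 * (\<integral>\<^sup>+x. \<integral>\<^sup>+y. \<integral>\<^sup>+w. \<integral>\<^sup>+\<kappa>. \<integral>\<^sup>+\<kappa>'. \<integral>\<^sup>+\<kappa>''. F ((x, \<kappa>), (y, \<kappa>'), (w, \<kappa>'')) \<partial>C \<partial>C \<partial>C \<partial>lborel \<partial>lborel \<partial>lborel)"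
proof -
  interpret C: prob_space C by (rule prob_space_cluster_law[OF f])
  define F' where "F' t = (\<integral>\<^sup>+\<kappa>. \<integral>\<^sup>+\<kappa>'. \<integral>\<^sup>+\<kappa>''. F ((fst t, \<kappa>), (fst (snd t), \<kappa>'), (snd (snd t), \<kappa>'')) \<partial>C \<partial>C \<partial>C)" for t
  have [measurable]: "F' \<in> borel_measurable (borel \<Otimes>\<^sub>M borel \<Otimes>\<^sub>M borel)" unfolding F'_def[abs_def] by measurable
  have "of_bool (i \<noteq> k \<and> i \<noteq> m \<and> k \<noteq> m) * (\<integral>\<^sup>+\<omega>. F (Z i \<omega>, Z k \<omega>, Z m \<omega>) \<partial>M) =
      of_bool (i \<noteq> k \<and> i \<noteq> m \<and> k \<noteq> m) * (\<integral>\<^sup>+\<omega>. F' (X i \<omega>, X k \<omega>, X m \<omega>) \<partial>M)" for i k m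
    using nn_integral_joint[of "\<lambda>(x, q). F ((x i, q i), (x k, q k), (x m, q m))"]
    by (cases "i \<noteq> k \<and> i \<noteq> m \<and> k \<noteq> m")
      (auto simp: Z_def F'_def nn_integral_PiM_three_coordinates[OF C.prob_space_axioms, of i k m "\<lambda>(\<kappa>, \<kappa>', \<kappa>''). F ((X i _, \<kappa>), (X k _, \<kappa>'), (X m _, \<kappa>''))", simplified])
  then have "(\<Sum>\<^sup>+i. \<Sum>\<^sup>+k. \<Sum>\<^sup>+m. \<integral>\<^sup>+\<omega>. of_bool (i \<noteq> k \<and> i \<noteq> m \<and> k \<noteq> m) * F (Z i \<omega>, Z k \<omega>, Z m \<omega>) \<partial>M) =
      ennreal l ^ 3 * (\<integral>\<^sup>+x. \<integral>\<^sup>+y. \<integral>\<^sup>+w. F' (x, y, w) \<partial>lborel \<partial>lborel \<partial>lborel)"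
    using nn_integral_point_triples[of F'] by (simp add: nn_integral_cmult del: of_bool_conj)
  then show ?thesis by (subst nn_integral_esum3) (auto simp: F'_def simp del: of_bool_conj)
qed

end

lemma nn_integral_lborel_translate:
  fixes g :: "'a::euclidean_space \<Rightarrow> ennreal"
  assumes [measurable]: "g \<in> borel_measurable borel"
  shows "(\<integral>\<^sup>+x. g (x + a) \<partial>lborel) = (\<integral>\<^sup>+x. g x \<partial>lborel)"
proof -
  have "(\<integral>\<^sup>+x. g x \<partial>lborel) = (\<integral>\<^sup>+x. g x \<partial>distr lborel borel ((+) a))"
    by (simp add: lborel_distr_plus)
  also have "\<dots> = (\<integral>\<^sup>+x. g (a + x) \<partial>lborel)" by (subst nn_integral_distr) auto
  finally show ?thesis by (simp add: add.commute)
qed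

section \<open>Sums over the points of one cluster\<close>

type_synonym cluster = "plane \<times> nat \<times> (nat \<Rightarrow> plane)"

definition pt :: "cluster \<Rightarrow> nat \<Rightarrow> plane" where
  "pt z j = fst z + snd (snd z) j"

definition alive :: "cluster \<Rightarrow> nat \<Rightarrow> bool" where
  "alive z j \<longleftrightarrow> j < fst (snd z)"

definition sum1 :: "cluster \<Rightarrow> (plane \<Rightarrow> ennreal) \<Rightarrow> ennreal" where
  "sum1 z h = (\<Sum>\<^sup>+j. of_bool (alive z j) * h (pt z j))"

definition sum2 :: "cluster \<Rightarrow> (plane \<Rightarrow> plane \<Rightarrow> ennreal) \<Rightarrow> ennreal" where
  "sum2 z h = (\<Sum>\<^sup>+j. \<Sum>\<^sup>+k. of_bool (j \<noteq> k \<and> alive z j \<and> alive z k) * h (pt z j) (pt z k))"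

definition sum3 :: "cluster \<Rightarrow> (plane \<Rightarrow> plane \<Rightarrow> plane \<Rightarrow> ennreal) \<Rightarrow> ennreal" where
  "sum3 z h = (\<Sum>\<^sup>+j. \<Sum>\<^sup>+k. \<Sum>\<^sup>+m. of_bool (j \<noteq> k \<and> j \<noteq> m \<and> k \<noteq> m \<and> alive z j \<and> alive z k \<and> alive z m) *
     h (pt z j) (pt z k) (pt z m))"

context neyman_scott_points
begin

lemma pt_measurable[measurable]: "(\<lambda>z. pt z j) \<in> borel_measurable (borel \<Otimes>\<^sub>M C)"
  unfolding pt_def by measurable

lemma alive_measurable[measurable]: "Measurable.pred (borel \<Otimes>\<^sub>M C) (\<lambda>z. alive z j)"
  unfolding alive_def by measurable

text \<open>In nested sums over several clusters the summand \<open>h\<close> depends on the other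
  clusters, so \<open>h\<close> is allowed to vary jointly with the parameter.\<close>

lemma sum1_measurable[measurable (raw)]:
  assumes [measurable]: "z \<in> measurable K (borel \<Otimes>\<^sub>M C)" "(\<lambda>(t, a). h t a) \<in> borel_measurable (K \<Otimes>\<^sub>M borel)"
  shows "(\<lambda>t. sum1 (z t) (h t)) \<in> borel_measurable K"
  unfolding sum1_def by measurable

lemma sum2_measurable[measurable (raw)]:
  assumes [measurable]: "z \<in> measurable K (borel \<Otimes>\<^sub>M C)"
    "(\<lambda>(t, a, b). h t a b) \<in> borel_measurable (K \<Otimes>\<^sub>M borel \<Otimes>\<^sub>M borel)"
  shows "(\<lambda>t. sum2 (z t) (h t)) \<in> borel_measurable K"
proof -
  have [measurable]: "(\<lambda>t. h t (pt (z t) j) (pt (z t) k)) \<in> borel_measurable K" for j k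
    using measurable_compose[OF _ assms(2), of "\<lambda>t. (t, pt (z t) j, pt (z t) k)" K] by simp
  show ?thesis unfolding sum2_def by measurable
qed

lemma sum3_measurable[measurable (raw)]:
  assumes [measurable]: "z \<in> measurable K (borel \<Otimes>\<^sub>M C)"
    "(\<lambda>(t, a, b, d). h t a b d) \<in> borel_measurable (K \<Otimes>\<^sub>M borel \<Otimes>\<^sub>M borel \<Otimes>\<^sub>M borel)"
  shows "(\<lambda>t. sum3 (z t) (h t)) \<in> borel_measurable K"
proof -
  have [measurable]: "(\<lambda>t. h t (pt (z t) j) (pt (z t) k) (pt (z t) m)) \<in> borel_measurable K" for j k m
    using measurable_compose[OF _ assms(2), of "\<lambda>t. (t, pt (z t) j, pt (z t) k, pt (z t) m)" K] by simp
  show ?thesis unfolding sum3_def by measurable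
qed

text \<open>Moves the average over another cluster inside the sum, so that nested cluster sums are
  averaged from the inside out.\<close>

lemma nn_integral_sum1:
  assumes [measurable]: "\<And>a. h a \<in> borel_measurable K"
  shows "(\<integral>\<^sup>+t. sum1 z (\<lambda>a. h a t) \<partial>K) = sum1 z (\<lambda>a. \<integral>\<^sup>+t. h a t \<partial>K)"
  unfolding sum1_def by (subst nn_integral_esum) (auto simp: nn_integral_cmult)

lemma nn_integral_sum2:
  assumes [measurable]: "\<And>a b. h a b \<in> borel_measurable K"
  shows "(\<integral>\<^sup>+t. sum2 z (\<lambda>a b. h a b t) \<partial>K) = sum2 z (\<lambda>a b. \<integral>\<^sup>+t. h a b t \<partial>K)"
  unfolding sum2_def by (subst nn_integral_esum2) (auto simp: nn_integral_cmult)

lemma nn_integral_cluster_sum1: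
  assumes [measurable]: "h \<in> borel_measurable borel"
  shows "(\<integral>\<^sup>+\<kappa>. sum1 (x, \<kappa>) h \<partial>C) = ennreal c * (\<integral>\<^sup>+a. h (x + a) \<partial>\<nu>)"
  using cluster_moment1[OF f c_pos, of "\<lambda>a. h (x + a)"] by (simp add: sum1_def pt_def alive_def)

lemma nn_integral_cluster_sum2:
  assumes [measurable]: "(\<lambda>(a, b). h a b) \<in> borel_measurable (borel \<Otimes>\<^sub>M borel)"
  shows "(\<integral>\<^sup>+\<kappa>. sum2 (x, \<kappa>) h \<partial>C) = ennreal c ^ 2 * (\<integral>\<^sup>+a. \<integral>\<^sup>+b. h (x + a) (x + b) \<partial>\<nu> \<partial>\<nu>)"
proof -
  have [measurable]: "(\<lambda>(a, b). h (x + a) (x + b)) \<in> borel_measurable (borel \<Otimes>\<^sub>M borel)"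
    using measurable_compose[OF _ assms, of "\<lambda>t. (x + fst t, x + snd t)" "borel \<Otimes>\<^sub>M borel"]
    by (simp add: case_prod_beta')
  show ?thesis
    using cluster_moment2[OF f c_pos, of "\<lambda>(a, b). h (x + a) (x + b)"] by (simp add: sum2_def pt_def alive_def)
qed

lemma nn_integral_cluster_sum3:
  assumes [measurable]: "(\<lambda>(a, b, d). h a b d) \<in> borel_measurable (borel \<Otimes>\<^sub>M borel \<Otimes>\<^sub>M borel)"
  shows "(\<integral>\<^sup>+\<kappa>. sum3 (x, \<kappa>) h \<partial>C) =
    ennreal c ^ 3 * (\<integral>\<^sup>+a. \<integral>\<^sup>+b. \<integral>\<^sup>+d. h (x + a) (x + b) (x + d) \<partial>\<nu> \<partial>\<nu> \<partial>\<nu>)"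
proof -
  have [measurable]: "(\<lambda>(a, b, d). h (x + a) (x + b) (x + d)) \<in> borel_measurable (borel \<Otimes>\<^sub>M borel \<Otimes>\<^sub>M borel)"
    using measurable_compose[OF _ assms, of "\<lambda>t. (x + fst t, x + fst (snd t), x + snd (snd t))" "borel \<Otimes>\<^sub>M borel \<Otimes>\<^sub>M borel"]
    by (simp add: case_prod_beta')
  show ?thesis
    using cluster_moment3[OF f c_pos, of "\<lambda>(a, b, d). h (x + a) (x + b) (x + d)"] by (simp add: sum3_def pt_def alive_def)
qed

section \<open>Factorial moments of the full process\<close>

definition Y :: "nat \<times> nat \<Rightarrow> 'w \<Rightarrow> plane" where
  "Y p \<omega> = X (fst p) \<omega> + D (fst p) (snd p) \<omega>"

text \<open>Points are indexed by all pairs of parent and child; \<open>active\<close> selects those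
  that exist, so that sums run over a fixed countable index set.\<close>

definition active :: "nat \<times> nat \<Rightarrow> 'w \<Rightarrow> bool" where
  "active p \<omega> \<longleftrightarrow> snd p < N (fst p) \<omega>"

lemma Y_measurable[measurable]: "Y p \<in> borel_measurable M"
  unfolding Y_def[abs_def] by measurable

lemma active_measurable[measurable]: "Measurable.pred M (active p)"
  unfolding active_def[abs_def] by measurable

lemma Y_pt: "Y (i, j) \<omega> = pt (Z i \<omega>) j" and active_alive: "active (i, j) \<omega> = alive (Z i \<omega>) j"
  by (auto simp: Y_def pt_def Z_def active_def alive_def)

lemma first_moment:
  assumes [measurable]: "g \<in> borel_measurable borel"
  shows "(\<integral>\<^sup>+\<omega>. (\<Sum>\<^sup>+p. of_bool (active p \<omega>) * g (Y p \<omega>)) \<partial>M) = ennreal l * ennreal c * (\<integral>\<^sup>+x. g x \<partial>lborel)"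
proof -
  interpret \<nu>: prob_space \<nu> by (rule prob_space_displacement_law[OF f])
  have "(\<integral>\<^sup>+\<omega>. (\<Sum>\<^sup>+p. of_bool (active p \<omega>) * g (Y p \<omega>)) \<partial>M) = (\<integral>\<^sup>+\<omega>. (\<Sum>\<^sup>+i. sum1 (Z i \<omega>) g) \<partial>M)"
    by (simp add: esum_prod sum1_def Y_pt active_alive)
  also have "\<dots> = ennreal l * (\<integral>\<^sup>+x. \<integral>\<^sup>+\<kappa>. sum1 (x, \<kappa>) g \<partial>C \<partial>lborel)"
    by (rule marked_points) measurable
  also have "\<dots> = ennreal l * (\<integral>\<^sup>+x. ennreal c * (\<integral>\<^sup>+a. g (x + a) \<partial>\<nu>) \<partial>lborel)"
    by (simp add: nn_integral_cluster_sum1)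
  also have "\<dots> = ennreal l * ennreal c * (\<integral>\<^sup>+x. \<integral>\<^sup>+a. g (x + a) \<partial>\<nu> \<partial>lborel)"
    by (simp add: nn_integral_cmult mult.assoc)
  also have "(\<integral>\<^sup>+x. \<integral>\<^sup>+a. g (x + a) \<partial>\<nu> \<partial>lborel) = (\<integral>\<^sup>+a. \<integral>\<^sup>+x. g (x + a) \<partial>lborel \<partial>\<nu>)"
  proof -
    interpret pair_sigma_finite lborel \<nu> ..
    show ?thesis by (rule Fubini'[symmetric]) measurable
  qed
  also have "\<dots> = (\<integral>\<^sup>+x. g x \<partial>lborel)"
    using \<nu>.emeasure_space_1 by (simp add: nn_integral_lborel_translate)
  finally show ?thesis .
qed

lemma lborel_displacement_swap:
  assumes [measurable]: "(\<lambda>(x, a). g x a) \<in> borel_measurable (borel \<Otimes>\<^sub>M borel)"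
  shows "(\<integral>\<^sup>+x. \<integral>\<^sup>+a. g x a \<partial>\<nu> \<partial>lborel) = (\<integral>\<^sup>+a. \<integral>\<^sup>+x. g x a \<partial>lborel \<partial>\<nu>)"
proof -
  interpret \<nu>: prob_space \<nu> by (rule prob_space_displacement_law[OF f])
  interpret pair_sigma_finite lborel \<nu> ..
  show ?thesis by (rule Fubini'[symmetric]) measurable
qed

text \<open>Two points either have different parents, which are then integrated independently, or
  belong to one cluster, which leaves a single integral over the common parent.\<close>

lemma second_moment:
  assumes [measurable]: "(\<lambda>(x, y). g x y) \<in> borel_measurable (borel \<Otimes>\<^sub>M borel)"
  shows "(\<integral>\<^sup>+\<omega>. (\<Sum>\<^sup>+p. \<Sum>\<^sup>+q. of_bool (p \<noteq> q \<and> active p \<omega> \<and> active q \<omega>) * g (Y p \<omega>) (Y q \<omega>)) \<partial>M) =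
    ennreal l ^ 2 * ennreal c ^ 2 * (\<integral>\<^sup>+x. \<integral>\<^sup>+y. \<integral>\<^sup>+a. \<integral>\<^sup>+b. g (x + a) (y + b) \<partial>\<nu> \<partial>\<nu> \<partial>lborel \<partial>lborel) +
    ennreal l * ennreal c ^ 2 * (\<integral>\<^sup>+x. \<integral>\<^sup>+a. \<integral>\<^sup>+b. g (x + a) (x + b) \<partial>\<nu> \<partial>\<nu> \<partial>lborel)"
proof -
  interpret \<nu>: prob_space \<nu> by (rule prob_space_displacement_law[OF f])
  have g1[measurable (raw)]: "(\<lambda>t. g (h1 t) (h2 t)) \<in> borel_measurable K"
    if "h1 \<in> borel_measurable K" "h2 \<in> borel_measurable K" for h1 h2 K
    using measurable_compose[OF _ assms, of "\<lambda>t. (h1 t, h2 t)" K] that by simp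
  let ?S = "\<lambda>\<omega>. \<Sum>\<^sup>+i. \<Sum>\<^sup>+k. of_bool (i \<noteq> k) * sum1 (Z i \<omega>) (\<lambda>a. sum1 (Z k \<omega>) (g a))"
  \<comment> \<open>Interchanging the inner sums brings both parent indices to the front, so that
    the case distinction is made on parents.\<close>
  have split: "(\<Sum>\<^sup>+p. \<Sum>\<^sup>+q. of_bool (p \<noteq> q \<and> active p \<omega> \<and> active q \<omega>) * g (Y p \<omega>) (Y q \<omega>)) =
      ?S \<omega> + (\<Sum>\<^sup>+i. sum2 (Z i \<omega>) g)" for \<omega>
  proof -
    have "(\<Sum>\<^sup>+p. \<Sum>\<^sup>+q. of_bool (p \<noteq> q \<and> active p \<omega> \<and> active q \<omega>) * g (Y p \<omega>) (Y q \<omega>)) =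
        (\<Sum>\<^sup>+i. \<Sum>\<^sup>+k. \<Sum>\<^sup>+j. \<Sum>\<^sup>+m. of_bool ((i, j) \<noteq> (k, m) \<and> active (i, j) \<omega> \<and> active (k, m) \<omega>) *
          g (Y (i, j) \<omega>) (Y (k, m) \<omega>))" (is "_ = (\<Sum>\<^sup>+i. \<Sum>\<^sup>+k. ?T i k)")
      unfolding esum_prod by (intro nn_integral_cong esum_swap)
    also have "\<dots> = (\<Sum>\<^sup>+i. \<Sum>\<^sup>+k. of_bool (i \<noteq> k) * sum1 (Z i \<omega>) (\<lambda>a. sum1 (Z k \<omega>) (g a)) +
        (if k = i then sum2 (Z k \<omega>) g else 0))"
    proof (intro nn_integral_cong)
      fix i k
      have "(\<Sum>\<^sup>+m. of_bool (active (i, j) \<omega> \<and> active (k, m) \<omega>) * g (Y (i, j) \<omega>) (Y (k, m) \<omega>)) =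
         of_bool (active (i, j) \<omega>) * (\<Sum>\<^sup>+m. of_bool (active (k, m) \<omega>) * g (Y (i, j) \<omega>) (Y (k, m) \<omega>))" for j
        by (simp add: nn_integral_cmult[symmetric] mult.assoc)
      then show "?T i k = of_bool (i \<noteq> k) * sum1 (Z i \<omega>) (\<lambda>a. sum1 (Z k \<omega>) (g a)) +
        (if k = i then sum2 (Z k \<omega>) g else 0)"
        by (cases "i = k") (auto simp: sum1_def sum2_def Y_pt active_alive)
    qed
    also have "\<dots> = ?S \<omega> + (\<Sum>\<^sup>+i. sum2 (Z i \<omega>) g)"
      by (simp add: nn_integral_add esum_single)
    finally show ?thesis .
  qed
  have "(\<integral>\<^sup>+\<omega>. ?S \<omega> \<partial>M) = ennreal l ^ 2 * (\<integral>\<^sup>+x. \<integral>\<^sup>+y. \<integral>\<^sup>+\<kappa>. \<integral>\<^sup>+\<kappa>'. sum1 (x, \<kappa>) (\<lambda>a. sum1 (y, \<kappa>') (g a)) \<partial>C \<partial>C \<partial>lborel \<partial>lborel)"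
    using marked_pairs[of "\<lambda>(z, z'). sum1 z (\<lambda>a. sum1 z' (g a))"] by simp
  also have "\<dots> = ennreal l ^ 2 * (\<integral>\<^sup>+x. \<integral>\<^sup>+y. ennreal c ^ 2 * (\<integral>\<^sup>+a. \<integral>\<^sup>+b. g (x + a) (y + b) \<partial>\<nu> \<partial>\<nu>) \<partial>lborel \<partial>lborel)"
    by (simp add: nn_integral_sum1 nn_integral_cluster_sum1 nn_integral_cmult power2_eq_square mult.assoc)
  also have "\<dots> = ennreal l ^ 2 * ennreal c ^ 2 * (\<integral>\<^sup>+x. \<integral>\<^sup>+y. \<integral>\<^sup>+a. \<integral>\<^sup>+b. g (x + a) (y + b) \<partial>\<nu> \<partial>\<nu> \<partial>lborel \<partial>lborel)"
    by (simp add: nn_integral_cmult mult.assoc)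
  finally have A: "(\<integral>\<^sup>+\<omega>. ?S \<omega> \<partial>M) = \<dots>" .
  have "(\<integral>\<^sup>+\<omega>. (\<Sum>\<^sup>+i. sum2 (Z i \<omega>) g) \<partial>M) = ennreal l * (\<integral>\<^sup>+x. \<integral>\<^sup>+\<kappa>. sum2 (x, \<kappa>) g \<partial>C \<partial>lborel)"
    by (rule marked_points) measurable
  also have "\<dots> = ennreal l * ennreal c ^ 2 * (\<integral>\<^sup>+x. \<integral>\<^sup>+a. \<integral>\<^sup>+b. g (x + a) (x + b) \<partial>\<nu> \<partial>\<nu> \<partial>lborel)"
    by (simp add: nn_integral_cluster_sum2 nn_integral_cmult mult.assoc)
  finally have B: "(\<integral>\<^sup>+\<omega>. (\<Sum>\<^sup>+i. sum2 (Z i \<omega>) g) \<partial>M) = \<dots>" .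
  show ?thesis unfolding split by (subst nn_integral_add) (auto simp: A B)
qed

text \<open>Triples are sorted by which points share a parent: none, one of three pairs, or all.
  Symmetry in the last two arguments identifies the two patterns where the first point shares its
  cluster with exactly one other, hence the factor 2.\<close>

lemma third_moment:
  assumes g[measurable]: "(\<lambda>(x, y, w). g x y w) \<in> borel_measurable (borel \<Otimes>\<^sub>M borel \<Otimes>\<^sub>M borel)"
    and sym: "\<And>x y w. g x y w = g x w y"
  shows "(\<integral>\<^sup>+\<omega>. (\<Sum>\<^sup>+p. \<Sum>\<^sup>+q. \<Sum>\<^sup>+r. of_bool (p \<noteq> q \<and> p \<noteq> r \<and> q \<noteq> r \<and> active p \<omega> \<and> active q \<omega> \<and> active r \<omega>) *
      g (Y p \<omega>) (Y q \<omega>) (Y r \<omega>)) \<partial>M) =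
    ennreal c ^ 3 * (
      ennreal l ^ 3 * (\<integral>\<^sup>+x. \<integral>\<^sup>+y. \<integral>\<^sup>+w. \<integral>\<^sup>+a. \<integral>\<^sup>+b. \<integral>\<^sup>+d. g (x + a) (y + b) (w + d) \<partial>\<nu> \<partial>\<nu> \<partial>\<nu> \<partial>lborel \<partial>lborel \<partial>lborel) +
      2 * ennreal l ^ 2 * (\<integral>\<^sup>+x. \<integral>\<^sup>+y. \<integral>\<^sup>+a. \<integral>\<^sup>+b. \<integral>\<^sup>+d. g (x + a) (x + b) (y + d) \<partial>\<nu> \<partial>\<nu> \<partial>\<nu> \<partial>lborel \<partial>lborel) +
      ennreal l ^ 2 * (\<integral>\<^sup>+x. \<integral>\<^sup>+y. \<integral>\<^sup>+a. \<integral>\<^sup>+b. \<integral>\<^sup>+d. g (x + a) (y + b) (y + d) \<partial>\<nu> \<partial>\<nu> \<partial>\<nu> \<partial>lborel \<partial>lborel) +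
      ennreal l * (\<integral>\<^sup>+x. \<integral>\<^sup>+a. \<integral>\<^sup>+b. \<integral>\<^sup>+d. g (x + a) (x + b) (x + d) \<partial>\<nu> \<partial>\<nu> \<partial>\<nu> \<partial>lborel))"
    (is "_ = ennreal c ^ 3 * (ennreal l ^ 3 * ?I0 + 2 * ennreal l ^ 2 * ?I1 + ennreal l ^ 2 * ?I3 + ennreal l * ?I4)")
proof -
  interpret \<nu>: prob_space \<nu> by (rule prob_space_displacement_law[OF f])
  have g1[measurable (raw)]: "(\<lambda>t. g (h1 t) (h2 t) (h3 t)) \<in> borel_measurable K"
    if "h1 \<in> borel_measurable K" "h2 \<in> borel_measurable K" "h3 \<in> borel_measurable K" for h1 h2 h3 K
    using measurable_compose[OF _ g, of "\<lambda>t. (h1 t, h2 t, h3 t)" K] that by simp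
  let ?S0 = "\<lambda>z z' z''. sum1 z (\<lambda>a. sum1 z' (\<lambda>b. sum1 z'' (g a b)))"
  let ?S1 = "\<lambda>z z'. sum2 z (\<lambda>a b. sum1 z' (g a b))"
  let ?S3 = "\<lambda>z z'. sum1 z (\<lambda>a. sum2 z' (g a))"
  let ?dist = "\<lambda>i k m :: nat. of_bool (i \<noteq> k \<and> i \<noteq> m \<and> k \<noteq> m) :: ennreal"
  have split: "(\<Sum>\<^sup>+p. \<Sum>\<^sup>+q. \<Sum>\<^sup>+r. of_bool (p \<noteq> q \<and> p \<noteq> r \<and> q \<noteq> r \<and> active p \<omega> \<and> active q \<omega> \<and> active r \<omega>) *
      g (Y p \<omega>) (Y q \<omega>) (Y r \<omega>)) =
      (\<Sum>\<^sup>+i. \<Sum>\<^sup>+k. \<Sum>\<^sup>+m. ?dist i k m * ?S0 (Z i \<omega>) (Z k \<omega>) (Z m \<omega>)) +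
      2 * (\<Sum>\<^sup>+i. \<Sum>\<^sup>+k. of_bool (i \<noteq> k) * ?S1 (Z i \<omega>) (Z k \<omega>)) +
      (\<Sum>\<^sup>+i. \<Sum>\<^sup>+k. of_bool (i \<noteq> k) * ?S3 (Z i \<omega>) (Z k \<omega>)) +
      (\<Sum>\<^sup>+i. sum3 (Z i \<omega>) g)" (is "?L = ?R") for \<omega>
  proof -
    let ?t = "\<lambda>i j k n m s. of_bool ((i, j) \<noteq> (k, n) \<and> (i, j) \<noteq> (m, s) \<and> (k, n) \<noteq> (m, s) \<and>
        active (i, j) \<omega> \<and> active (k, n) \<omega> \<and> active (m, s) \<omega>) * g (Y (i, j) \<omega>) (Y (k, n) \<omega>) (Y (m, s) \<omega>)"
    let ?T = "\<lambda>i k m. \<Sum>\<^sup>+j. \<Sum>\<^sup>+n. \<Sum>\<^sup>+s. ?t i j k n m s"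
    \<comment> \<open>One summand for each coincidence pattern of the parent indices; for given
      \<open>i\<close>, \<open>k\<close>, \<open>m\<close> all summands but the one of the actual
      pattern are 0.\<close>
    let ?R' = "\<lambda>i k m. ?dist i k m * ?S0 (Z i \<omega>) (Z k \<omega>) (Z m \<omega>) +
        (if k = i then of_bool (i \<noteq> m) * ?S1 (Z i \<omega>) (Z m \<omega>) else 0) +
        (if m = i then of_bool (i \<noteq> k) * ?S1 (Z i \<omega>) (Z k \<omega>) else 0) +
        (if m = k then of_bool (i \<noteq> k) * ?S3 (Z i \<omega>) (Z k \<omega>) else 0) +
        (if m = i then (if k = i then sum3 (Z i \<omega>) g else 0) else 0)"
    have "?L = (\<Sum>\<^sup>+i. \<Sum>\<^sup>+k. \<Sum>\<^sup>+j. \<Sum>\<^sup>+n. \<Sum>\<^sup>+m. \<Sum>\<^sup>+s. ?t i j k n m s)"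
      unfolding esum_prod by (intro nn_integral_cong esum_swap)
    also have "\<dots> = (\<Sum>\<^sup>+i. \<Sum>\<^sup>+k. \<Sum>\<^sup>+j. \<Sum>\<^sup>+m. \<Sum>\<^sup>+n. \<Sum>\<^sup>+s. ?t i j k n m s)"
      by (intro nn_integral_cong esum_swap)
    also have "\<dots> = (\<Sum>\<^sup>+i. \<Sum>\<^sup>+k. \<Sum>\<^sup>+m. ?T i k m)"
      by (intro nn_integral_cong esum_swap)
    also have "\<dots> = (\<Sum>\<^sup>+i. \<Sum>\<^sup>+k. \<Sum>\<^sup>+m. ?R' i k m)"
    proof (intro nn_integral_cong)
      fix i k m :: nat
      let ?a = "\<lambda>i j. of_bool (alive (Z i \<omega>) j) :: ennreal" and ?p = "\<lambda>i j. pt (Z i \<omega>) j"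
      consider "i \<noteq> k" "i \<noteq> m" "k \<noteq> m" | "k = i" "i \<noteq> m" | "m = i" "i \<noteq> k" | "m = k" "i \<noteq> k" | "m = i" "k = i" by blast
      then show "?T i k m = ?R' i k m"
      proof cases
        case 1
        have "?T i k m = (\<Sum>\<^sup>+j. \<Sum>\<^sup>+n. \<Sum>\<^sup>+s. ?a i j * (?a k n * (?a m s * g (?p i j) (?p k n) (?p m s))))"
          using 1 by (intro nn_integral_cong) (auto simp: Y_pt active_alive)
        also have "\<dots> = ?S0 (Z i \<omega>) (Z k \<omega>) (Z m \<omega>)" by (simp add: sum1_def nn_integral_cmult)
        finally show ?thesis using 1 by simp
      next
        case 2
        have "?T i k m = (\<Sum>\<^sup>+j. \<Sum>\<^sup>+n. \<Sum>\<^sup>+s. of_bool (j \<noteq> n \<and> alive (Z i \<omega>) j \<and> alive (Z i \<omega>) n) *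
            (?a m s * g (?p i j) (?p i n) (?p m s)))"
          using 2 by (intro nn_integral_cong) (auto simp: Y_pt active_alive)
        also have "\<dots> = ?S1 (Z i \<omega>) (Z m \<omega>)" by (simp add: sum1_def sum2_def nn_integral_cmult del: of_bool_conj)
        finally show ?thesis using 2 by simp
      next
        \<comment> \<open>Here the third point shares the parent of the first; \<open>sym\<close>
          exchanges the last two arguments, which reduces this pattern to the form of the previous
          case.\<close>
        case 3
        have "?T i k m = (\<Sum>\<^sup>+j. \<Sum>\<^sup>+n. \<Sum>\<^sup>+s. of_bool (j \<noteq> s \<and> alive (Z i \<omega>) j \<and> alive (Z i \<omega>) s) *
            (?a k n * g (?p i j) (?p i s) (?p k n)))"
          using 3 sym by (intro nn_integral_cong) (auto simp: Y_pt active_alive)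
        also have "\<dots> = (\<Sum>\<^sup>+j. \<Sum>\<^sup>+s. \<Sum>\<^sup>+n. of_bool (j \<noteq> s \<and> alive (Z i \<omega>) j \<and> alive (Z i \<omega>) s) *
            (?a k n * g (?p i j) (?p i s) (?p k n)))"
          by (intro nn_integral_cong esum_swap)
        also have "\<dots> = ?S1 (Z i \<omega>) (Z k \<omega>)" by (simp add: sum1_def sum2_def nn_integral_cmult del: of_bool_conj)
        finally show ?thesis using 3 by simp
      next
        case 4
        have "?T i k m = (\<Sum>\<^sup>+j. \<Sum>\<^sup>+n. \<Sum>\<^sup>+s. ?a i j * (of_bool (n \<noteq> s \<and> alive (Z k \<omega>) n \<and> alive (Z k \<omega>) s) *
            g (?p i j) (?p k n) (?p k s)))"
          using 4 by (intro nn_integral_cong) (auto simp: Y_pt active_alive)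
        also have "\<dots> = ?S3 (Z i \<omega>) (Z k \<omega>)" by (simp add: sum1_def sum2_def nn_integral_cmult del: of_bool_conj)
        finally show ?thesis using 4 by simp
      next
        case 5
        then show ?thesis by (simp add: sum3_def Y_pt active_alive)
      qed
    qed
    also have "\<dots> = (\<Sum>\<^sup>+i. \<Sum>\<^sup>+k. \<Sum>\<^sup>+m. ?dist i k m * ?S0 (Z i \<omega>) (Z k \<omega>) (Z m \<omega>)) +
        (\<Sum>\<^sup>+i. \<Sum>\<^sup>+k. \<Sum>\<^sup>+m. if k = i then of_bool (i \<noteq> m) * ?S1 (Z i \<omega>) (Z m \<omega>) else 0) +
        (\<Sum>\<^sup>+i. \<Sum>\<^sup>+k. \<Sum>\<^sup>+m. if m = i then of_bool (i \<noteq> k) * ?S1 (Z i \<omega>) (Z k \<omega>) else 0) +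
        (\<Sum>\<^sup>+i. \<Sum>\<^sup>+k. \<Sum>\<^sup>+m. if m = k then of_bool (i \<noteq> k) * ?S3 (Z i \<omega>) (Z k \<omega>) else 0) +
        (\<Sum>\<^sup>+i. \<Sum>\<^sup>+k. \<Sum>\<^sup>+m. if m = i then (if k = i then sum3 (Z i \<omega>) g else 0) else 0)"
      by (simp add: nn_integral_add del: of_bool_conj)
    also have "(\<Sum>\<^sup>+i. \<Sum>\<^sup>+k. \<Sum>\<^sup>+m. if k = i then of_bool (i \<noteq> m) * ?S1 (Z i \<omega>) (Z m \<omega>) else 0) =
        (\<Sum>\<^sup>+i. \<Sum>\<^sup>+k. if k = i then \<Sum>\<^sup>+m. of_bool (i \<noteq> m) * ?S1 (Z i \<omega>) (Z m \<omega>) else 0)"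
      by (intro nn_integral_cong) simp
    also have "\<dots> = (\<Sum>\<^sup>+i. \<Sum>\<^sup>+m. of_bool (i \<noteq> m) * ?S1 (Z i \<omega>) (Z m \<omega>))"
      by (simp only: esum_single)
    finally show ?thesis by (simp only: esum_single mult_2 add.assoc)
  qed
  have A0: "(\<integral>\<^sup>+\<omega>. (\<Sum>\<^sup>+i. \<Sum>\<^sup>+k. \<Sum>\<^sup>+m. ?dist i k m * ?S0 (Z i \<omega>) (Z k \<omega>) (Z m \<omega>)) \<partial>M) = ennreal c ^ 3 * (ennreal l ^ 3 * ?I0)"
  proof -
    have inner: "(\<integral>\<^sup>+\<kappa>. \<integral>\<^sup>+\<kappa>'. \<integral>\<^sup>+\<kappa>''. ?S0 (x, \<kappa>) (y, \<kappa>') (w, \<kappa>'') \<partial>C \<partial>C \<partial>C) =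
        ennreal c ^ 3 * (\<integral>\<^sup>+a. \<integral>\<^sup>+b. \<integral>\<^sup>+d. g (x + a) (y + b) (w + d) \<partial>\<nu> \<partial>\<nu> \<partial>\<nu>)" for x y w
    proof -
      have m1: "(\<lambda>t. sum1 (y, \<kappa>') (\<lambda>b. sum1 (w, t) (g a b))) \<in> borel_measurable C" for \<kappa>' a
        unfolding sum1_def by measurable
      have "(\<integral>\<^sup>+\<kappa>''. sum1 (y, \<kappa>') (\<lambda>b. sum1 (w, \<kappa>'') (g a b)) \<partial>C) =
          sum1 (y, \<kappa>') (\<lambda>b. ennreal c * (\<integral>\<^sup>+d. g a b (w + d) \<partial>\<nu>))" for a \<kappa>'
        by (subst nn_integral_sum1) (simp_all add: nn_integral_cluster_sum1)
      then have "(\<integral>\<^sup>+\<kappa>''. ?S0 (x, \<kappa>) (y, \<kappa>') (w, \<kappa>'') \<partial>C) =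
          sum1 (x, \<kappa>) (\<lambda>a. sum1 (y, \<kappa>') (\<lambda>b. ennreal c * (\<integral>\<^sup>+d. g a b (w + d) \<partial>\<nu>)))" for \<kappa> \<kappa>'
        by (subst nn_integral_sum1) (simp_all add: m1)
      moreover have "(\<integral>\<^sup>+\<kappa>'. sum1 (x, \<kappa>) (\<lambda>a. sum1 (y, \<kappa>') (\<lambda>b. ennreal c * (\<integral>\<^sup>+d. g a b (w + d) \<partial>\<nu>))) \<partial>C) =
          sum1 (x, \<kappa>) (\<lambda>a. ennreal c * (\<integral>\<^sup>+b. ennreal c * (\<integral>\<^sup>+d. g a (y + b) (w + d) \<partial>\<nu>) \<partial>\<nu>))" for \<kappa>
        by (subst nn_integral_sum1) (simp_all add: nn_integral_cluster_sum1)
      ultimately show ?thesis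
        by (simp add: nn_integral_cluster_sum1 nn_integral_cmult power3_eq_cube mult.assoc)
    qed
    have "(\<integral>\<^sup>+\<omega>. (\<Sum>\<^sup>+i. \<Sum>\<^sup>+k. \<Sum>\<^sup>+m. ?dist i k m * ?S0 (Z i \<omega>) (Z k \<omega>) (Z m \<omega>)) \<partial>M) =
        ennreal l ^ 3 * (\<integral>\<^sup>+x. \<integral>\<^sup>+y. \<integral>\<^sup>+w. \<integral>\<^sup>+\<kappa>. \<integral>\<^sup>+\<kappa>'. \<integral>\<^sup>+\<kappa>''. ?S0 (x, \<kappa>) (y, \<kappa>') (w, \<kappa>'') \<partial>C \<partial>C \<partial>C \<partial>lborel \<partial>lborel \<partial>lborel)"
      using marked_triples[of "\<lambda>(z, z', z''). ?S0 z z' z''"] by (simp del: of_bool_conj)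
    also have "\<dots> = ennreal l ^ 3 * (\<integral>\<^sup>+x. \<integral>\<^sup>+y. \<integral>\<^sup>+w. ennreal c ^ 3 *
        (\<integral>\<^sup>+a. \<integral>\<^sup>+b. \<integral>\<^sup>+d. g (x + a) (y + b) (w + d) \<partial>\<nu> \<partial>\<nu> \<partial>\<nu>) \<partial>lborel \<partial>lborel \<partial>lborel)"
      by (simp add: inner)
    also have "\<dots> = ennreal c ^ 3 * (ennreal l ^ 3 * ?I0)"
      by (simp add: nn_integral_cmult mult_ac)
    finally show ?thesis .
  qed
  have A1: "(\<integral>\<^sup>+\<omega>. (\<Sum>\<^sup>+i. \<Sum>\<^sup>+k. of_bool (i \<noteq> k) * ?S1 (Z i \<omega>) (Z k \<omega>)) \<partial>M) = ennreal c ^ 3 * (ennreal l ^ 2 * ?I1)"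
  proof -
    have "(\<integral>\<^sup>+\<omega>. (\<Sum>\<^sup>+i. \<Sum>\<^sup>+k. of_bool (i \<noteq> k) * ?S1 (Z i \<omega>) (Z k \<omega>)) \<partial>M) =
        ennreal l ^ 2 * (\<integral>\<^sup>+x. \<integral>\<^sup>+y. \<integral>\<^sup>+\<kappa>. \<integral>\<^sup>+\<kappa>'. ?S1 (x, \<kappa>) (y, \<kappa>') \<partial>C \<partial>C \<partial>lborel \<partial>lborel)"
      using marked_pairs[of "\<lambda>(z, z'). ?S1 z z'"] by simp
    also have "\<dots> = ennreal l ^ 2 * (\<integral>\<^sup>+x. \<integral>\<^sup>+y. ennreal c ^ 3 *
        (\<integral>\<^sup>+a. \<integral>\<^sup>+b. \<integral>\<^sup>+d. g (x + a) (x + b) (y + d) \<partial>\<nu> \<partial>\<nu> \<partial>\<nu>) \<partial>lborel \<partial>lborel)"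
      by (simp add: nn_integral_sum2 nn_integral_cluster_sum1 nn_integral_cluster_sum2 nn_integral_cmult
          power3_eq_cube power2_eq_square mult.assoc)
    also have "\<dots> = ennreal c ^ 3 * (ennreal l ^ 2 * ?I1)"
      by (simp add: nn_integral_cmult mult_ac)
    finally show ?thesis .
  qed
  have A3: "(\<integral>\<^sup>+\<omega>. (\<Sum>\<^sup>+i. \<Sum>\<^sup>+k. of_bool (i \<noteq> k) * ?S3 (Z i \<omega>) (Z k \<omega>)) \<partial>M) = ennreal c ^ 3 * (ennreal l ^ 2 * ?I3)"
  proof -
    have "(\<integral>\<^sup>+\<omega>. (\<Sum>\<^sup>+i. \<Sum>\<^sup>+k. of_bool (i \<noteq> k) * ?S3 (Z i \<omega>) (Z k \<omega>)) \<partial>M) =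
        ennreal l ^ 2 * (\<integral>\<^sup>+x. \<integral>\<^sup>+y. \<integral>\<^sup>+\<kappa>. \<integral>\<^sup>+\<kappa>'. ?S3 (x, \<kappa>) (y, \<kappa>') \<partial>C \<partial>C \<partial>lborel \<partial>lborel)"
      using marked_pairs[of "\<lambda>(z, z'). ?S3 z z'"] by simp
    also have "\<dots> = ennreal l ^ 2 * (\<integral>\<^sup>+x. \<integral>\<^sup>+y. ennreal c ^ 3 *
        (\<integral>\<^sup>+a. \<integral>\<^sup>+b. \<integral>\<^sup>+d. g (x + a) (y + b) (y + d) \<partial>\<nu> \<partial>\<nu> \<partial>\<nu>) \<partial>lborel \<partial>lborel)"
      by (simp add: nn_integral_sum1 nn_integral_cluster_sum1 nn_integral_cluster_sum2 nn_integral_cmult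
          power3_eq_cube power2_eq_square mult.assoc)
    also have "\<dots> = ennreal c ^ 3 * (ennreal l ^ 2 * ?I3)"
      by (simp add: nn_integral_cmult mult_ac)
    finally show ?thesis .
  qed
  have A4: "(\<integral>\<^sup>+\<omega>. (\<Sum>\<^sup>+i. sum3 (Z i \<omega>) g) \<partial>M) = ennreal c ^ 3 * (ennreal l * ?I4)"
  proof -
    have "(\<integral>\<^sup>+\<omega>. (\<Sum>\<^sup>+i. sum3 (Z i \<omega>) g) \<partial>M) = ennreal l * (\<integral>\<^sup>+x. \<integral>\<^sup>+\<kappa>. sum3 (x, \<kappa>) g \<partial>C \<partial>lborel)"
      by (rule marked_points) measurable
    also have "\<dots> = ennreal c ^ 3 * (ennreal l * ?I4)"
      by (simp add: nn_integral_cluster_sum3 nn_integral_cmult mult_ac)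
    finally show ?thesis .
  qed
  show ?thesis unfolding split
    by (simp add: nn_integral_add nn_integral_cmult A0 A1 A3 A4 distrib_left mult_ac del: of_bool_conj)
qed

section \<open>Removing displacements by translation invariance\<close>

lemma displacement_translate1:
  assumes [measurable]: "g \<in> borel_measurable borel"
  shows "(\<integral>\<^sup>+x. \<integral>\<^sup>+a. g (x + a) \<partial>\<nu> \<partial>lborel) = (\<integral>\<^sup>+x. g x \<partial>lborel)"
proof -
  interpret \<nu>: prob_space \<nu> by (rule prob_space_displacement_law[OF f])
  show ?thesis
    using \<nu>.emeasure_space_1 by (simp add: lborel_displacement_swap nn_integral_lborel_translate)
qed

text \<open>Each displacement is moved next to the Lebesgue integral of its own parent and absorbed
  there by a shift, one variable at a time.\<close>

lemma displacement_translate2: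
  assumes g[measurable]: "(\<lambda>(x, y). g x y) \<in> borel_measurable (borel \<Otimes>\<^sub>M borel)"
  shows "(\<integral>\<^sup>+x. \<integral>\<^sup>+y. \<integral>\<^sup>+a. \<integral>\<^sup>+b. g (x + a) (y + b) \<partial>\<nu> \<partial>\<nu> \<partial>lborel \<partial>lborel) = (\<integral>\<^sup>+x. \<integral>\<^sup>+y. g x y \<partial>lborel \<partial>lborel)"
proof -
  interpret \<nu>: prob_space \<nu> by (rule prob_space_displacement_law[OF f])
  have [measurable (raw)]: "(\<lambda>t. g (h1 t) (h2 t)) \<in> borel_measurable K"
    if "h1 \<in> borel_measurable K" "h2 \<in> borel_measurable K" for h1 h2 K
    using measurable_compose[OF _ g, of "\<lambda>t. (h1 t, h2 t)" K] that by simp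
  have "(\<integral>\<^sup>+x. \<integral>\<^sup>+y. \<integral>\<^sup>+a. \<integral>\<^sup>+b. g (x + a) (y + b) \<partial>\<nu> \<partial>\<nu> \<partial>lborel \<partial>lborel) =
      (\<integral>\<^sup>+x. \<integral>\<^sup>+a. \<integral>\<^sup>+y. \<integral>\<^sup>+b. g (x + a) (y + b) \<partial>\<nu> \<partial>lborel \<partial>\<nu> \<partial>lborel)"
    by (intro nn_integral_cong lborel_displacement_swap) measurable
  also have "\<dots> = (\<integral>\<^sup>+x. \<integral>\<^sup>+a. \<integral>\<^sup>+y. g (x + a) y \<partial>lborel \<partial>\<nu> \<partial>lborel)"
    by (intro nn_integral_cong displacement_translate1) measurable
  also have "\<dots> = (\<integral>\<^sup>+x. \<integral>\<^sup>+y. g x y \<partial>lborel \<partial>lborel)"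
    by (rule displacement_translate1) measurable
  finally show ?thesis .
qed

lemma displacement_translate3:
  assumes g[measurable]: "(\<lambda>(x, y, w). g x y w) \<in> borel_measurable (borel \<Otimes>\<^sub>M borel \<Otimes>\<^sub>M borel)"
  shows "(\<integral>\<^sup>+x. \<integral>\<^sup>+y. \<integral>\<^sup>+w. \<integral>\<^sup>+a. \<integral>\<^sup>+b. \<integral>\<^sup>+d. g (x + a) (y + b) (w + d) \<partial>\<nu> \<partial>\<nu> \<partial>\<nu> \<partial>lborel \<partial>lborel \<partial>lborel) =
    (\<integral>\<^sup>+x. \<integral>\<^sup>+y. \<integral>\<^sup>+w. g x y w \<partial>lborel \<partial>lborel \<partial>lborel)"
proof -
  interpret \<nu>: prob_space \<nu> by (rule prob_space_displacement_law[OF f])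
  have [measurable (raw)]: "(\<lambda>t. g (h1 t) (h2 t) (h3 t)) \<in> borel_measurable K"
    if "h1 \<in> borel_measurable K" "h2 \<in> borel_measurable K" "h3 \<in> borel_measurable K" for h1 h2 h3 K
    using measurable_compose[OF _ g, of "\<lambda>t. (h1 t, h2 t, h3 t)" K] that by simp
  have "(\<integral>\<^sup>+x. \<integral>\<^sup>+y. \<integral>\<^sup>+w. \<integral>\<^sup>+a. \<integral>\<^sup>+b. \<integral>\<^sup>+d. g (x + a) (y + b) (w + d) \<partial>\<nu> \<partial>\<nu> \<partial>\<nu> \<partial>lborel \<partial>lborel \<partial>lborel) =
      (\<integral>\<^sup>+x. \<integral>\<^sup>+y. \<integral>\<^sup>+a. \<integral>\<^sup>+w. \<integral>\<^sup>+b. \<integral>\<^sup>+d. g (x + a) (y + b) (w + d) \<partial>\<nu> \<partial>\<nu> \<partial>lborel \<partial>\<nu> \<partial>lborel \<partial>lborel)"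
    by (intro nn_integral_cong lborel_displacement_swap) measurable
  also have "\<dots> = (\<integral>\<^sup>+x. \<integral>\<^sup>+y. \<integral>\<^sup>+a. \<integral>\<^sup>+b. \<integral>\<^sup>+w. \<integral>\<^sup>+d. g (x + a) (y + b) (w + d) \<partial>\<nu> \<partial>lborel \<partial>\<nu> \<partial>\<nu> \<partial>lborel \<partial>lborel)"
    by (intro nn_integral_cong lborel_displacement_swap) measurable
  also have "\<dots> = (\<integral>\<^sup>+x. \<integral>\<^sup>+y. \<integral>\<^sup>+a. \<integral>\<^sup>+b. \<integral>\<^sup>+w. g (x + a) (y + b) w \<partial>lborel \<partial>\<nu> \<partial>\<nu> \<partial>lborel \<partial>lborel)"
    by (intro nn_integral_cong displacement_translate1) measurable
  also have "\<dots> = (\<integral>\<^sup>+x. \<integral>\<^sup>+y. \<integral>\<^sup>+w. g x y w \<partial>lborel \<partial>lborel \<partial>lborel)"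
    by (rule displacement_translate2) measurable
  finally show ?thesis .
qed

lemma nn_integral_lborel_diff:
  assumes [measurable]: "(u :: plane \<Rightarrow> ennreal) \<in> borel_measurable borel"
  shows "(\<integral>\<^sup>+y. u (y - x) \<partial>lborel) = (\<integral>\<^sup>+y. u y \<partial>lborel)"
  using nn_integral_lborel_translate[of u "- x"] by simp

text \<open>The window fixes the location of one point of a cluster, so the free position of the
  parent contributes exactly the area of \<open>B\<close>.\<close>

lemma window_translate:
  assumes [measurable]: "B \<in> sets borel" "(h :: plane \<Rightarrow> ennreal) \<in> borel_measurable borel"
  shows "(\<integral>\<^sup>+x. \<integral>\<^sup>+a. indicator B (x + a) * h a \<partial>\<nu> \<partial>lborel) = emeasure lborel B * (\<integral>\<^sup>+a. h a \<partial>\<nu>)"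
proof -
  interpret \<nu>: prob_space \<nu> by (rule prob_space_displacement_law[OF f])
  have "(\<integral>\<^sup>+x. \<integral>\<^sup>+a. indicator B (x + a) * h a \<partial>\<nu> \<partial>lborel) = (\<integral>\<^sup>+a. \<integral>\<^sup>+x. indicator B (x + a) * h a \<partial>lborel \<partial>\<nu>)"
    by (rule lborel_displacement_swap) measurable
  also have "\<dots> = (\<integral>\<^sup>+a. emeasure lborel B * h a \<partial>\<nu>)"
    by (simp add: nn_integral_multc nn_integral_lborel_translate[of "indicator B"])
  finally show ?thesis by (simp add: nn_integral_cmult)
qed

text \<open>The prefactor is the mean number of points in \<open>B\<close>. The other factor is the
  reduced Palm expectation of the sum of \<open>u\<close>: a part from foreign clusters, and a part
  from the cluster of the window point, where two points differ by a difference of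
  displacements.\<close>

lemma second_moment_window:
  assumes [measurable]: "B \<in> sets borel" "(u :: plane \<Rightarrow> ennreal) \<in> borel_measurable borel"
  shows "(\<integral>\<^sup>+\<omega>. (\<Sum>\<^sup>+p. \<Sum>\<^sup>+q. of_bool (p \<noteq> q \<and> active p \<omega> \<and> active q \<omega>) *
      (indicator B (Y p \<omega>) * u (Y q \<omega> - Y p \<omega>))) \<partial>M) =
    ennreal l * ennreal c * emeasure lborel B *
      (ennreal l * ennreal c * (\<integral>\<^sup>+x. u x \<partial>lborel) + ennreal c * (\<integral>\<^sup>+a. \<integral>\<^sup>+b. u (b - a) \<partial>\<nu> \<partial>\<nu>))"
proof -
  interpret \<nu>: prob_space \<nu> by (rule prob_space_displacement_law[OF f])
  let ?I0 = "\<integral>\<^sup>+x. \<integral>\<^sup>+y. \<integral>\<^sup>+a. \<integral>\<^sup>+b. indicator B (x + a) * u (y + b - (x + a)) \<partial>\<nu> \<partial>\<nu> \<partial>lborel \<partial>lborel"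
  let ?I1 = "\<integral>\<^sup>+x. \<integral>\<^sup>+a. \<integral>\<^sup>+b. indicator B (x + a) * u (x + b - (x + a)) \<partial>\<nu> \<partial>\<nu> \<partial>lborel"
  have "?I0 =
      (\<integral>\<^sup>+x. \<integral>\<^sup>+y. indicator B x * u (y - x) \<partial>lborel \<partial>lborel)"
    by (rule displacement_translate2) measurable
  also have "\<dots> = emeasure lborel B * (\<integral>\<^sup>+x. u x \<partial>lborel)"
    by (simp add: nn_integral_cmult nn_integral_multc nn_integral_lborel_diff)
  finally have 1: "?I0 = \<dots>" .
  have "?I1 =
      (\<integral>\<^sup>+x. \<integral>\<^sup>+a. indicator B (x + a) * (\<integral>\<^sup>+b. u (b - a) \<partial>\<nu>) \<partial>\<nu> \<partial>lborel)"
    by (simp add: nn_integral_cmult)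
  also have "\<dots> = emeasure lborel B * (\<integral>\<^sup>+a. \<integral>\<^sup>+b. u (b - a) \<partial>\<nu> \<partial>\<nu>)"
    by (rule window_translate) measurable
  finally have 2: "?I1 = \<dots>" .
  show ?thesis
    by (subst second_moment) (measurable, simp only: 1 2, simp add: power2_eq_square distrib_left mult_ac)
qed

text \<open>If the two other points lie in different clusters, the integral factors into
  \<open>U\<close> and \<kappa>. If they share a cluster it need not factor; bounding the average
  over the last displacement by \<delta> leaves an expression of second-moment type.\<close>

lemma third_moment_window:
  assumes [measurable]: "B \<in> sets borel" "(u :: plane \<Rightarrow> ennreal) \<in> borel_measurable borel"
    and \<delta>: "\<And>s. (\<integral>\<^sup>+b. u (s + b) \<partial>\<nu>) \<le> \<delta>"
  defines "U \<equiv> \<integral>\<^sup>+x. u x \<partial>lborel" and "\<kappa> \<equiv> \<integral>\<^sup>+a. \<integral>\<^sup>+b. u (b - a) \<partial>\<nu> \<partial>\<nu>"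
  shows "(\<integral>\<^sup>+\<omega>. (\<Sum>\<^sup>+p. \<Sum>\<^sup>+q. \<Sum>\<^sup>+r. of_bool (p \<noteq> q \<and> p \<noteq> r \<and> q \<noteq> r \<and> active p \<omega> \<and> active q \<omega> \<and> active r \<omega>) *
      (indicator B (Y p \<omega>) * u (Y q \<omega> - Y p \<omega>) * u (Y r \<omega> - Y p \<omega>))) \<partial>M) \<le>
    ennreal c ^ 3 * emeasure lborel B *
      (ennreal l ^ 3 * U ^ 2 + 2 * ennreal l ^ 2 * (U * \<kappa>) + ennreal l ^ 2 * (\<delta> * U) + ennreal l * (\<delta> * \<kappa>))"
proof -
  interpret \<nu>: prob_space \<nu> by (rule prob_space_displacement_law[OF f])
  let ?g = "\<lambda>x y w. indicator B x * u (y - x) * u (w - x)"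
  let ?I0 = "\<integral>\<^sup>+x. \<integral>\<^sup>+y. \<integral>\<^sup>+w. \<integral>\<^sup>+a. \<integral>\<^sup>+b. \<integral>\<^sup>+d. ?g (x + a) (y + b) (w + d) \<partial>\<nu> \<partial>\<nu> \<partial>\<nu> \<partial>lborel \<partial>lborel \<partial>lborel"
  let ?I1 = "\<integral>\<^sup>+x. \<integral>\<^sup>+y. \<integral>\<^sup>+a. \<integral>\<^sup>+b. \<integral>\<^sup>+d. ?g (x + a) (x + b) (y + d) \<partial>\<nu> \<partial>\<nu> \<partial>\<nu> \<partial>lborel \<partial>lborel"
  let ?I3 = "\<integral>\<^sup>+x. \<integral>\<^sup>+y. \<integral>\<^sup>+a. \<integral>\<^sup>+b. \<integral>\<^sup>+d. ?g (x + a) (y + b) (y + d) \<partial>\<nu> \<partial>\<nu> \<partial>\<nu> \<partial>lborel \<partial>lborel"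
  let ?I4 = "\<integral>\<^sup>+x. \<integral>\<^sup>+a. \<integral>\<^sup>+b. \<integral>\<^sup>+d. ?g (x + a) (x + b) (x + d) \<partial>\<nu> \<partial>\<nu> \<partial>\<nu> \<partial>lborel"
  have "?I0 =
      (\<integral>\<^sup>+x. \<integral>\<^sup>+y. \<integral>\<^sup>+w. ?g x y w \<partial>lborel \<partial>lborel \<partial>lborel)"
    by (rule displacement_translate3) measurable
  also have "\<dots> = emeasure lborel B * U ^ 2"
    by (simp add: nn_integral_cmult nn_integral_multc nn_integral_lborel_diff U_def power2_eq_square mult.assoc)
  finally have I0: "?I0 = \<dots>" .
  have "?I1 =
      (\<integral>\<^sup>+x. \<integral>\<^sup>+a. \<integral>\<^sup>+y. \<integral>\<^sup>+b. \<integral>\<^sup>+d. ?g (x + a) (x + b) (y + d) \<partial>\<nu> \<partial>\<nu> \<partial>lborel \<partial>\<nu> \<partial>lborel)"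
    by (intro nn_integral_cong lborel_displacement_swap) measurable
  also have "\<dots> = (\<integral>\<^sup>+x. \<integral>\<^sup>+a. \<integral>\<^sup>+b. \<integral>\<^sup>+y. \<integral>\<^sup>+d. ?g (x + a) (x + b) (y + d) \<partial>\<nu> \<partial>lborel \<partial>\<nu> \<partial>\<nu> \<partial>lborel)"
    by (intro nn_integral_cong lborel_displacement_swap) measurable
  also have "\<dots> = (\<integral>\<^sup>+x. \<integral>\<^sup>+a. \<integral>\<^sup>+b. \<integral>\<^sup>+y. ?g (x + a) (x + b) y \<partial>lborel \<partial>\<nu> \<partial>\<nu> \<partial>lborel)"
    by (intro nn_integral_cong displacement_translate1) measurable
  also have "\<dots> = (\<integral>\<^sup>+x. \<integral>\<^sup>+a. indicator B (x + a) * ((\<integral>\<^sup>+b. u (b - a) \<partial>\<nu>) * U) \<partial>\<nu> \<partial>lborel)"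
    by (simp add: nn_integral_cmult nn_integral_multc nn_integral_lborel_diff U_def mult.assoc)
  also have "\<dots> = emeasure lborel B * (\<integral>\<^sup>+a. (\<integral>\<^sup>+b. u (b - a) \<partial>\<nu>) * U \<partial>\<nu>)"
    by (rule window_translate) measurable
  also have "\<dots> = emeasure lborel B * (U * \<kappa>)"
    by (subst nn_integral_multc) (auto simp: \<kappa>_def mult.commute)
  finally have I1: "?I1 = \<dots>" .
  have "?I3 =
      (\<integral>\<^sup>+x. \<integral>\<^sup>+a. \<integral>\<^sup>+y. \<integral>\<^sup>+b. \<integral>\<^sup>+d. ?g (x + a) (y + b) (y + d) \<partial>\<nu> \<partial>\<nu> \<partial>lborel \<partial>\<nu> \<partial>lborel)"
    by (intro nn_integral_cong lborel_displacement_swap) measurable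
  also have "\<dots> = (\<integral>\<^sup>+x. \<integral>\<^sup>+y. \<integral>\<^sup>+b. \<integral>\<^sup>+d. ?g x (y + b) (y + d) \<partial>\<nu> \<partial>\<nu> \<partial>lborel \<partial>lborel)"
    by (rule displacement_translate1) measurable
  also have "\<dots> = (\<integral>\<^sup>+x. \<integral>\<^sup>+y. \<integral>\<^sup>+b. indicator B x * u (y + b - x) * (\<integral>\<^sup>+d. u ((y - x) + d) \<partial>\<nu>) \<partial>\<nu> \<partial>lborel \<partial>lborel)"
    by (simp add: nn_integral_cmult algebra_simps)
  \<comment> \<open>\<delta> is applied with \<open>s = y - x\<close>, the parent of the shared
    cluster as seen from the window point.\<close>
  also have "\<dots> \<le> (\<integral>\<^sup>+x. \<integral>\<^sup>+y. \<integral>\<^sup>+b. indicator B x * u (y + b - x) * \<delta> \<partial>\<nu> \<partial>lborel \<partial>lborel)"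
    by (intro nn_integral_mono mult_left_mono \<delta>) simp
  also have "\<dots> = (\<integral>\<^sup>+x. \<integral>\<^sup>+y. indicator B x * u (y - x) * \<delta> \<partial>lborel \<partial>lborel)"
    by (intro nn_integral_cong displacement_translate1) measurable
  also have "\<dots> = emeasure lborel B * (\<delta> * U)"
    by (simp add: nn_integral_cmult nn_integral_multc nn_integral_lborel_diff U_def mult_ac)
  finally have I3: "?I3 \<le> \<dots>" .
  have "?I4 =
      (\<integral>\<^sup>+x. \<integral>\<^sup>+a. \<integral>\<^sup>+b. indicator B (x + a) * u (b - a) * (\<integral>\<^sup>+d. u (- a + d) \<partial>\<nu>) \<partial>\<nu> \<partial>\<nu> \<partial>lborel)"
    by (simp add: nn_integral_cmult)
  \<comment> \<open>With a common parent the last point lies at \<open>- a + d\<close> from the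
    window point, so \<delta> applies with \<open>s = - a\<close>.\<close>
  also have "\<dots> \<le> (\<integral>\<^sup>+x. \<integral>\<^sup>+a. \<integral>\<^sup>+b. indicator B (x + a) * u (b - a) * \<delta> \<partial>\<nu> \<partial>\<nu> \<partial>lborel)"
    by (intro nn_integral_mono mult_left_mono \<delta>) simp
  also have "\<dots> = (\<integral>\<^sup>+x. \<integral>\<^sup>+a. indicator B (x + a) * ((\<integral>\<^sup>+b. u (b - a) \<partial>\<nu>) * \<delta>) \<partial>\<nu> \<partial>lborel)"
    by (simp add: nn_integral_cmult nn_integral_multc mult.assoc)
  also have "\<dots> = emeasure lborel B * (\<integral>\<^sup>+a. (\<integral>\<^sup>+b. u (b - a) \<partial>\<nu>) * \<delta> \<partial>\<nu>)"
    by (rule window_translate) measurable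
  also have "\<dots> = emeasure lborel B * (\<delta> * \<kappa>)"
    by (subst nn_integral_multc) (auto simp: \<kappa>_def mult.commute)
  finally have I4: "?I4 \<le> \<dots>" .
  have "(\<integral>\<^sup>+\<omega>. (\<Sum>\<^sup>+p. \<Sum>\<^sup>+q. \<Sum>\<^sup>+r. of_bool (p \<noteq> q \<and> p \<noteq> r \<and> q \<noteq> r \<and> active p \<omega> \<and> active q \<omega> \<and> active r \<omega>) *
      ?g (Y p \<omega>) (Y q \<omega>) (Y r \<omega>)) \<partial>M) \<le>
    ennreal c ^ 3 * (ennreal l ^ 3 * (emeasure lborel B * U ^ 2) + 2 * ennreal l ^ 2 * (emeasure lborel B * (U * \<kappa>)) +
      ennreal l ^ 2 * (emeasure lborel B * (\<delta> * U)) + ennreal l * (emeasure lborel B * (\<delta> * \<kappa>)))"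
    by (subst third_moment) (measurable, simp add: mult_ac, simp only: I0 I1, intro mult_left_mono add_mono I3 I4 order_refl, simp_all)
  also have "\<dots> = ennreal c ^ 3 * emeasure lborel B *
      (ennreal l ^ 3 * U ^ 2 + 2 * ennreal l ^ 2 * (U * \<kappa>) + ennreal l ^ 2 * (\<delta> * U) + ennreal l * (\<delta> * \<kappa>))"
    by (simp add: distrib_left mult_ac)
  finally show ?thesis .
qed

end

section \<open>Bonferroni inequalities for unordered products\<close>

text \<open>By monotone convergence the sum is the supremum of the sums over the finite sets of
  elements with code below \<open>n\<close>.\<close>

lemma esum_le_finite_sums:
  fixes g :: "'i::countable \<Rightarrow> ennreal"
  assumes "\<And>S. finite S \<Longrightarrow> (\<Sum>i\<in>S. g i) \<le> R"
  shows "(\<Sum>\<^sup>+i. g i) \<le> R"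
proof -
  let ?J = "\<lambda>n. {i::'i. to_nat i < n}"
  have fin: "finite (?J n)" for n
    by (rule finite_imageD[of to_nat]) (auto intro: finite_subset[of _ "{..<n}"] simp: inj_on_def)
  have "(\<Sum>\<^sup>+i. g i) = (\<Sum>\<^sup>+i. SUP n. g i * indicator (?J n) i)"
  proof (rule nn_integral_cong)
    fix i
    show "g i = (SUP n. g i * indicator (?J n) i)"
      by (rule antisym, rule SUP_upper2[of "Suc (to_nat i)"])
        (auto intro!: SUP_least simp: indicator_def)
  qed
  also have "\<dots> = (SUP n. \<Sum>\<^sup>+i. g i * indicator (?J n) i)"
    by (rule nn_integral_monotone_convergence_SUP)
      (auto simp: incseq_def le_fun_def indicator_def)
  also have "\<dots> \<le> R"
  proof (rule SUP_least)
    fix n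
    have "(\<Sum>\<^sup>+i. g i * indicator (?J n) i) = (\<Sum>i\<in>?J n. g i * indicator (?J n) i)"
      using fin by (intro nn_integral_count_space') auto
    also have "\<dots> = (\<Sum>i\<in>?J n. g i)" by (rule sum.cong) auto
    finally show "(\<Sum>\<^sup>+i. g i * indicator (?J n) i) \<le> R" using assms[OF fin, of n] by simp
  qed
  finally show ?thesis .
qed

lemma finite_sum_le_esum: "finite S \<Longrightarrow> (\<Sum>i\<in>S. g i) \<le> (\<Sum>\<^sup>+i. g i)"
proof -
  assume "finite S"
  then have "(\<Sum>i\<in>S. g i) = (\<Sum>\<^sup>+i. g i * indicator S i)"
    using nn_integral_count_space'[of S UNIV "\<lambda>i. g i * indicator S i"] by simp
  also have "\<dots> \<le> (\<Sum>\<^sup>+i. g i)" by (intro nn_integral_mono) (auto simp: indicator_def)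
  finally show ?thesis .
qed

text \<open>In the divergent case both conventions agree: \<open>infsum\<close> of a family that is
  not summable is 0, and \<open>enn2real\<close> sends \<infinity> to 0.\<close>

lemma infsum_eq_enn2real_esum:
  fixes g :: "'i \<Rightarrow> real"
  assumes "\<And>i. 0 \<le> g i"
  shows "infsum g UNIV = enn2real (\<Sum>\<^sup>+i. ennreal (g i))"
proof -
  have iff: "g summable_on UNIV \<longleftrightarrow> Infinite_Set_Sum.abs_summable_on g UNIV"
    by (rule trans[OF summable_on_iff_abs_summable_on_real abs_summable_equivalent])
  show ?thesis
  proof (cases "g summable_on UNIV")
  case True
  then have s: "Infinite_Set_Sum.abs_summable_on g UNIV"
    using iff by blast
  then show ?thesis
    using assms nn_integral_conv_infsetsum[OF s] infsetsum_infsum[OF s]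
    by (simp add: infsum_nonneg)
next
  case False
  then have "\<not> Infinite_Set_Sum.abs_summable_on g UNIV"
    using iff by blast
  then have "(\<Sum>\<^sup>+i. ennreal (g i)) = \<infinity>"
    using assms unfolding Infinite_Set_Sum.abs_summable_on_def integrable_iff_bounded by (auto simp: less_top[symmetric])
  then show ?thesis using False by (simp add: infsum_not_exists)
  qed
qed

text \<open>The infimum of the finite subproducts is the value of an unordered product of factors in \<open>[0,1]\<close>.\<close>

definition inf_prod :: "('i \<Rightarrow> real) \<Rightarrow> real" where
  "inf_prod w = (INF Q\<in>{Q. finite Q}. \<Prod>q\<in>Q. w q)"

lemma inf_prod_le:
  assumes "\<And>q. 0 \<le> w q" "finite Q" shows "inf_prod w \<le> (\<Prod>q\<in>Q. w q)"
  unfolding inf_prod_def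
  by (rule cINF_lower) (use assms in \<open>auto intro!: bdd_belowI2[where m = 0] prod_nonneg\<close>)

lemma inf_prod_greatest:
  assumes "\<And>Q. finite Q \<Longrightarrow> b \<le> (\<Prod>q\<in>Q. w q)" shows "b \<le> inf_prod w"
  unfolding inf_prod_def by (rule cINF_greatest) (use assms in auto)

lemma inf_prod_bounds:
  assumes "\<And>q. 0 \<le> w q"
  shows "0 \<le> inf_prod w" "inf_prod w \<le> 1"
  using inf_prod_le[OF assms, of "{}"] by (auto intro!: inf_prod_greatest prod_nonneg assms)

lemma borel_measurable_inf_prod[measurable (raw)]:
  fixes w :: "'w \<Rightarrow> 'i::countable \<Rightarrow> real"
  assumes [measurable]: "\<And>q. (\<lambda>\<omega>. w \<omega> q) \<in> borel_measurable M"
  shows "(\<lambda>\<omega>. inf_prod (w \<omega>)) \<in> borel_measurable M"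
  unfolding inf_prod_def
  by (rule borel_measurable_cINF_real) (auto simp: countable_Collect_finite)

text \<open>Factors in [0,1] make the finite subproducts decrease as the set grows, so their limit
  is the infimum. Locations become indices, padded with the factor 1 outside \<open>A\<close>, so
  that the index type is fixed and measurability can be checked factor by factor.\<close>

lemma config_prod_image:
  fixes h :: "'i \<Rightarrow> plane"
  assumes v: "\<And>x. 0 \<le> v x" "\<And>x. v x \<le> 1" and inj: "inj_on h A"
  shows "config_prod v (h ` A) = inf_prod (\<lambda>q. if q \<in> A then v (h q) else 1)"
proof -
  let ?L = "INF S\<in>{S. finite S \<and> S \<subseteq> h ` A}. \<Prod>x\<in>S. v x"
  have bdd: "bdd_below ((\<lambda>S. \<Prod>x\<in>S. v x) ` {S. finite S \<and> S \<subseteq> h ` A})"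
    by (auto intro!: bdd_belowI2[where m = 0] prod_nonneg v)
  have ne: "{S. finite S \<and> S \<subseteq> h ` A} \<noteq> {}" by auto
  have "((\<lambda>S. \<Prod>x\<in>S. v x) \<longlongrightarrow> ?L) (finite_subsets_at_top (h ` A))"
  proof (rule order_tendstoI)
    fix a assume "a < ?L"
    show "\<forall>\<^sub>F S in finite_subsets_at_top (h ` A). a < (\<Prod>x\<in>S. v x)"
    proof (rule eventually_finite_subsets_at_top_weakI)
      fix S assume "finite S" "S \<subseteq> h ` A"
      then have "?L \<le> (\<Prod>x\<in>S. v x)" by (intro cINF_lower bdd) auto
      with \<open>a < ?L\<close> show "a < (\<Prod>x\<in>S. v x)" by simp
    qed
  next
    fix a assume "?L < a"
    then obtain S where S: "finite S" "S \<subseteq> h ` A" "(\<Prod>x\<in>S. v x) < a"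
      using cINF_less_iff[OF ne bdd] by auto
    show "\<forall>\<^sub>F S in finite_subsets_at_top (h ` A). (\<Prod>x\<in>S. v x) < a"
      unfolding eventually_finite_subsets_at_top
    proof (intro exI[of _ S] conjI allI impI S(1,2))
      fix T assume T: "finite T \<and> S \<subseteq> T \<and> T \<subseteq> h ` A"
      then have "(\<Prod>x\<in>T. v x) = (\<Prod>x\<in>T - S. v x) * (\<Prod>x\<in>S. v x)"
        by (intro prod.subset_diff) auto
      also have "\<dots> \<le> 1 * (\<Prod>x\<in>S. v x)"
        by (intro mult_right_mono prod_le_1 prod_nonneg) (auto simp: v)
      finally show "(\<Prod>x\<in>T. v x) < a" using S(3) by simp
    qed
  qed
  then have "config_prod v (h ` A) = ?L"
    unfolding config_prod_def by (intro tendsto_Lim) auto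
  also have "(\<lambda>S. \<Prod>x\<in>S. v x) ` {S. finite S \<and> S \<subseteq> h ` A} =
      (\<lambda>Q. \<Prod>q\<in>Q. if q \<in> A then v (h q) else 1) ` {Q. finite Q}"
  proof (intro equalityI subsetI)
    fix t assume "t \<in> (\<lambda>S. \<Prod>x\<in>S. v x) ` {S. finite S \<and> S \<subseteq> h ` A}"
    then obtain S where S: "finite S" "S \<subseteq> h ` A" "t = (\<Prod>x\<in>S. v x)" by auto
    then obtain Q where Q: "Q \<subseteq> A" "finite Q" "S = h ` Q" by (meson finite_subset_image)
    have "t = (\<Prod>q\<in>Q. v (h q))"
      using S(3) Q inj by (simp add: prod.reindex inj_on_subset)
    also have "\<dots> = (\<Prod>q\<in>Q. if q \<in> A then v (h q) else 1)"
      using Q(1) by (intro prod.cong) auto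
    finally show "t \<in> (\<lambda>Q. \<Prod>q\<in>Q. if q \<in> A then v (h q) else 1) ` {Q. finite Q}" using Q(2) by blast
  next
    fix t assume "t \<in> (\<lambda>Q. \<Prod>q\<in>Q. if q \<in> A then v (h q) else 1) ` {Q. finite Q}"
    then obtain Q where Q: "finite Q" "t = (\<Prod>q\<in>Q. if q \<in> A then v (h q) else 1)" by auto
    have "t = (\<Prod>q\<in>Q \<inter> A. v (h q))"
      unfolding Q(2) using Q(1) by (simp add: prod.inter_restrict)
    also have "\<dots> = (\<Prod>x\<in>h ` (Q \<inter> A). v x)"
      using inj by (simp add: prod.reindex inj_on_subset[of h A])
    finally show "t \<in> (\<lambda>S. \<Prod>x\<in>S. v x) ` {S. finite S \<and> S \<subseteq> h ` A}" using Q(1) by auto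
  qed
  then have "?L = inf_prod (\<lambda>q. if q \<in> A then v (h q) else 1)"
    unfolding inf_prod_def by simp
  finally show ?thesis .
qed

text \<open>A further factor \<open>1 - w a\<close> lowers the product by at most
  \<open>w a\<close>.\<close>

lemma bonferroni_upper:
  fixes w :: "'i \<Rightarrow> real"
  assumes "finite Q" "\<And>q. 0 \<le> w q" "\<And>q. w q \<le> 1"
  shows "1 - (\<Prod>q\<in>Q. 1 - w q) \<le> (\<Sum>q\<in>Q. w q)"
  using assms(1)
proof induction
  case (insert a Q)
  have "(\<Prod>q\<in>Q. 1 - w q) \<le> 1" by (intro prod_le_1) (auto simp: assms)
  then have "w a * (\<Prod>q\<in>Q. 1 - w q) \<le> w a" using assms(2) mult_left_le by blast
  then show ?case using insert by (simp add: algebra_simps)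
qed simp

text \<open>The double sum runs over ordered pairs, twice the sharp second-order term, because
  ordered tuples are what factorial moments count. The induction consumes one copy of
  \<open>w a\<close> times the sum over \<open>Q\<close> and has two available.\<close>

lemma bonferroni_lower:
  fixes w :: "'i \<Rightarrow> real"
  assumes "finite Q" "\<And>q. 0 \<le> w q" "\<And>q. w q \<le> 1"
  shows "(\<Sum>q\<in>Q. w q) \<le> 1 - (\<Prod>q\<in>Q. 1 - w q) + (\<Sum>q\<in>Q. \<Sum>r\<in>Q. if q \<noteq> r then w q * w r else 0)"
  using assms(1)
proof induction
  case (insert a Q)
  have "w a * (1 - (\<Prod>q\<in>Q. 1 - w q)) \<le> w a * (\<Sum>q\<in>Q. w q)"
    by (intro mult_left_mono bonferroni_upper insert.hyps assms)
  moreover have "(\<Sum>q\<in>insert a Q. \<Sum>r\<in>insert a Q. if q \<noteq> r then w q * w r else 0) =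
      (\<Sum>q\<in>Q. \<Sum>r\<in>Q. if q \<noteq> r then w q * w r else 0) + 2 * (w a * (\<Sum>q\<in>Q. w q))"
  proof -
    have "(\<Sum>r\<in>Q. if a \<noteq> r then w a * w r else 0) = w a * (\<Sum>q\<in>Q. w q)"
      using insert.hyps by (auto simp: sum_distrib_left intro!: sum.cong)
    moreover have "(\<Sum>q\<in>Q. if q \<noteq> a then w q * w a else 0) = w a * (\<Sum>q\<in>Q. w q)"
      using insert.hyps by (auto simp: sum_distrib_left intro!: sum.cong)
    ultimately show ?thesis using insert.hyps by (simp add: sum.distrib)
  qed
  moreover have "0 \<le> w a * (\<Sum>q\<in>Q. w q)" by (intro mult_nonneg_nonneg sum_nonneg assms)
  ultimately show ?case using insert by (simp add: algebra_simps)
qed simp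

text \<open>The finite sums are bounded by the full one, so the finite inequality passes to the
  infimum; an infinite sum makes the claim trivial.\<close>

lemma inf_prod_upper:
  fixes w :: "'i::countable \<Rightarrow> real"
  assumes w: "\<And>q. 0 \<le> w q" "\<And>q. w q \<le> 1"
  shows "ennreal (1 - inf_prod (\<lambda>q. 1 - w q)) \<le> (\<Sum>\<^sup>+q. ennreal (w q))"
proof (cases "(\<Sum>\<^sup>+q. ennreal (w q)) = \<infinity>")
  case False
  then obtain s where s: "(\<Sum>\<^sup>+q. ennreal (w q)) = ennreal s" "0 \<le> s" 
    by (cases "\<Sum>\<^sup>+q. ennreal (w q)" rule: ennreal_cases) auto
  have "1 - s \<le> inf_prod (\<lambda>q. 1 - w q)"
  proof (rule inf_prod_greatest)
    fix Q :: "'i set" assume "finite Q"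
    then have "ennreal (\<Sum>q\<in>Q. w q) \<le> ennreal s"
      using finite_sum_le_esum[of Q "\<lambda>q. ennreal (w q)"] s(1) w by (simp add: sum_ennreal)
    then have "(\<Sum>q\<in>Q. w q) \<le> s" using s(2) by (simp add: ennreal_le_iff)
    then show "1 - s \<le> (\<Prod>q\<in>Q. 1 - w q)" using bonferroni_upper[OF \<open>finite Q\<close>, of w] w by simp
  qed
  then show ?thesis using s by (simp add: ennreal_leI)
qed simp

text \<open>Each finite partial sum on the left obeys the finite inequality, and passing from
  \<open>Q\<close> to the whole type only increases both terms on the right.\<close>

lemma inf_prod_lower:
  fixes w :: "'i::countable \<Rightarrow> real"
  assumes w: "\<And>q. 0 \<le> w q" "\<And>q. w q \<le> 1"
  shows "(\<Sum>\<^sup>+q. ennreal (w q)) \<le> ennreal (1 - inf_prod (\<lambda>q. 1 - w q)) +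
    (\<Sum>\<^sup>+q. \<Sum>\<^sup>+r. of_bool (q \<noteq> r) * (ennreal (w q) * ennreal (w r)))"
proof (rule esum_le_finite_sums)
  fix Q :: "'i set" assume Q: "finite Q"
  have p: "(\<Prod>q\<in>Q. 1 - w q) \<le> 1" by (intro prod_le_1) (use w in auto)
  have i: "inf_prod (\<lambda>q. 1 - w q) \<le> (\<Prod>q\<in>Q. 1 - w q)" by (rule inf_prod_le) (use w Q in auto)
  have "(\<Sum>q\<in>Q. ennreal (w q)) = ennreal (\<Sum>q\<in>Q. w q)" using w by (simp add: sum_ennreal)
  also have "\<dots> \<le> ennreal (1 - (\<Prod>q\<in>Q. 1 - w q) + (\<Sum>q\<in>Q. \<Sum>r\<in>Q. if q \<noteq> r then w q * w r else 0))"
    by (intro ennreal_leI bonferroni_lower Q w)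
  also have "\<dots> = ennreal (1 - (\<Prod>q\<in>Q. 1 - w q)) + ennreal (\<Sum>q\<in>Q. \<Sum>r\<in>Q. if q \<noteq> r then w q * w r else 0)"
    using p w by (intro ennreal_plus sum_nonneg) auto
  also have "\<dots> \<le> ennreal (1 - inf_prod (\<lambda>q. 1 - w q)) + (\<Sum>\<^sup>+q. \<Sum>\<^sup>+r. of_bool (q \<noteq> r) * (ennreal (w q) * ennreal (w r)))"
  proof (rule add_mono)
    show "ennreal (1 - (\<Prod>q\<in>Q. 1 - w q)) \<le> ennreal (1 - inf_prod (\<lambda>q. 1 - w q))"
      using i by (intro ennreal_leI) simp
    have "ennreal (\<Sum>q\<in>Q. \<Sum>r\<in>Q. if q \<noteq> r then w q * w r else 0) =
        (\<Sum>q\<in>Q. ennreal (\<Sum>r\<in>Q. if q \<noteq> r then w q * w r else 0))"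
      using w by (intro sum_ennreal[symmetric] sum_nonneg) auto
    also have "\<dots> = (\<Sum>q\<in>Q. \<Sum>r\<in>Q. ennreal (if q \<noteq> r then w q * w r else 0))"
      using w by (intro sum.cong refl sum_ennreal[symmetric]) auto
    also have "\<dots> = (\<Sum>q\<in>Q. \<Sum>r\<in>Q. of_bool (q \<noteq> r) * (ennreal (w q) * ennreal (w r)))"
      using w by (intro sum.cong) (auto simp: ennreal_mult)
    also have "\<dots> \<le> (\<Sum>q\<in>Q. \<Sum>\<^sup>+r. of_bool (q \<noteq> r) * (ennreal (w q) * ennreal (w r)))"
      by (intro sum_mono finite_sum_le_esum Q)
    also have "\<dots> \<le> (\<Sum>\<^sup>+q. \<Sum>\<^sup>+r. of_bool (q \<noteq> r) * (ennreal (w q) * ennreal (w r)))"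
      by (intro finite_sum_le_esum Q)
    finally show "ennreal (\<Sum>q\<in>Q. \<Sum>r\<in>Q. if q \<noteq> r then w q * w r else 0) \<le> \<dots>" .
  qed
  finally show "(\<Sum>q\<in>Q. ennreal (w q)) \<le> \<dots>" .
qed

section \<open>The reduced Palm distribution\<close>

lemma esum_eq_0D:
  fixes g :: "'i \<Rightarrow> ennreal"
  assumes "(\<Sum>\<^sup>+i. g i) = 0" shows "g i = 0"
  using finite_sum_le_esum[of "{i}" g] assms by simp

context neyman_scott_points
begin

text \<open>The expected number of coinciding ordered pairs is a second moment with the indicator of
  the diagonal; it is 0 because neither Lebesgue measure nor the displacement law has atoms.\<close>

lemma AE_distinct_points:
  "AE \<omega> in M. \<forall>p q. p \<noteq> q \<longrightarrow> active p \<omega> \<longrightarrow> active q \<omega> \<longrightarrow> Y p \<omega> \<noteq> Y q \<omega>"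
proof -
  interpret \<nu>: prob_space \<nu> by (rule prob_space_displacement_law[OF f])
  have [measurable]: "Measurable.pred (borel \<Otimes>\<^sub>M borel) (\<lambda>(x::plane, y). x = y)" by measurable
  have null: "(\<integral>\<^sup>+b. of_bool (a = b) \<partial>\<nu>) = 0" for a
  proof -
    have "(\<integral>\<^sup>+b. of_bool (a = b) \<partial>\<nu>) = (\<integral>\<^sup>+b. ennreal (f b) * indicator {a} b \<partial>lborel)"
      by (subst nn_integral_density) (auto intro!: nn_integral_cong simp: indicator_def)
    also have "\<dots> = 0"
      using AE_lborel_singleton[of a] by (subst nn_integral_0_iff_AE) (auto elim!: eventually_mono)
    finally show ?thesis .
  qed
  have null': "(\<integral>\<^sup>+y. of_bool (x = y) \<partial>lborel) = 0" for x :: plane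
    using AE_lborel_singleton[of x] by (subst nn_integral_0_iff_AE) (auto elim!: eventually_mono)
  have "(\<integral>\<^sup>+x. \<integral>\<^sup>+y. \<integral>\<^sup>+a. \<integral>\<^sup>+b. of_bool (x + a = y + b) \<partial>\<nu> \<partial>\<nu> \<partial>lborel \<partial>lborel) =
      (\<integral>\<^sup>+x. \<integral>\<^sup>+y. of_bool (x = y) \<partial>lborel \<partial>(lborel :: plane measure))"
    by (rule displacement_translate2) measurable
  then have "(\<integral>\<^sup>+\<omega>. (\<Sum>\<^sup>+p. \<Sum>\<^sup>+q. of_bool (p \<noteq> q \<and> active p \<omega> \<and> active q \<omega>) * of_bool (Y p \<omega> = Y q \<omega>)) \<partial>M) = 0"
    by (subst second_moment) (measurable, simp add: null null')
  then have T0: "(\<Sum>\<^sup>+p. \<Sum>\<^sup>+q. (\<integral>\<^sup>+\<omega>. of_bool (p \<noteq> q \<and> active p \<omega> \<and> active q \<omega>) * of_bool (Y p \<omega> = Y q \<omega>) \<partial>M)) = 0"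
    by (subst nn_integral_esum2[symmetric]) measurable
  have Z: "(\<integral>\<^sup>+\<omega>. of_bool (p \<noteq> q \<and> active p \<omega> \<and> active q \<omega>) * of_bool (Y p \<omega> = Y q \<omega>) \<partial>M) = 0" for p q
    using esum_eq_0D[OF esum_eq_0D[OF T0, where i = p], where i = q] .
  have *: "AE \<omega> in M. p \<noteq> q \<longrightarrow> active p \<omega> \<longrightarrow> active q \<omega> \<longrightarrow> Y p \<omega> \<noteq> Y q \<omega>" for p q
  proof -
    have "AE \<omega> in M. of_bool (p \<noteq> q \<and> active p \<omega> \<and> active q \<omega>) * of_bool (Y p \<omega> = Y q \<omega>) = (0 :: ennreal)"
      by (rule iffD1[OF nn_integral_0_iff_AE Z]) measurable
    then show ?thesis by eventually_elim (auto simp: of_bool_def split: if_splits)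
  qed
  show ?thesis unfolding AE_all_countable by (intro allI *)
qed

text \<open>The Bochner integral over a possibly incomplete \<open>M\<close> needs measurability at every \<open>\<omega>\<close>, also
  at those where points coincide; a coinciding point is counted at its first index only.\<close>

definition rep :: "nat \<times> nat \<Rightarrow> 'w \<Rightarrow> bool" where
  "rep p \<omega> \<longleftrightarrow> active p \<omega> \<and> (\<forall>q. to_nat q < to_nat p \<longrightarrow> active q \<omega> \<longrightarrow> Y q \<omega> \<noteq> Y p \<omega>)"

lemma rep_measurable[measurable]: "Measurable.pred M (rep p)"
  unfolding rep_def[abs_def] by measurable

lemma inj_rep: "inj_on (\<lambda>p. Y p \<omega>) {p. rep p \<omega>}"
proof (rule inj_onI)
  fix p q assume "p \<in> {p. rep p \<omega>}" "q \<in> {p. rep p \<omega>}" "Y p \<omega> = Y q \<omega>"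
  then have "\<not> to_nat p < to_nat q" "\<not> to_nat q < to_nat p"
    unfolding rep_def mem_Collect_eq by metis+
  then show "p = q" by (metis linorder_neqE_nat to_nat_split)
qed

lemma rep_image: "(\<lambda>p. Y p \<omega>) ` {p. rep p \<omega>} = {Y p \<omega> | p. active p \<omega>}"
proof (intro equalityI subsetI)
  fix x assume "x \<in> {Y p \<omega> | p. active p \<omega>}"
  then obtain p where p: "x = Y p \<omega>" "active p \<omega>" by auto
  \<comment> \<open>Among the active indices located at \<open>x\<close>, the one of least code is
    the representative.\<close>
  let ?P = "\<lambda>n. \<exists>q. n = to_nat q \<and> active q \<omega> \<and> Y q \<omega> = x"
  have "\<exists>n. ?P n" using p by blast
  then have "?P (LEAST n. ?P n)" by (rule LeastI_ex)
  then obtain q where q: "(LEAST n. ?P n) = to_nat q" "active q \<omega>" "Y q \<omega> = x" by blast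
  have "rep q \<omega>" unfolding rep_def
  proof (intro conjI allI impI notI)
    fix q' assume "to_nat q' < to_nat q" "active q' \<omega>" "Y q' \<omega> = Y q \<omega>"
    then show False using not_less_Least[of "to_nat q'" ?P] q by auto
  qed (fact q)
  then show "x \<in> (\<lambda>p. Y p \<omega>) ` {p. rep p \<omega>}" using q by auto
qed (auto simp: rep_def)

end

section \<open>Bounds on the generating functional from second and third moments\<close>

locale neyman_scott_palm = neyman_scott_points M l X c f N D
  for M :: "'w measure" and l X c f N D +
  fixes \<phi> :: "'w \<Rightarrow> plane set" and B :: "plane set" and v :: "plane \<Rightarrow> real"
  assumes \<phi>: "\<And>\<omega>. \<omega> \<in> space M \<Longrightarrow> \<phi> \<omega> = {X i \<omega> + D i j \<omega> | i j. j < N i \<omega>}"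
    and B[measurable]: "B \<in> sets borel" and B_pos: "0 < emeasure lborel B" and B_fin: "emeasure lborel B < \<infinity>"
    and v[measurable]: "v \<in> borel_measurable borel" and v_nonneg: "\<And>x. 0 \<le> v x" and v_le: "\<And>x. v x \<le> 1"
begin

definition u :: "plane \<Rightarrow> ennreal" where "u x = ennreal (1 - v x)"

lemma u_measurable[measurable]: "u \<in> borel_measurable borel"
  unfolding u_def[abs_def] by measurable

text \<open>The quantity averaged in the reduced Palm expectation: the product over the points other
  than \<open>p\<close>, seen from \<open>p\<close>. Restricting to \<open>rep\<close> makes each
  location count once.\<close>

definition \<pi> :: "nat \<times> nat \<Rightarrow> 'w \<Rightarrow> real" where
  "\<pi> p \<omega> = inf_prod (\<lambda>q. if rep q \<omega> \<and> q \<noteq> p then v (Y q \<omega> - Y p \<omega>) else 1)"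

lemma \<pi>_measurable[measurable]: "\<pi> p \<in> borel_measurable M"
  unfolding \<pi>_def[abs_def] by measurable

lemma \<pi>_bounds: "0 \<le> \<pi> p \<omega>" "\<pi> p \<omega> \<le> 1"
  unfolding \<pi>_def by (rule inf_prod_bounds; simp add: v_nonneg)+

definition weight :: "nat \<times> nat \<Rightarrow> 'w \<Rightarrow> real" where
  "weight p \<omega> = of_bool (rep p \<omega> \<and> Y p \<omega> \<in> B)"

lemma weight_measurable[measurable]: "weight p \<in> borel_measurable M"
  unfolding weight_def[abs_def] by measurable

lemma \<phi>_rep: "\<omega> \<in> space M \<Longrightarrow> \<phi> \<omega> = (\<lambda>p. Y p \<omega>) ` {p. rep p \<omega>}"
  unfolding rep_image \<phi> by (auto simp: Y_def active_def)

text \<open>After translation by \<open>- Y p \<omega>\<close> exactly one representative sits at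
  the origin, namely \<open>p\<close>, so deleting \<open>0\<close> from the configuration deletes
  this index alone.\<close>

lemma config_prod_reduced:
  assumes "\<omega> \<in> space M" "rep p \<omega>"
  shows "config_prod v ((\<lambda>y. y - Y p \<omega>) ` \<phi> \<omega> - {0}) = \<pi> p \<omega>"
proof -
  have inj: "inj_on (\<lambda>q. Y q \<omega> - Y p \<omega>) {q. rep q \<omega>}" using inj_rep by (auto simp: inj_on_def)
  have eq: "(\<lambda>y. y - Y p \<omega>) ` \<phi> \<omega> - {0} = (\<lambda>q. Y q \<omega> - Y p \<omega>) ` ({q. rep q \<omega>} - {p})"
  proof -
    have "(\<lambda>y. y - Y p \<omega>) ` \<phi> \<omega> - {0} = (\<lambda>q. Y q \<omega> - Y p \<omega>) ` {q. rep q \<omega>} - (\<lambda>q. Y q \<omega> - Y p \<omega>) ` {p}"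
    by (simp add: \<phi>_rep[OF assms(1)] image_image)
    also have "\<dots> = (\<lambda>q. Y q \<omega> - Y p \<omega>) ` ({q. rep q \<omega>} - {p})"
      using assms(2) by (intro inj_on_image_set_diff[OF inj, symmetric]) auto
    finally show ?thesis .
  qed
  have "config_prod v ((\<lambda>q. Y q \<omega> - Y p \<omega>) ` ({q. rep q \<omega>} - {p})) =
      inf_prod (\<lambda>q. if q \<in> {q. rep q \<omega>} - {p} then v (Y q \<omega> - Y p \<omega>) else 1)"
    by (rule config_prod_image) (auto simp: v_nonneg v_le intro: inj_on_subset[OF inj])
  then show ?thesis unfolding eq \<pi>_def by simp
qed

lemma palm_integrand:
  assumes "\<omega> \<in> space M"
  shows "(\<Sum>\<^sub>\<infinity>x\<in>\<phi> \<omega> \<inter> B. config_prod v ((\<lambda>y. y - x) ` \<phi> \<omega> - {0})) =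
    enn2real (\<Sum>\<^sup>+p. ennreal (weight p \<omega> * \<pi> p \<omega>))"
proof -
  let ?A = "{p. rep p \<omega> \<and> Y p \<omega> \<in> B}"
  let ?F = "\<lambda>x. config_prod v ((\<lambda>y. y - x) ` \<phi> \<omega> - {0})"
  have "\<phi> \<omega> \<inter> B = (\<lambda>p. Y p \<omega>) ` ?A" by (auto simp: \<phi>_rep[OF assms])
  moreover have "inj_on (\<lambda>p. Y p \<omega>) ?A" by (rule inj_on_subset[OF inj_rep]) auto
  ultimately have "infsum ?F (\<phi> \<omega> \<inter> B) = infsum (?F \<circ> (\<lambda>p. Y p \<omega>)) ?A"
    by (simp only: infsum_reindex)
  also have "\<dots> = infsum (\<lambda>p. weight p \<omega> * \<pi> p \<omega>) UNIV"
    by (rule infsum_cong_neutral) (use config_prod_reduced[OF assms] in \<open>auto simp: weight_def\<close>)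
  also have "\<dots> = enn2real (\<Sum>\<^sup>+p. ennreal (weight p \<omega> * \<pi> p \<omega>))"
    by (rule infsum_eq_enn2real_esum) (simp add: weight_def \<pi>_bounds)
  finally show ?thesis .
qed

text \<open>Almost surely no points coincide, which lets the moment formulas, stated for
  \<open>active\<close>, be applied to sums over \<open>rep\<close>.\<close>

lemma AE_rep: "AE \<omega> in M. \<forall>p. rep p \<omega> = active p \<omega>"
  using AE_distinct_points
proof eventually_elim
  case (elim \<omega>)
  have "Y q \<omega> \<noteq> Y p \<omega>" if "to_nat q < to_nat p" "active q \<omega>" "active p \<omega>" for p q
  proof -
    have "q \<noteq> p" using that(1) by auto
    then show ?thesis using elim that by blast
  qed
  then show ?case unfolding rep_def by blast
qed

text \<open>The mean number of points in the window, by which the Palm expectation is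
  normalised.\<close>

definition \<Lambda> :: ennreal where "\<Lambda> = ennreal l * ennreal c * emeasure lborel B"

lemma \<Lambda>_pos: "0 < \<Lambda>" and \<Lambda>_fin: "\<Lambda> < \<infinity>"
  using l_pos c_pos B_pos B_fin by (auto simp: \<Lambda>_def ennreal_zero_less_mult_iff ennreal_mult_less_top)

lemma \<Lambda>_eq: "\<Lambda> = ennreal (l * c * measure lborel B)"
  using l_pos c_pos B_fin by (simp add: \<Lambda>_def ennreal_mult emeasure_eq_ennreal_measure less_top)

text \<open>This is \<Lambda> times \<open>1 - G\<close>, written as an expectation of nonnegative
  terms so that no subtraction in \<open>ennreal\<close> occurs and pointwise bounds apply.\<close>

definition deficit :: ennreal where
  "deficit = (\<integral>\<^sup>+\<omega>. (\<Sum>\<^sup>+p. ennreal (weight p \<omega> * (1 - \<pi> p \<omega>))) \<partial>M)"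

text \<open>The weights \<open>\<pi> p \<omega>\<close> and \<open>1 - \<pi> p \<omega>\<close> add
  up to 1, so the two expectations add up to the mean number of points in \<open>B\<close>. That
  mean is finite, so the Palm integrand is almost surely a convergent sum and its real-valued
  integral loses nothing.\<close>

lemma palm_deficit:
  "ennreal (l * c * measure lborel B) * ennreal (cond_gen_functional M \<phi> (l * c) B v) + deficit = \<Lambda>"
  and cond_gen_functional_nonneg: "0 \<le> cond_gen_functional M \<phi> (l * c) B v"
proof -
  let ?E = "\<integral>\<^sup>+\<omega>. (\<Sum>\<^sup>+p. ennreal (weight p \<omega> * \<pi> p \<omega>)) \<partial>M"
  have "?E + deficit = (\<integral>\<^sup>+\<omega>. (\<Sum>\<^sup>+p. ennreal (weight p \<omega> * \<pi> p \<omega>) + ennreal (weight p \<omega> * (1 - \<pi> p \<omega>))) \<partial>M)"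
    unfolding deficit_def by (simp add: nn_integral_add)
  also have "\<dots> = (\<integral>\<^sup>+\<omega>. (\<Sum>\<^sup>+p. ennreal (weight p \<omega>)) \<partial>M)"
    using \<pi>_bounds by (intro nn_integral_cong) (simp add: ennreal_plus[symmetric] weight_def algebra_simps del: ennreal_plus)
  also have "\<dots> = (\<integral>\<^sup>+\<omega>. (\<Sum>\<^sup>+p. of_bool (active p \<omega>) * indicator B (Y p \<omega>)) \<partial>M)"
    using AE_rep
  proof (intro nn_integral_cong_AE, eventually_elim)
    case (elim \<omega>)
    then show ?case by (intro nn_integral_cong) (auto simp: weight_def indicator_def)
  qed
  also have "\<dots> = \<Lambda>" using first_moment[of "indicator B"] by (simp add: \<Lambda>_def)
  finally have sum: "?E + deficit = \<Lambda>" .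
  have "?E \<le> ?E + deficit" by simp
  then have E_fin: "?E < \<infinity>" unfolding sum using \<Lambda>_fin by (rule le_less_trans)
  have AE_fin: "AE \<omega> in M. (\<Sum>\<^sup>+p. ennreal (weight p \<omega> * \<pi> p \<omega>)) \<noteq> \<infinity>"
    by (rule nn_integral_PInf_AE) (use E_fin in \<open>auto simp: less_top\<close>)
  let ?I = "\<lambda>\<omega>. enn2real (\<Sum>\<^sup>+p. ennreal (weight p \<omega> * \<pi> p \<omega>))"
  have "(\<integral>\<omega>. (\<Sum>\<^sub>\<infinity>x\<in>\<phi> \<omega> \<inter> B. config_prod v ((\<lambda>y. y - x) ` \<phi> \<omega> - {0})) \<partial>M) = (\<integral>\<omega>. ?I \<omega> \<partial>M)"
    by (rule Bochner_Integration.integral_cong) (simp_all add: palm_integrand)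
  also have "\<dots> = enn2real (\<integral>\<^sup>+\<omega>. ennreal (?I \<omega>) \<partial>M)"
    by (rule integral_eq_nn_integral) auto
  also have "(\<integral>\<^sup>+\<omega>. ennreal (?I \<omega>) \<partial>M) = ?E"
    using AE_fin by (intro nn_integral_cong_AE) (auto simp: less_top elim!: eventually_mono)
  finally have G: "cond_gen_functional M \<phi> (l * c) B v = 1 / (l * c * measure lborel B) * enn2real ?E"
    by (simp add: cond_gen_functional_def reduced_palm_expectation_def)
  have pos: "0 < l * c * measure lborel B" using \<Lambda>_pos \<Lambda>_eq by simp
  show "0 \<le> cond_gen_functional M \<phi> (l * c) B v"
    unfolding G using pos by (intro mult_nonneg_nonneg) auto
  have "ennreal (l * c * measure lborel B) * ennreal (cond_gen_functional M \<phi> (l * c) B v) = ennreal (enn2real ?E)"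
    unfolding G using pos by (subst ennreal_mult[symmetric]) (auto intro!: mult_nonneg_nonneg)
  also have "\<dots> = ?E" using E_fin by simp
  finally show "ennreal (l * c * measure lborel B) * ennreal (cond_gen_functional M \<phi> (l * c) B v) + deficit = \<Lambda>"
    using sum by simp
qed

text \<open>Up to the factor \<Lambda>, \<open>S2\<close> is the reduced Palm expectation of the sum
  of \<open>u\<close> over the points, and \<open>S3\<close> that of the sum of products over
  ordered pairs.\<close>

definition S2 :: ennreal where
  "S2 = (\<integral>\<^sup>+\<omega>. (\<Sum>\<^sup>+p. \<Sum>\<^sup>+q. of_bool (p \<noteq> q \<and> active p \<omega> \<and> active q \<omega>) *
      (indicator B (Y p \<omega>) * u (Y q \<omega> - Y p \<omega>))) \<partial>M)"

definition S3 :: ennreal where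
  "S3 = (\<integral>\<^sup>+\<omega>. (\<Sum>\<^sup>+p. \<Sum>\<^sup>+q. \<Sum>\<^sup>+r. of_bool (p \<noteq> q \<and> p \<noteq> r \<and> q \<noteq> r \<and> active p \<omega> \<and> active q \<omega> \<and> active r \<omega>) *
      (indicator B (Y p \<omega>) * u (Y q \<omega> - Y p \<omega>) * u (Y r \<omega> - Y p \<omega>))) \<partial>M)"

text \<open>The Bonferroni inequalities are applied for each window point \<open>p\<close> and each
  \<omega> to the factors \<open>1 - w p \<omega> q\<close>, then summed over \<open>p\<close> and
  integrated.\<close>

lemma deficit_bounds: "deficit \<le> S2" "S2 \<le> deficit + S3"
proof -
  define w where "w p \<omega> q = (if rep q \<omega> \<and> q \<noteq> p then 1 - v (Y q \<omega> - Y p \<omega>) else 0)" for p \<omega> q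
  have w: "0 \<le> w p \<omega> q" "w p \<omega> q \<le> 1" for p \<omega> q by (auto simp: w_def v_nonneg v_le)
  have \<pi>: "\<pi> p \<omega> = inf_prod (\<lambda>q. 1 - w p \<omega> q)" for p \<omega>
    unfolding \<pi>_def w_def by (rule arg_cong[where f = inf_prod]) auto
  have def: "ennreal (weight p \<omega> * (1 - \<pi> p \<omega>)) = ennreal (weight p \<omega>) * ennreal (1 - inf_prod (\<lambda>q. 1 - w p \<omega> q))" for p \<omega>
    unfolding \<pi>[symmetric] by (rule ennreal_mult) (auto simp: weight_def \<pi>_bounds)
  have s2: "S2 = (\<integral>\<^sup>+\<omega>. (\<Sum>\<^sup>+p. ennreal (weight p \<omega>) * (\<Sum>\<^sup>+q. ennreal (w p \<omega> q))) \<partial>M)"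
    unfolding S2_def using AE_rep
  proof (intro nn_integral_cong_AE, eventually_elim)
    case (elim \<omega>)
    show ?case
      by (subst nn_integral_cmult[symmetric]) (use elim in \<open>auto intro!: nn_integral_cong simp: weight_def w_def u_def indicator_def\<close>)
  qed
  have s3: "S3 = (\<integral>\<^sup>+\<omega>. (\<Sum>\<^sup>+p. ennreal (weight p \<omega>) *
      (\<Sum>\<^sup>+q. \<Sum>\<^sup>+r. of_bool (q \<noteq> r) * (ennreal (w p \<omega> q) * ennreal (w p \<omega> r)))) \<partial>M)"
    unfolding S3_def using AE_rep
  proof (intro nn_integral_cong_AE, eventually_elim)
    case (elim \<omega>)
    have "ennreal (weight p \<omega>) * (\<Sum>\<^sup>+q. \<Sum>\<^sup>+r. of_bool (q \<noteq> r) * (ennreal (w p \<omega> q) * ennreal (w p \<omega> r))) =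
       (\<Sum>\<^sup>+q. \<Sum>\<^sup>+r. ennreal (weight p \<omega>) * (of_bool (q \<noteq> r) * (ennreal (w p \<omega> q) * ennreal (w p \<omega> r))))" for p
      by (simp add: nn_integral_cmult)
    then show ?case
      by (simp only:) (use elim in \<open>auto intro!: nn_integral_cong simp: weight_def w_def u_def indicator_def\<close>)
  qed
  have [measurable]: "(\<lambda>\<omega>. w p \<omega> q) \<in> borel_measurable M" for p q unfolding w_def by measurable
  show "deficit \<le> S2"
    unfolding deficit_def s2 def by (intro nn_integral_mono mult_left_mono inf_prod_upper w) simp
  have "S2 \<le> (\<integral>\<^sup>+\<omega>. (\<Sum>\<^sup>+p. ennreal (weight p \<omega>) * (ennreal (1 - inf_prod (\<lambda>q. 1 - w p \<omega> q)) +
      (\<Sum>\<^sup>+q. \<Sum>\<^sup>+r. of_bool (q \<noteq> r) * (ennreal (w p \<omega> q) * ennreal (w p \<omega> r))))) \<partial>M)"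
    unfolding s2 by (intro nn_integral_mono mult_left_mono inf_prod_lower w) simp
  also have "\<dots> = deficit + S3"
    unfolding deficit_def s3 def by (simp add: distrib_left nn_integral_add)
  finally show "S2 \<le> deficit + S3" .
qed

lemma palm_bounds:
  fixes \<Phi> \<delta> :: real
  defines "U \<equiv> \<integral>\<^sup>+x. u x \<partial>lborel" and "\<kappa> \<equiv> \<integral>\<^sup>+a. \<integral>\<^sup>+b. u (b - a) \<partial>\<nu> \<partial>\<nu>"
  assumes \<Phi>: "ennreal l * ennreal c * U + ennreal c * \<kappa> = ennreal \<Phi>" "0 \<le> \<Phi>"
    and \<delta>: "\<And>s. (\<integral>\<^sup>+b. u (s + b) \<partial>\<nu>) \<le> ennreal \<delta>" "0 \<le> \<delta>"
  shows "1 - cond_gen_functional M \<phi> (l * c) B v \<le> \<Phi>"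
    and "\<Phi> * (1 - \<Phi> - c * \<delta>) \<le> 1 - cond_gen_functional M \<phi> (l * c) B v"
proof -
  let ?G = "cond_gen_functional M \<phi> (l * c) B v" and ?L = "l * c * measure lborel B"
  have pos: "0 < ?L" using \<Lambda>_pos \<Lambda>_eq by simp
  have S2: "S2 = ennreal (?L * \<Phi>)"
    using second_moment_window[OF B u_measurable] \<Phi> pos \<Lambda>_eq
    by (simp add: S2_def U_def \<kappa>_def \<Lambda>_def ennreal_mult)
  have "S3 \<le> ennreal c ^ 3 * emeasure lborel B *
      (ennreal l ^ 3 * U ^ 2 + 2 * ennreal l ^ 2 * (U * \<kappa>) + ennreal l ^ 2 * (ennreal \<delta> * U) + ennreal l * (ennreal \<delta> * \<kappa>))"
    unfolding S3_def U_def \<kappa>_def by (rule third_moment_window) (auto simp: \<delta>)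
  also have "\<dots> = \<Lambda> * ((ennreal l * ennreal c * U) ^ 2 + 2 * (ennreal l * ennreal c * U) * (ennreal c * \<kappa>) +
      ennreal c * ennreal \<delta> * (ennreal l * ennreal c * U + ennreal c * \<kappa>))"
    by (simp add: \<Lambda>_def power2_eq_square power3_eq_cube distrib_left mult_ac add_ac)
  \<comment> \<open>The square of the foreign-cluster part of \<Phi> and twice its product with the
    own-cluster part are completed to the square of \<Phi>; the remaining terms are exactly
    \<open>c * \<delta> * \<Phi>\<close>.\<close>
  also have "\<dots> \<le> \<Lambda> * ((ennreal l * ennreal c * U + ennreal c * \<kappa>) ^ 2 +
      ennreal c * ennreal \<delta> * (ennreal l * ennreal c * U + ennreal c * \<kappa>))"
    by (intro mult_left_mono add_mono order_refl) (simp_all add: power2_sum add_increasing2 mult_ac)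
  also have "\<dots> = ennreal (?L * (\<Phi> ^ 2 + c * \<delta> * \<Phi>))"
    using \<Phi>(2) \<delta>(2) c_pos pos unfolding \<Phi>(1) \<Lambda>_eq
    by (simp add: ennreal_mult mult_nonneg_nonneg power2_eq_square)
  finally have S3: "S3 \<le> ennreal (?L * (\<Phi> ^ 2 + c * \<delta> * \<Phi>))" .
  have "deficit \<noteq> \<infinity>" using deficit_bounds(1) S2 by (auto simp: top_unique)
  then obtain d where d: "deficit = ennreal d" "0 \<le> d" by (cases deficit rule: ennreal_cases) auto
  have "ennreal (?L * ?G + d) = ennreal ?L"
    using palm_deficit d pos cond_gen_functional_nonneg \<Lambda>_eq by (simp add: ennreal_mult)
  then have dG: "d = ?L * (1 - ?G)"
  proof -
    have "0 \<le> ?L * ?G + d"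
      using pos d(2) cond_gen_functional_nonneg by (intro add_nonneg_nonneg mult_nonneg_nonneg[of ?L]) auto
    then have "?L * ?G + d = ?L"
      using ennreal_inj[of "?L * ?G + d" ?L] \<open>ennreal (?L * ?G + d) = ennreal ?L\<close> pos by simp
    then show ?thesis by (simp add: right_diff_distrib)
  qed
  have "d \<le> ?L * \<Phi>"
    using deficit_bounds(1) d S2 pos \<Phi>(2) by (simp add: ennreal_le_iff)
  then have "?L * (1 - ?G) \<le> ?L * \<Phi>" by (simp only: dG)
  then show "1 - ?G \<le> \<Phi>" using pos by (rule mult_left_le_imp_le)
  have "0 \<le> c * \<delta> * \<Phi>" using c_pos \<delta>(2) \<Phi>(2) by simp
  then have q: "0 \<le> ?L * (\<Phi> ^ 2 + c * \<delta> * \<Phi>)"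
    using pos by (intro mult_nonneg_nonneg[of ?L] add_nonneg_nonneg) auto
  have "ennreal (?L * \<Phi>) \<le> ennreal d + ennreal (?L * (\<Phi> ^ 2 + c * \<delta> * \<Phi>))"
    using deficit_bounds(2) S2 S3 d(1) by (metis add_left_mono order_trans)
  then have "?L * \<Phi> \<le> d + ?L * (\<Phi> ^ 2 + c * \<delta> * \<Phi>)"
    unfolding ennreal_plus[OF d(2) q, symmetric] using add_nonneg_nonneg[OF d(2) q] by (simp only: ennreal_le_iff)
  then have "?L * \<Phi> \<le> ?L * (1 - ?G + (\<Phi> ^ 2 + c * \<delta> * \<Phi>))"
    by (simp only: dG distrib_left)
  then have "\<Phi> \<le> 1 - ?G + (\<Phi> ^ 2 + c * \<delta> * \<Phi>)" using pos by (rule mult_left_le_imp_le)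
  then show "\<Phi> * (1 - \<Phi> - c * \<delta>) \<le> 1 - ?G"
    by (simp add: algebra_simps power2_eq_square)
qed

end

section \<open>Tail integrals of the fading variable\<close>

text \<open>Used with \<open>r\<close> a distance and \<open>b = \<nu> / y\<close>: the fading
  exceeds its threshold exactly inside an open ball. At \<open>b = 0\<close> both sides are
  false.\<close>

lemma less_powr_inverse_iff:
  fixes r b \<alpha> :: real
  assumes "0 \<le> r" "0 \<le> b" "0 < \<alpha>"
  shows "r < b powr (1 / \<alpha>) \<longleftrightarrow> r powr \<alpha> < b"
proof (cases "b = 0")
  case False
  then have b: "(b powr (1 / \<alpha>)) powr \<alpha> = b" using assms by (simp add: powr_powr)
  show ?thesis
  proof
    assume "r < b powr (1 / \<alpha>)"
    then have "r powr \<alpha> < (b powr (1 / \<alpha>)) powr \<alpha>" using assms by (intro powr_less_mono2) auto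
    then show "r powr \<alpha> < b" by (simp only: b)
  next
    assume l: "r powr \<alpha> < b"
    show "r < b powr (1 / \<alpha>)"
    proof (rule ccontr)
      assume "\<not> ?thesis"
      then have "(b powr (1 / \<alpha>)) powr \<alpha> \<le> r powr \<alpha>" using assms by (intro powr_mono2) auto
      then show False using l unfolding b by simp
    qed
  qed
qed (use assms in simp)

locale fading = real_distribution H for H :: "real measure" +
  fixes \<alpha> :: real and z :: plane
  assumes \<alpha>: "2 < \<alpha>" and nonneg: "AE \<nu> in H. 0 \<le> \<nu>"
    and moment: "integrable H (\<lambda>\<nu>. \<nu> powr (2 / \<alpha>))"
begin

definition tail :: "real \<Rightarrow> real" where
  "tail t = 1 - cdf H t"

lemma tail_eq: "tail t = measure H {t<..}"
proof -
  have "measure H {t<..} = measure H (space H - {..t})" by (rule arg_cong[where f = "measure H"]) auto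
  also have "\<dots> = 1 - measure H {..t}" by (rule prob_compl) simp
  finally show ?thesis by (simp add: tail_def cdf_def)
qed

lemma tail_nonneg: "0 \<le> tail t" and tail_le: "tail t \<le> 1"
  by (simp_all add: tail_eq prob_le_1)

lemma tail_measurable[measurable]: "tail \<in> borel_measurable borel"
proof -
  have "mono (cdf H)" by (intro monoI cdf_nondecreasing)
  then have [measurable]: "cdf H \<in> borel_measurable borel" by (rule borel_measurable_mono)
  show ?thesis unfolding tail_def[abs_def] by measurable
qed

lemma ennreal_tail: "ennreal (tail t) = (\<integral>\<^sup>+\<nu>. of_bool (t < \<nu>) \<partial>H)"
proof -
  have "(\<integral>\<^sup>+\<nu>. of_bool (t < \<nu>) \<partial>H) = (\<integral>\<^sup>+\<nu>. indicator {t<..} \<nu> \<partial>H)"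
    by (intro nn_integral_cong) (auto simp: indicator_def)
  then show ?thesis by (simp add: tail_eq emeasure_eq_measure)
qed

definition C\<^sub>\<alpha> :: real where "C\<^sub>\<alpha> = (\<integral>\<nu>. \<nu> powr (2 / \<alpha>) \<partial>H)"

lemma C_nonneg: "0 \<le> C\<^sub>\<alpha>"
  unfolding C\<^sub>\<alpha>_def by simp

end

section \<open>Tail integrals against a weight\<close>

lemma emeasure_ball_plane: "0 \<le> r \<Longrightarrow> emeasure lborel (ball (z :: plane) r) = ennreal (pi * r ^ 2)"
  by (subst emeasure_ball) (simp_all add: unit_ball_vol_2)

text \<open>The weight \<open>q\<close> stands for the intensity seen from the typical point. The
  bound \<open>K * r^2\<close> for all balls around \<open>z\<close> supplies the dominating
  functions of the limits below.\<close>

locale fading_weight = fading H \<alpha> z for H \<alpha> z +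
  fixes q :: "plane \<Rightarrow> real" and K :: real
  assumes q[measurable]: "q \<in> borel_measurable borel" and q_nonneg: "\<And>x. 0 \<le> q x"
    and q_cont: "isCont q z" and K_nonneg: "0 \<le> K"
    and q_ball: "\<And>r. 0 < r \<Longrightarrow> (\<integral>\<^sup>+x. ennreal (q x) * indicator (ball z r) x \<partial>lborel) \<le> ennreal (K * r ^ 2)"
begin

definition V :: "real \<Rightarrow> ennreal" where
  "V r = (\<integral>\<^sup>+x. ennreal (q x) * indicator (ball z r) x \<partial>lborel)"

definition W :: "real \<Rightarrow> real" where
  "W r = enn2real (V r) / r ^ 2"

lemma V_measurable[measurable]: "V \<in> borel_measurable borel"
  unfolding V_def[abs_def] indicator_def mem_ball by measurable

lemma W_measurable[measurable]: "W \<in> borel_measurable borel"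
  unfolding W_def[abs_def] by measurable

lemma V_fin: "V r < \<infinity>"
proof (cases "0 < r")
  case True then show ?thesis using q_ball[of r] by (simp add: V_def order_le_less_trans)
next
  case False
  then have "ball z r = {}" by simp
  then show ?thesis by (simp add: V_def del: ball_eq_empty)
qed

lemma V_W: "0 \<le> r \<Longrightarrow> V r = ennreal (r ^ 2 * W r)"
  using V_fin[of r] by (cases "r = 0") (auto simp: W_def V_def ennreal_enn2real_if less_top)

lemma W_nonneg: "0 \<le> W r" by (simp add: W_def)

lemma W_le: "0 < r \<Longrightarrow> W r \<le> K"
proof -
  assume r: "0 < r"
  have "enn2real (V r) \<le> K * r ^ 2"
    using q_ball[OF r] K_nonneg by (intro enn2real_leI) (auto simp: V_def)
  then show "W r \<le> K" using r by (simp add: W_def divide_le_eq)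
qed

text \<open>Averages over shrinking balls converge to the value at a point of continuity; dividing
  by \<open>r^2\<close> instead of the area leaves the factor \<open>pi\<close>.\<close>

lemma W_tendsto: "(W \<longlongrightarrow> pi * q z) (at_right 0)"
proof (rule tendstoI)
  fix e :: real assume e: "0 < e"
  \<comment> \<open>A quarter suffices because \<open>pi < 4\<close> and the final error is at most
    \<open>pi * \<epsilon>\<close>.\<close>
  define \<epsilon> where "\<epsilon> = e / 4"
  have \<epsilon>: "0 < \<epsilon>" "pi * \<epsilon> < e" using e pi_less_4 by (auto simp: \<epsilon>_def field_simps)
  obtain d where d: "0 < d" "\<And>x. dist x z < d \<Longrightarrow> dist (q x) (q z) < \<epsilon>"
    using q_cont \<epsilon>(1) unfolding continuous_at_eps_delta by metis
  have "dist (W r) (pi * q z) < e" if r: "0 < r" "r < d" for r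
  proof -
    have near: "q z - \<epsilon> \<le> q x" "q x \<le> q z + \<epsilon>" if "x \<in> ball z r" for x
      using d(2)[of x] that r by (auto simp: dist_real_def dist_commute abs_less_iff)
    have c: "(\<integral>\<^sup>+x. ennreal b * indicator (ball z r) x \<partial>lborel) = ennreal (b * (pi * r ^ 2))" if "0 \<le> b" for b
      using that r by (subst nn_integral_cmult) (auto simp: emeasure_ball_plane ennreal_mult intro!: borel_measurable_indicator)
    have "V r \<le> (\<integral>\<^sup>+x. ennreal (q z + \<epsilon>) * indicator (ball z r) x \<partial>lborel)"
      unfolding V_def using near by (intro nn_integral_mono) (auto simp: indicator_def intro: ennreal_leI)
    also have "\<dots> = ennreal ((q z + \<epsilon>) * (pi * r ^ 2))" using q_nonneg[of z] \<epsilon>(1) by (intro c) simp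
    finally have "enn2real (V r) \<le> (q z + \<epsilon>) * (pi * r ^ 2)"
      using q_nonneg[of z] \<epsilon>(1) by (intro enn2real_leI) auto
    then have up: "W r \<le> (q z + \<epsilon>) * pi" using r by (simp add: W_def divide_le_eq mult_ac)
    \<comment> \<open>\<open>ennreal\<close> sends negative numbers to 0, so the comparison of
      integrals is made only for nonnegative \<open>q z - \<epsilon>\<close>; otherwise the bound is
      trivial.\<close>
    have lo: "(q z - \<epsilon>) * pi \<le> W r"
    proof (cases "0 \<le> q z - \<epsilon>")
      case True
      have "ennreal ((q z - \<epsilon>) * (pi * r ^ 2)) = (\<integral>\<^sup>+x. ennreal (q z - \<epsilon>) * indicator (ball z r) x \<partial>lborel)"
        by (rule c[OF True, symmetric])
      also have "\<dots> \<le> V r"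
        unfolding V_def using near by (intro nn_integral_mono) (auto simp: indicator_def intro: ennreal_leI)
      finally have "ennreal ((q z - \<epsilon>) * (pi * r ^ 2)) \<le> ennreal (r ^ 2 * W r)" using V_W[of r] r by simp
      then have "r ^ 2 * ((q z - \<epsilon>) * pi) \<le> r ^ 2 * W r"
        using W_nonneg[of r] by (subst (asm) ennreal_le_iff) (auto simp: mult_ac)
      then show ?thesis using r by simp
    next
      case False
      then have "(q z - \<epsilon>) * pi \<le> 0" by (intro mult_nonpos_nonneg) auto
      then show ?thesis using W_nonneg[of r] by linarith
    qed
    have "\<bar>W r - pi * q z\<bar> \<le> pi * \<epsilon>" using up lo by (auto simp: abs_le_iff algebra_simps)
    then show ?thesis using \<epsilon>(2) by (simp add: dist_real_def)
  qed
  then show "\<forall>\<^sub>F r in at_right 0. dist (W r) (pi * q z) < e"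
    unfolding eventually_at_right_field using d(1) by blast
qed

definition S :: "real \<Rightarrow> ennreal" where
  "S y = (\<integral>\<^sup>+x. ennreal (tail (y * norm (x - z) powr \<alpha>)) * ennreal (q x) \<partial>lborel)"

definition h :: "real \<Rightarrow> real" where
  "h y = (\<integral>\<nu>. \<nu> powr (2 / \<alpha>) * W ((\<nu> / y) powr (1 / \<alpha>)) \<partial>H)"

lemma S_measurable[measurable]: "S \<in> borel_measurable borel"
  unfolding S_def[abs_def] by measurable

lemma h_measurable[measurable]: "h \<in> borel_measurable borel"
  unfolding h_def[abs_def] by measurable

text \<open>At \<nu> = 0 the radius is 0 and \<open>W_le\<close> says nothing, but the factor in
  front vanishes.\<close>

lemma h_integrand_bound: "\<bar>\<nu> powr (2 / \<alpha>) * W ((\<nu> / y) powr (1 / \<alpha>))\<bar> \<le> K * \<nu> powr (2 / \<alpha>)" if "0 < y"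
proof (cases "\<nu> = 0")
  case False
  then have "0 < (\<nu> / y) powr (1 / \<alpha>)" using that by simp
  then have "W ((\<nu> / y) powr (1 / \<alpha>)) \<le> K" by (rule W_le)
  then have "\<nu> powr (2 / \<alpha>) * W ((\<nu> / y) powr (1 / \<alpha>)) \<le> \<nu> powr (2 / \<alpha>) * K" by (intro mult_left_mono) auto
  then show ?thesis by (simp add: abs_mult W_nonneg mult.commute)
qed (use \<alpha> in simp)

lemma h_integrable: "0 < y \<Longrightarrow> integrable H (\<lambda>\<nu>. \<nu> powr (2 / \<alpha>) * W ((\<nu> / y) powr (1 / \<alpha>)))"
  by (rule Bochner_Integration.integrable_bound[where f = "\<lambda>\<nu>. K * \<nu> powr (2 / \<alpha>)"])
    (use moment h_integrand_bound K_nonneg in \<open>auto simp: abs_mult intro!: AE_I2\<close>)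

lemma h_nonneg: "0 \<le> h y"
  unfolding h_def by (rule integral_nonneg_AE) (simp add: W_nonneg)

lemma h_le: "0 < y \<Longrightarrow> h y \<le> K * C\<^sub>\<alpha>"
proof -
  assume y: "0 < y"
  have "h y \<le> (\<integral>\<nu>. K * \<nu> powr (2 / \<alpha>) \<partial>H)"
    unfolding h_def using h_integrable[OF y] moment h_integrand_bound[OF y]
    by (intro integral_mono) (auto simp: abs_le_iff)
  then show ?thesis by (simp add: C\<^sub>\<alpha>_def)
qed

text \<open>For each \<nu> > 0 the radius tends to 0 from the right, so \<open>W\<close> tends to
  \<open>pi * q z\<close>; the moment of order \<open>2 / \<alpha>\<close> dominates.\<close>

lemma h_tendsto: "(h \<longlongrightarrow> pi * q z * C\<^sub>\<alpha>) at_top"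
proof -
  have "((\<lambda>y. \<integral>\<nu>. \<nu> powr (2 / \<alpha>) * W ((\<nu> / y) powr (1 / \<alpha>)) \<partial>H) \<longlongrightarrow> (\<integral>\<nu>. \<nu> powr (2 / \<alpha>) * (pi * q z) \<partial>H)) at_top"
  proof (rule integral_dominated_convergence_at_top[where w = "\<lambda>\<nu>. K * \<nu> powr (2 / \<alpha>)"])
    show "\<forall>\<^sub>F y in at_top. AE \<nu> in H. norm (\<nu> powr (2 / \<alpha>) * W ((\<nu> / y) powr (1 / \<alpha>))) \<le> K * \<nu> powr (2 / \<alpha>)"
      using eventually_gt_at_top[of 0] by eventually_elim (use h_integrand_bound in \<open>auto intro!: AE_I2\<close>)
    show "AE \<nu> in H. ((\<lambda>y. \<nu> powr (2 / \<alpha>) * W ((\<nu> / y) powr (1 / \<alpha>))) \<longlongrightarrow> \<nu> powr (2 / \<alpha>) * (pi * q z)) at_top"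
      using nonneg
    proof eventually_elim
      case (elim \<nu>)
      show ?case
      proof (cases "\<nu> = 0")
        case False
        with elim have \<nu>: "0 < \<nu>" by simp
        have "((\<lambda>y. (\<nu> / y) powr (1 / \<alpha>)) \<longlongrightarrow> 0 powr (1 / \<alpha>)) at_top"
        proof (rule tendsto_powr2)
          show "((\<lambda>y. \<nu> / y) \<longlongrightarrow> 0) at_top" by (intro tendsto_divide_0[OF tendsto_const] filterlim_at_top_imp_at_infinity filterlim_ident)
          show "\<forall>\<^sub>F y in at_top. 0 \<le> \<nu> / y" using eventually_gt_at_top[of 0] by eventually_elim (use \<nu> in simp)
        qed (use \<alpha> in \<open>auto intro: tendsto_const\<close>)
        moreover have "\<forall>\<^sub>F y in at_top. (\<nu> / y) powr (1 / \<alpha>) \<in> {0<..}"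
          using eventually_gt_at_top[of 0] by eventually_elim (use \<nu> in simp)
        ultimately have "filterlim (\<lambda>y. (\<nu> / y) powr (1 / \<alpha>)) (at_right 0) at_top"
          using \<alpha> by (auto simp: filterlim_at intro!: eventually_conj elim: eventually_mono)
        from filterlim_compose[OF W_tendsto this] show ?thesis by (intro tendsto_mult tendsto_const)
      qed simp
    qed
  qed (use moment in auto)
  then show ?thesis by (simp add: h_def[abs_def] C\<^sub>\<alpha>_def mult_ac)
qed

text \<open>By Tonelli the position is integrated first: for fixed \<nu> the condition
  \<open>y * norm (x - z) powr \<alpha> < \<nu>\<close> describes the ball of radius
  \<open>(\<nu> / y) powr (1 / \<alpha>)\<close>, whose squared radius splits off the power of
  \<open>y\<close>.\<close>

lemma S_eq:
  assumes y: "0 < y"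
  shows "S y = ennreal (y powr (- (2 / \<alpha>)) * h y)"
proof -
  interpret P: pair_sigma_finite lborel H ..
  have "S y = (\<integral>\<^sup>+x. \<integral>\<^sup>+\<nu>. of_bool (y * norm (x - z) powr \<alpha> < \<nu>) * ennreal (q x) \<partial>H \<partial>lborel)"
    unfolding S_def by (simp add: ennreal_tail nn_integral_multc)
  also have "\<dots> = (\<integral>\<^sup>+\<nu>. \<integral>\<^sup>+x. of_bool (y * norm (x - z) powr \<alpha> < \<nu>) * ennreal (q x) \<partial>lborel \<partial>H)"
    by (rule P.Fubini'[symmetric]) measurable
  also have "\<dots> = (\<integral>\<^sup>+\<nu>. ennreal (y powr (- (2 / \<alpha>)) * (\<nu> powr (2 / \<alpha>) * W ((\<nu> / y) powr (1 / \<alpha>)))) \<partial>H)"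
    using nonneg
  proof (intro nn_integral_cong_AE, eventually_elim)
    case (elim \<nu>)
    let ?r = "(\<nu> / y) powr (1 / \<alpha>)"
    have "(\<integral>\<^sup>+x. of_bool (y * norm (x - z) powr \<alpha> < \<nu>) * ennreal (q x) \<partial>lborel) = V ?r"
      unfolding V_def
    proof (rule nn_integral_cong)
      fix x
      have "x \<in> ball z ?r \<longleftrightarrow> y * norm (x - z) powr \<alpha> < \<nu>"
        using less_powr_inverse_iff[of "norm (x - z)" "\<nu> / y" \<alpha>] y elim \<alpha>
        by (simp add: dist_norm norm_minus_commute less_divide_eq mult.commute)
      then show "of_bool (y * norm (x - z) powr \<alpha> < \<nu>) * ennreal (q x) = ennreal (q x) * indicator (ball z ?r) x"
        by (auto simp: indicator_def)
    qed
    also have "\<dots> = ennreal (?r ^ 2 * W ?r)" by (rule V_W) simp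
    also have "?r ^ 2 = y powr (- (2 / \<alpha>)) * \<nu> powr (2 / \<alpha>)"
      using y elim by (simp add: power2_eq_square powr_add[symmetric] powr_divide powr_minus divide_simps)
    finally show ?case by (simp add: mult.assoc)
  qed
  also have "\<dots> = ennreal (y powr (- (2 / \<alpha>))) * ennreal (h y)"
    unfolding h_def using h_integrable[OF y]
    by (subst nn_integral_eq_integral[symmetric])
      (auto simp: W_nonneg ennreal_mult nn_integral_cmult[symmetric])
  finally show ?thesis by (simp add: ennreal_mult h_nonneg)
qed

end

section \<open>The truncated mean as an average of tails over scales\<close>

lemma nn_integral_powr_0_1:
  fixes a :: real
  assumes "- 1 < a"
  shows "(\<integral>\<^sup>+\<tau>. ennreal (indicator {0<..1} \<tau> * \<tau> powr a) \<partial>lborel) = ennreal (1 / (a + 1))"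
proof -
  have "((\<lambda>x. x powr a) has_integral (1 powr (a + 1) / (a + 1))) {0..1}"
    using assms by (intro has_integral_powr_from_0) auto
  then have "(\<integral>\<^sup>+x. ennreal (x powr a) * indicator {0..1} x \<partial>lborel) = ennreal (1 / (a + 1))"
    by (subst nn_integral_has_integral_lebesgue') auto
  moreover have "ennreal (indicator {0<..1} \<tau> * \<tau> powr a) = ennreal (\<tau> powr a) * indicator {0..1} \<tau>" for \<tau> :: real
    by (cases "\<tau> = 0") (auto simp: indicator_def)
  ultimately show ?thesis by simp
qed

context fading
begin

text \<open>The inner integral of the Markov term in rescaled form: path loss times truncated
  integral is \<open>y\<close> times this mean at \<open>t = y / path_loss\<close>.\<close>

definition trunc_mean :: "real \<Rightarrow> real" where
  "trunc_mean t = 1 / t * (LINT \<nu>:{0..t}|H. \<nu>)"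

lemma trunc_mean_measurable[measurable]: "trunc_mean \<in> borel_measurable borel"
  unfolding trunc_mean_def[abs_def] set_lebesgue_integral_def indicator_def atLeastAtMost_iff by measurable

lemma trunc_mean_nonneg: "0 \<le> t \<Longrightarrow> 0 \<le> trunc_mean t"
  unfolding trunc_mean_def set_lebesgue_integral_def
  by (intro mult_nonneg_nonneg integral_nonneg_AE AE_I2) (auto simp: indicator_def)

text \<open>Both sides are the expectation of \<open>min 1 (\<nu> / t)\<close>.\<close>

lemma trunc_mean_tail:
  assumes "0 \<le> t"
  shows "ennreal (trunc_mean t) + ennreal (tail t) = (\<integral>\<^sup>+\<tau>. indicator {0<..1} \<tau> * ennreal (tail (\<tau> * t)) \<partial>lborel)"
proof (cases "t = 0")
  \<comment> \<open>Division by 0 makes \<open>trunc_mean 0\<close> vanish, and the tail on the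
    right is evaluated at 0 for every \<tau>.\<close>
  case True
  have "(\<integral>\<^sup>+\<tau>. indicator {0<..1::real} \<tau> * ennreal (tail 0) \<partial>lborel) = ennreal (tail 0)"
    by (subst nn_integral_multc) auto
  then show ?thesis using True by (simp add: trunc_mean_def)
next
  case False
  with assms have t: "0 < t" by simp
  interpret P: pair_sigma_finite lborel H ..
  have int: "integrable H (\<lambda>\<nu>. indicator {0..t} \<nu> * \<nu>)"
    by (rule integrable_const_bound[where B = t]) (auto simp: indicator_def t less_imp_le)
  have "ennreal (trunc_mean t) = ennreal (\<integral>\<nu>. indicator {0..t} \<nu> * \<nu> / t \<partial>H)"
    by (simp add: trunc_mean_def set_lebesgue_integral_def)
  also have "\<dots> = (\<integral>\<^sup>+\<nu>. ennreal (indicator {0..t} \<nu> * \<nu> / t) \<partial>H)"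
    using int t by (intro nn_integral_eq_integral[symmetric]) (auto simp: indicator_def)
  finally have "ennreal (trunc_mean t) + ennreal (tail t) =
      (\<integral>\<^sup>+\<nu>. ennreal (indicator {0..t} \<nu> * \<nu> / t) + of_bool (t < \<nu>) \<partial>H)"
    by (simp add: ennreal_tail nn_integral_add)
  \<comment> \<open>For fixed \<nu> the inner integral is the length of the set of \<tau> in (0,1]
    with \<tau> t < \<nu>: it is 1 if t < \<nu>, and \<nu> / t otherwise.\<close>
  also have "\<dots> = (\<integral>\<^sup>+\<nu>. \<integral>\<^sup>+\<tau>. indicator {0<..1} \<tau> * of_bool (\<tau> * t < \<nu>) \<partial>lborel \<partial>H)"
    using nonneg
  proof (intro nn_integral_cong_AE, eventually_elim)
    case (elim \<nu>)
    show ?case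
    proof (cases "t < \<nu>")
      case True
      have "(\<integral>\<^sup>+\<tau>. indicator {0<..1} \<tau> * of_bool (\<tau> * t < \<nu>) \<partial>lborel) = (\<integral>\<^sup>+\<tau>. indicator {0<..1::real} \<tau> \<partial>lborel)"
      proof (rule nn_integral_cong)
        fix \<tau> :: real
        have "\<tau> * t < \<nu>" if "\<tau> \<le> 1"
        proof -
          have "\<tau> * t \<le> 1 * t" using that t by (intro mult_right_mono) auto
          then show ?thesis using True by linarith
        qed
        then show "indicator {0<..1} \<tau> * of_bool (\<tau> * t < \<nu>) = (indicator {0<..1} \<tau> :: ennreal)"
          by (auto simp: indicator_def)
      qed
      then show ?thesis using True by simp
    next
      case False
      have "(\<integral>\<^sup>+\<tau>. indicator {0<..1} \<tau> * of_bool (\<tau> * t < \<nu>) \<partial>lborel) = (\<integral>\<^sup>+\<tau>. indicator {0<..<\<nu> / t} \<tau> \<partial>lborel)"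
      proof (rule nn_integral_cong)
        fix \<tau> :: real
        have "\<tau> \<le> 1" if "\<tau> * t < \<nu>"
        proof (rule ccontr)
          assume "\<not> \<tau> \<le> 1"
          then have "1 * t < \<tau> * t" using t by (intro mult_strict_right_mono) auto
          then show False using that False by linarith
        qed
        then show "indicator {0<..1} \<tau> * of_bool (\<tau> * t < \<nu>) = (indicator {0<..<\<nu> / t} \<tau> :: ennreal)"
          using t by (auto simp: indicator_def less_divide_eq)
      qed
      also have "\<dots> = ennreal (\<nu> / t)" using elim t by simp
      finally show ?thesis using False elim by simp
    qed
  qed
  also have "\<dots> = (\<integral>\<^sup>+\<tau>. \<integral>\<^sup>+\<nu>. indicator {0<..1} \<tau> * of_bool (\<tau> * t < \<nu>) \<partial>H \<partial>lborel)"
    by (rule P.Fubini') measurable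
  also have "\<dots> = (\<integral>\<^sup>+\<tau>. indicator {0<..1} \<tau> * ennreal (tail (\<tau> * t)) \<partial>lborel)"
    by (simp add: nn_integral_cmult ennreal_tail)
  finally show ?thesis .
qed

end

context fading_weight
begin

text \<open>Its real value will be the Markov term of the upper bound. It is studied through
  \<open>T y + S y\<close>, which is an average of \<open>S\<close> over scales.\<close>

definition T :: "real \<Rightarrow> ennreal" where
  "T y = (\<integral>\<^sup>+x. ennreal (trunc_mean (y * norm (x - z) powr \<alpha>)) * ennreal (q x) \<partial>lborel)"

definition h_avg :: "real \<Rightarrow> real" where
  "h_avg y = (\<integral>\<tau>. indicator {0<..1} \<tau> * \<tau> powr (- (2 / \<alpha>)) * h (\<tau> * y) \<partial>lborel)"

text \<open>Integrability at 0 holds because \<open>2 / \<alpha> < 1\<close>. The value exceeds 1 by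
  \<open>2 / (\<alpha> - 2)\<close>, the factor of \<theta>2.\<close>

lemma powr_0_1_integrable:
  "integrable lborel (\<lambda>\<tau>. indicator {0<..1} \<tau> * \<tau> powr (- (2 / \<alpha>)))"
  and powr_0_1_integral: "(\<integral>\<tau>. indicator {0<..1} \<tau> * \<tau> powr (- (2 / \<alpha>)) \<partial>lborel) = \<alpha> / (\<alpha> - 2)"
proof -
  have *: "(\<integral>\<^sup>+\<tau>. ennreal (indicator {0<..1} \<tau> * \<tau> powr (- (2 / \<alpha>))) \<partial>lborel) = ennreal (\<alpha> / (\<alpha> - 2))"
    using nn_integral_powr_0_1[of "- (2 / \<alpha>)"] \<alpha> by (simp add: field_simps)
  show "integrable lborel (\<lambda>\<tau>. indicator {0<..1} \<tau> * \<tau> powr (- (2 / \<alpha>)))"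
    by (rule integrableI_nonneg) (auto simp: * intro!: AE_I2)
  show "(\<integral>\<tau>. indicator {0<..1} \<tau> * \<tau> powr (- (2 / \<alpha>)) \<partial>lborel) = \<alpha> / (\<alpha> - 2)"
    using * \<alpha> by (subst integral_eq_nn_integral) (auto intro!: AE_I2)
qed

lemma h_avg_integrand_bound:
  "0 < y \<Longrightarrow> \<bar>indicator {0<..1} \<tau> * \<tau> powr (- (2 / \<alpha>)) * h (\<tau> * y)\<bar> \<le> K * C\<^sub>\<alpha> * (indicator {0<..1} \<tau> * \<tau> powr (- (2 / \<alpha>)))"
  using h_le[of "\<tau> * y"] h_nonneg[of "\<tau> * y"]
  by (auto simp: indicator_def abs_mult mult.commute[of "K * C\<^sub>\<alpha>"] intro!: mult_left_mono)

lemma h_avg_integrable: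
  "0 < y \<Longrightarrow> integrable lborel (\<lambda>\<tau>. indicator {0<..1} \<tau> * \<tau> powr (- (2 / \<alpha>)) * h (\<tau> * y))"
  by (rule Bochner_Integration.integrable_bound[where f = "\<lambda>\<tau>. K * C\<^sub>\<alpha> * (indicator {0<..1} \<tau> * \<tau> powr (- (2 / \<alpha>)))"])
    (use powr_0_1_integrable h_avg_integrand_bound K_nonneg C_nonneg in \<open>auto simp: abs_mult intro!: AE_I2\<close>)

text \<open>For each \<tau> in (0,1] the argument \<open>\<tau> * y\<close> still tends to infinity,
  and \<open>h\<close> is uniformly bounded by \<open>K * C\<^sub>\<alpha>\<close>, so dominated
  convergence carries the limit of \<open>h\<close> through the average.\<close>

lemma h_avg_tendsto: "(h_avg \<longlongrightarrow> \<alpha> / (\<alpha> - 2) * (pi * q z * C\<^sub>\<alpha>)) at_top"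
proof -
  have "((\<lambda>y. \<integral>\<tau>. indicator {0<..1} \<tau> * \<tau> powr (- (2 / \<alpha>)) * h (\<tau> * y) \<partial>lborel) \<longlongrightarrow>
      (\<integral>\<tau>. indicator {0<..1} \<tau> * \<tau> powr (- (2 / \<alpha>)) * (pi * q z * C\<^sub>\<alpha>) \<partial>lborel)) at_top"
  proof (rule integral_dominated_convergence_at_top[where w = "\<lambda>\<tau>. K * C\<^sub>\<alpha> * (indicator {0<..1} \<tau> * \<tau> powr (- (2 / \<alpha>)))"])
    show "\<forall>\<^sub>F y in at_top. AE \<tau> in lborel. norm (indicator {0<..1} \<tau> * \<tau> powr (- (2 / \<alpha>)) * h (\<tau> * y)) \<le>
        K * C\<^sub>\<alpha> * (indicator {0<..1} \<tau> * \<tau> powr (- (2 / \<alpha>)))"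
      using eventually_gt_at_top[of 0]
      by eventually_elim (use h_avg_integrand_bound in \<open>auto intro!: AE_I2\<close>)
    show "AE \<tau> in lborel. ((\<lambda>y. indicator {0<..1} \<tau> * \<tau> powr (- (2 / \<alpha>)) * h (\<tau> * y)) \<longlongrightarrow>
        indicator {0<..1} \<tau> * \<tau> powr (- (2 / \<alpha>)) * (pi * q z * C\<^sub>\<alpha>)) at_top"
    proof (rule AE_I2)
      fix \<tau> :: real
      show "((\<lambda>y. indicator {0<..1} \<tau> * \<tau> powr (- (2 / \<alpha>)) * h (\<tau> * y)) \<longlongrightarrow>
          indicator {0<..1} \<tau> * \<tau> powr (- (2 / \<alpha>)) * (pi * q z * C\<^sub>\<alpha>)) at_top"
      proof (cases "0 < \<tau>")
        case True
        have "filterlim (\<lambda>y. \<tau> * y) at_top at_top"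
          by (rule filterlim_tendsto_pos_mult_at_top[OF tendsto_const True filterlim_ident])
        from filterlim_compose[OF h_tendsto this] show ?thesis by (intro tendsto_mult tendsto_const)
      qed simp
    qed
  qed (use powr_0_1_integrable in auto)
  also have "(\<integral>\<tau>. indicator {0<..1} \<tau> * \<tau> powr (- (2 / \<alpha>)) * (pi * q z * C\<^sub>\<alpha>) \<partial>lborel) = \<alpha> / (\<alpha> - 2) * (pi * q z * C\<^sub>\<alpha>)"
    by (subst integral_mult_left_zero) (simp only: powr_0_1_integral)
  finally show ?thesis by (simp add: h_avg_def[abs_def])
qed

text \<open>Integrating \<open>trunc_mean_tail\<close> against \<open>q\<close> yields the average
  of \<open>S (\<tau> * y)\<close> over \<tau> in (0,1], and \<open>S_eq\<close> factors out the
  power of \<open>y\<close>.\<close>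

lemma T_plus_S:
  assumes y: "0 < y"
  shows "T y + S y = ennreal (y powr (- (2 / \<alpha>)) * h_avg y)"
proof -
  have "T y + S y = (\<integral>\<^sup>+x. (ennreal (trunc_mean (y * norm (x - z) powr \<alpha>)) + ennreal (tail (y * norm (x - z) powr \<alpha>))) * ennreal (q x) \<partial>lborel)"
    unfolding T_def S_def by (simp add: nn_integral_add distrib_right)
  also have "\<dots> = (\<integral>\<^sup>+x. \<integral>\<^sup>+\<tau>. indicator {0<..1} \<tau> * ennreal (tail (\<tau> * (y * norm (x - z) powr \<alpha>))) * ennreal (q x) \<partial>lborel \<partial>lborel)"
    using y by (simp add: trunc_mean_tail nn_integral_multc)
  also have "\<dots> = (\<integral>\<^sup>+\<tau>. \<integral>\<^sup>+x. indicator {0<..1} \<tau> * ennreal (tail (\<tau> * (y * norm (x - z) powr \<alpha>))) * ennreal (q x) \<partial>lborel \<partial>lborel)"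
    by (rule lborel_pair.Fubini'[symmetric]) measurable
  also have "\<dots> = (\<integral>\<^sup>+\<tau>. indicator {0<..1} \<tau> * S (\<tau> * y) \<partial>lborel)"
    unfolding S_def by (simp add: nn_integral_cmult mult.assoc)
  also have "\<dots> = (\<integral>\<^sup>+\<tau>. ennreal (y powr (- (2 / \<alpha>))) * ennreal (indicator {0<..1} \<tau> * \<tau> powr (- (2 / \<alpha>)) * h (\<tau> * y)) \<partial>lborel)"
  proof (rule nn_integral_cong)
    fix \<tau> :: real
    show "indicator {0<..1} \<tau> * S (\<tau> * y) =
        ennreal (y powr (- (2 / \<alpha>))) * ennreal (indicator {0<..1} \<tau> * \<tau> powr (- (2 / \<alpha>)) * h (\<tau> * y))"
      using y by (cases "\<tau> \<in> {0<..1}")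
        (auto simp: S_eq powr_mult ennreal_mult h_nonneg mult_ac)
  qed
  also have "\<dots> = ennreal (y powr (- (2 / \<alpha>))) * ennreal (h_avg y)"
    unfolding h_avg_def using h_avg_integrable[OF y]
    by (subst nn_integral_eq_integral[symmetric]) (auto simp: nn_integral_cmult h_nonneg intro!: AE_I2)
  also have "\<dots> = ennreal (y powr (- (2 / \<alpha>)) * h_avg y)"
    by (rule ennreal_mult'[symmetric]) simp
  finally show ?thesis .
qed

lemma h_avg_nonneg: "0 \<le> h_avg y"
  unfolding h_avg_def by (intro integral_nonneg_AE AE_I2) (simp add: h_nonneg)

text \<open>Finiteness of \<open>T y + S y\<close> permits the subtraction of
  \<open>S y\<close>.\<close>

lemma T_eq:
  assumes y: "0 < y"
  shows "enn2real (T y) = y powr (- (2 / \<alpha>)) * (h_avg y - h y)"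
proof -
  have "T y \<le> T y + S y" by simp
  then have "T y < \<infinity>" unfolding T_plus_S[OF y] by (rule le_less_trans) simp
  then obtain t where t: "T y = ennreal t" "0 \<le> t" by (cases "T y" rule: ennreal_cases) auto
  have "ennreal (t + y powr (- (2 / \<alpha>)) * h y) = ennreal (y powr (- (2 / \<alpha>)) * h_avg y)"
    using T_plus_S[OF y] t y by (simp add: S_eq h_nonneg)
  then have "t + y powr (- (2 / \<alpha>)) * h y = y powr (- (2 / \<alpha>)) * h_avg y"
    using t(2) by (subst (asm) ennreal_inj) (auto simp: h_nonneg h_avg_nonneg)
  then show ?thesis using t by (simp add: right_diff_distrib)
qed

end

section \<open>Asymptotics of the bounds\<close>

context neyman_scott_points
begin

abbreviation "ff \<equiv> convolve f f"

lemma ff_measurable[measurable]: "ff \<in> borel_measurable borel"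
  unfolding convolve_def[abs_def] by measurable

lemma ff_nonneg: "0 \<le> ff x"
  unfolding convolve_def by (intro integral_nonneg_AE AE_I2) (simp add: f_nonneg)

lemma f_diff: "f (x - y) = f (y - x)"
  using f unfolding isotropic_density_def by (metis norm_minus_commute)

lemma f_minus: "f (- y) = f y"
  using f_diff[of 0 y] by simp

section \<open>The law of a difference of two displacements\<close>

lemma nn_integral_\<nu>:
  "g \<in> borel_measurable borel \<Longrightarrow> (\<integral>\<^sup>+x. g x \<partial>\<nu>) = (\<integral>\<^sup>+x. ennreal (f x) * g x \<partial>lborel)"
  by (rule nn_integral_density) auto

text \<open>The difference has the autocorrelation of \<open>f\<close> as its density; evenness of
  \<open>f\<close>, a consequence of isotropy, turns it into the convolution.\<close>

lemma difference_law_density: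
  assumes [measurable]: "u \<in> borel_measurable borel"
  shows "(\<integral>\<^sup>+a. \<integral>\<^sup>+b. u (b - a) \<partial>\<nu> \<partial>\<nu>) =
    (\<integral>\<^sup>+x. u x * (\<integral>\<^sup>+y. ennreal (f y) * ennreal (f (x - y)) \<partial>lborel) \<partial>lborel)"
proof -
  interpret \<nu>: prob_space \<nu> by (rule prob_space_displacement_law[OF f])
  have "(\<integral>\<^sup>+a. \<integral>\<^sup>+b. u (b - a) \<partial>\<nu> \<partial>\<nu>) =
      (\<integral>\<^sup>+a. ennreal (f a) * (\<integral>\<^sup>+b. ennreal (f b) * u (b - a) \<partial>lborel) \<partial>lborel)"
    by (simp add: nn_integral_\<nu>)
  also have "\<dots> = (\<integral>\<^sup>+a. ennreal (f a) * (\<integral>\<^sup>+x. ennreal (f (x + a)) * u x \<partial>lborel) \<partial>lborel)"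
  proof -
    have "(\<integral>\<^sup>+b. ennreal (f b) * u (b - a) \<partial>lborel) = (\<integral>\<^sup>+x. ennreal (f (x + a)) * u x \<partial>lborel)" for a
      using nn_integral_lborel_translate[of "\<lambda>b. ennreal (f b) * u (b - a)" a] by simp
    then show ?thesis by simp
  qed
  also have "\<dots> = (\<integral>\<^sup>+a. \<integral>\<^sup>+x. ennreal (f a) * (ennreal (f (x + a)) * u x) \<partial>lborel \<partial>lborel)"
    by (simp add: nn_integral_cmult)
  also have "\<dots> = (\<integral>\<^sup>+x. \<integral>\<^sup>+a. ennreal (f a) * (ennreal (f (x + a)) * u x) \<partial>lborel \<partial>lborel)"
    by (rule lborel_pair.Fubini'[symmetric]) measurable
  also have "\<dots> = (\<integral>\<^sup>+x. u x * (\<integral>\<^sup>+a. ennreal (f a) * ennreal (f (x + a)) \<partial>lborel) \<partial>lborel)"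
    by (intro nn_integral_cong, subst nn_integral_cmult[symmetric]) (auto intro!: nn_integral_cong simp: mult_ac)
  also have "\<dots> = (\<integral>\<^sup>+x. u x * (\<integral>\<^sup>+y. ennreal (f y) * ennreal (f (x - y)) \<partial>lborel) \<partial>lborel)"
  proof -
    have "(\<integral>\<^sup>+a. ennreal (f a) * ennreal (f (x + a)) \<partial>lborel) = (\<integral>\<^sup>+y. ennreal (f y) * ennreal (f (x - y)) \<partial>lborel)" for x
      using nn_integral_lborel_translate[of "\<lambda>y. ennreal (f y) * ennreal (f (x - y))" x]
      by (simp add: f_diff[of x] f_minus mult.commute add.commute)
    then show ?thesis by simp
  qed
  finally show ?thesis .
qed

lemma convolution_mass: "(\<integral>\<^sup>+x. \<integral>\<^sup>+y. ennreal (f y) * ennreal (f (x - y)) \<partial>lborel \<partial>lborel) = 1"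
proof -
  interpret \<nu>: prob_space \<nu> by (rule prob_space_displacement_law[OF f])
  show ?thesis using difference_law_density[of "\<lambda>_. 1"] \<nu>.emeasure_space_1 by simp
qed

text \<open>\<open>ff\<close> is a Bochner integral and is 0 by convention wherever the convolution
  diverges; the total mass 1 excludes divergence almost everywhere.\<close>

lemma AE_convolve:
  "AE x in lborel. (\<integral>\<^sup>+y. ennreal (f y) * ennreal (f (x - y)) \<partial>lborel) = ennreal (ff x)"
proof -
  have "AE x in lborel. (\<integral>\<^sup>+y. ennreal (f y) * ennreal (f (x - y)) \<partial>lborel) \<noteq> \<infinity>"
    by (rule nn_integral_PInf_AE) (simp_all add: convolution_mass)
  then show ?thesis
  proof eventually_elim
    case (elim x)
    have *: "(\<integral>\<^sup>+y. ennreal (f y * f (x - y)) \<partial>lborel) = (\<integral>\<^sup>+y. ennreal (f y) * ennreal (f (x - y)) \<partial>lborel)"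
      by (simp add: ennreal_mult f_nonneg)
    have "integrable lborel (\<lambda>y. f y * f (x - y))"
      using elim by (intro integrableI_nonneg) (auto simp: * f_nonneg less_top)
    then have "(\<integral>\<^sup>+y. ennreal (f y * f (x - y)) \<partial>lborel) = ennreal (ff x)"
      unfolding convolve_def by (intro nn_integral_eq_integral) (auto simp: f_nonneg)
    then show ?case by (simp only: *)
  qed
qed

lemma difference_law:
  assumes [measurable]: "u \<in> borel_measurable borel"
  shows "(\<integral>\<^sup>+a. \<integral>\<^sup>+b. u (b - a) \<partial>\<nu> \<partial>\<nu>) = (\<integral>\<^sup>+x. u x * ennreal (ff x) \<partial>lborel)"
  unfolding difference_law_density[OF assms] using AE_convolve
  by (intro nn_integral_cong_AE) (auto elim!: eventually_mono)

lemma ff_mass: "(\<integral>\<^sup>+x. ennreal (ff x) \<partial>lborel) = 1"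
proof -
  have "(\<integral>\<^sup>+x. ennreal (ff x) \<partial>lborel) = (\<integral>\<^sup>+x. \<integral>\<^sup>+y. ennreal (f y) * ennreal (f (x - y)) \<partial>lborel \<partial>lborel)"
    using AE_convolve by (intro nn_integral_cong_AE) (auto elim!: eventually_mono)
  then show ?thesis by (simp add: convolution_mass)
qed

lemma displacement_mean_le_1:
  assumes "\<And>x. u x \<le> 1" shows "(\<integral>\<^sup>+b. u (s + b) \<partial>\<nu>) \<le> 1"
proof -
  interpret \<nu>: prob_space \<nu> by (rule prob_space_displacement_law[OF f])
  have "(\<integral>\<^sup>+b. u (s + b) \<partial>\<nu>) \<le> (\<integral>\<^sup>+b. 1 \<partial>\<nu>)" by (intro nn_integral_mono assms)
  then show ?thesis using \<nu>.emeasure_space_1 by simp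
qed

text \<open>The density is cut at level \<open>n\<close>: where \<open>f\<close> is at most
  \<open>n\<close> the average is controlled by the integral of \<open>u\<close>, and the mass
  carried where \<open>f\<close> exceeds \<open>n\<close> is below \<epsilon> for suitable
  \<open>n\<close>. The constant depends neither on \<open>u\<close> nor on the shift.\<close>

lemma displacement_uniformly_integrable:
  fixes \<epsilon> :: real
  assumes "0 < \<epsilon>"
  obtains R where "0 \<le> R"
    "\<And>u s. u \<in> borel_measurable borel \<Longrightarrow> (\<And>x. u x \<le> 1) \<Longrightarrow>
      (\<integral>\<^sup>+b. u (s + b) \<partial>\<nu>) \<le> ennreal R * (\<integral>\<^sup>+x. u x \<partial>lborel) + ennreal \<epsilon>"
proof -
  have f_int: "integrable lborel f" using f unfolding isotropic_density_def by blast
  have "(\<lambda>n. \<integral>x. f x * indicator {x. real n < f x} x \<partial>lborel) \<longlonglongrightarrow> (\<integral>x. 0 \<partial>(lborel :: plane measure))"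
  proof (rule integral_dominated_convergence[where w = f])
    show "AE x in lborel. (\<lambda>n. f x * indicator {x. real n < f x} x) \<longlonglongrightarrow> 0"
    proof (rule AE_I2)
      fix x
      obtain n where n: "f x \<le> real n" using real_arch_simple by blast
      have "\<forall>\<^sub>F m in sequentially. f x * indicator {x. real m < f x} x = 0"
        using eventually_ge_at_top[of n]
        by eventually_elim (use n in \<open>auto simp: indicator_def\<close>)
      then show "(\<lambda>n. f x * indicator {x. real n < f x} x) \<longlonglongrightarrow> 0" by (rule tendsto_eventually)
    qed
  qed (use f_int f_nonneg in \<open>auto simp: indicator_def\<close>)
  then have "\<forall>\<^sub>F n in sequentially. (\<integral>x. f x * indicator {x. real n < f x} x \<partial>lborel) < \<epsilon>"
    using assms by (intro order_tendstoD) auto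
  then obtain n where n: "(\<integral>x. f x * indicator {x. real n < f x} x \<partial>lborel) < \<epsilon>"
    by (auto simp: eventually_sequentially)
  have int: "integrable lborel (\<lambda>x. f x * indicator {x. real n < f x} x)"
    by (rule Bochner_Integration.integrable_bound[OF f_int]) (auto simp: indicator_def)
  show ?thesis
  proof (rule that[of "real n"])
    fix u :: "plane \<Rightarrow> ennreal" and s
    assume u[measurable]: "u \<in> borel_measurable borel" and u1: "\<And>x. u x \<le> 1"
    have "(\<integral>\<^sup>+b. u (s + b) \<partial>\<nu>) = (\<integral>\<^sup>+b. ennreal (f b) * u (s + b) \<partial>lborel)"
      by (rule nn_integral_\<nu>) measurable
    also have "\<dots> \<le> (\<integral>\<^sup>+b. ennreal (real n) * u (b + s) + ennreal (f b * indicator {x. real n < f x} b) \<partial>lborel)"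
    proof (rule nn_integral_mono)
      fix b
      show "ennreal (f b) * u (s + b) \<le> ennreal (real n) * u (b + s) + ennreal (f b * indicator {x. real n < f x} b)"
      proof (cases "real n < f b")
        case True
        have "ennreal (f b) * u (s + b) \<le> ennreal (f b) * 1" by (intro mult_left_mono u1) simp
        then show ?thesis using True by (simp add: add_increasing)
      next
        case False
        then have "ennreal (f b) * u (s + b) \<le> ennreal (real n) * u (s + b)"
          by (intro mult_right_mono ennreal_leI) auto
        then show ?thesis using False by (simp add: add.commute)
      qed
    qed
    also have "\<dots> = ennreal (real n) * (\<integral>\<^sup>+b. u (b + s) \<partial>lborel) + (\<integral>\<^sup>+b. ennreal (f b * indicator {x. real n < f x} b) \<partial>lborel)"
      by (subst nn_integral_add) (auto simp: nn_integral_cmult)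
    also have "\<dots> \<le> ennreal (real n) * (\<integral>\<^sup>+x. u x \<partial>lborel) + ennreal \<epsilon>"
      using n int f_nonneg
      by (intro add_mono) (auto simp: nn_integral_lborel_translate nn_integral_eq_integral intro!: ennreal_leI)
    finally show "(\<integral>\<^sup>+b. u (s + b) \<partial>\<nu>) \<le> ennreal (real n) * (\<integral>\<^sup>+x. u x \<partial>lborel) + ennreal \<epsilon>" .
  qed simp
qed

text \<open>For radii up to \<open>d\<close> continuity bounds \<open>ff\<close> on the ball. For
  larger radii the mass 1 of \<open>ff\<close> contributes at most \<open>c\<close>, which is below
  \<open>c * r^2 / d^2\<close>; the constant adds both bounds.\<close>

lemma palm_weight_ball_bound:
  assumes "isCont ff z"
  obtains K where "0 \<le> K"
    "\<And>r. 0 < r \<Longrightarrow> (\<integral>\<^sup>+x. ennreal (l * c + c * ff x) * indicator (ball z r) x \<partial>lborel) \<le> ennreal (K * r ^ 2)"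
proof -
  obtain d where d: "0 < d" "\<And>x. dist x z < d \<Longrightarrow> dist (ff x) (ff z) < 1"
    using assms unfolding continuous_at_eps_delta by (metis zero_less_one)
  let ?A = "l * c + c * (ff z + 1)"
  have A: "0 \<le> ?A" using l_pos c_pos ff_nonneg[of z] by simp
  let ?K = "?A * pi + c / d ^ 2"
  have ball: "(\<integral>\<^sup>+x. ennreal b * indicator (ball z r) x \<partial>lborel) = ennreal (b * (pi * r ^ 2))" if "0 \<le> b" "0 < r" for b r
    using that by (subst nn_integral_cmult) (auto simp: emeasure_ball_plane ennreal_mult intro!: borel_measurable_indicator)
  show ?thesis
  proof (rule that[of ?K])
    fix r :: real assume r: "0 < r"
    show "(\<integral>\<^sup>+x. ennreal (l * c + c * ff x) * indicator (ball z r) x \<partial>lborel) \<le> ennreal (?K * r ^ 2)"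
    proof (cases "r \<le> d")
      case True
      have "(\<integral>\<^sup>+x. ennreal (l * c + c * ff x) * indicator (ball z r) x \<partial>lborel) \<le>
          (\<integral>\<^sup>+x. ennreal ?A * indicator (ball z r) x \<partial>lborel)"
      proof (rule nn_integral_mono)
        fix x
        have "ff x \<le> ff z + 1" if "x \<in> ball z r"
          using d(2)[of x] that True by (auto simp: dist_commute dist_real_def)
        then show "ennreal (l * c + c * ff x) * indicator (ball z r) x \<le> ennreal ?A * indicator (ball z r) x"
          using c_pos by (auto simp: indicator_def intro!: ennreal_leI)
      qed
      also have "\<dots> = ennreal (?A * (pi * r ^ 2))" using A r by (rule ball)
      also have "\<dots> \<le> ennreal (?K * r ^ 2)"
        using c_pos d(1) by (intro ennreal_leI) (simp add: distrib_right mult.assoc)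
      finally show ?thesis .
    next
      case False
      have "(\<integral>\<^sup>+x. ennreal (l * c + c * ff x) * indicator (ball z r) x \<partial>lborel) \<le>
          (\<integral>\<^sup>+x. ennreal (l * c) * indicator (ball z r) x + ennreal c * ennreal (ff x) \<partial>lborel)"
        using l_pos c_pos ff_nonneg
        by (intro nn_integral_mono) (auto simp: indicator_def ennreal_mult)
      also have "\<dots> = (\<integral>\<^sup>+x. ennreal (l * c) * indicator (ball z r) x \<partial>lborel) + (\<integral>\<^sup>+x. ennreal c * ennreal (ff x) \<partial>lborel)"
        by (rule nn_integral_add) (auto intro!: borel_measurable_times_ennreal borel_measurable_indicator)
      also have "\<dots> = ennreal (l * c * (pi * r ^ 2)) + ennreal c"
        using ball[of "l * c" r] r l_pos c_pos by (simp add: nn_integral_cmult ff_mass)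
      also have "\<dots> = ennreal (l * c * (pi * r ^ 2) + c)"
        using l_pos c_pos by (intro ennreal_plus[symmetric]) auto
      also have "\<dots> \<le> ennreal (?K * r ^ 2)"
      proof (rule ennreal_leI)
        have "d ^ 2 \<le> r ^ 2" using False d(1) by (intro power_mono) auto
        then have "c * 1 \<le> c * (r ^ 2 / d ^ 2)" using d(1) c_pos by (intro mult_left_mono) auto
        moreover have "0 \<le> c * (ff z + 1) * pi * r ^ 2" using c_pos ff_nonneg[of z] by simp
        ultimately show "l * c * (pi * r ^ 2) + c \<le> ?K * r ^ 2" by (simp add: distrib_right algebra_simps)
      qed
      finally show ?thesis .
    qed
  qed (use A c_pos d in simp)
qed

end

section \<open>From scaled limits to asymptotic equivalence\<close>

lemma powr_scaled_sandwich:
  fixes \<Phi> D :: "real \<Rightarrow> real"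
  assumes "0 < a" and lim: "((\<lambda>y. y powr a * \<Phi> y) \<longlongrightarrow> \<theta>) at_top"
    and upper: "\<And>y. 0 < y \<Longrightarrow> D y \<le> \<Phi> y"
    and lower: "\<And>\<epsilon>. 0 < \<epsilon> \<Longrightarrow> \<forall>\<^sub>F y in at_top. \<Phi> y * (1 - \<epsilon>) \<le> D y"
  shows "((\<lambda>y. y powr a * D y) \<longlongrightarrow> \<theta>) at_top"
proof (rule order_tendstoI)
  fix b assume "\<theta> < b"
  then have "\<forall>\<^sub>F y in at_top. y powr a * \<Phi> y < b" by (rule order_tendstoD(2)[OF lim])
  then show "\<forall>\<^sub>F y in at_top. y powr a * D y < b"
    using eventually_gt_at_top[of 0]
  proof eventually_elim
    case (elim y)
    have "y powr a * D y \<le> y powr a * \<Phi> y" by (intro mult_left_mono upper elim) simp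
    then show ?case using elim by linarith
  qed
next
  fix b assume b: "b < \<theta>"
  \<comment> \<open>\<open>n\<close> is positive and at least \<theta>, so \<epsilon> is well
    defined for every sign of \<theta>, and \<open>\<theta> * \<epsilon>\<close> uses up at most
    half of the gap between \<open>b\<close> and \<theta>.\<close>
  define n where "n = \<bar>\<theta>\<bar> + 1"
  define \<epsilon> where "\<epsilon> = (\<theta> - b) / (2 * n)"
  have n: "0 < n" "\<theta> \<le> n" by (auto simp: n_def)
  then have \<epsilon>: "0 < \<epsilon>" using b by (simp add: \<epsilon>_def)
  have "\<theta> * \<epsilon> \<le> n * \<epsilon>" using \<epsilon> n by (intro mult_right_mono) auto
  also have "\<dots> = (\<theta> - b) / 2" using n by (simp add: \<epsilon>_def field_simps)
  finally have "b < \<theta> * (1 - \<epsilon>)" using b by (simp add: algebra_simps)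
  moreover have "((\<lambda>y. y powr a * \<Phi> y * (1 - \<epsilon>)) \<longlongrightarrow> \<theta> * (1 - \<epsilon>)) at_top"
    by (intro tendsto_mult lim tendsto_const)
  ultimately have "\<forall>\<^sub>F y in at_top. b < y powr a * \<Phi> y * (1 - \<epsilon>)" by (intro order_tendstoD(1))
  with lower[OF \<epsilon>] show "\<forall>\<^sub>F y in at_top. b < y powr a * D y"
  proof eventually_elim
    case (elim y)
    have "y powr a * (\<Phi> y * (1 - \<epsilon>)) \<le> y powr a * D y" by (intro mult_left_mono elim) simp
    then show ?case using elim by (simp only: mult.assoc)
  qed
qed

text \<open>Dividing by \<theta> requires it to be nonzero; the degenerate case is handled inside
  the theorem.\<close>

lemma asymp_equiv_powrI:
  fixes F :: "real \<Rightarrow> real"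
  assumes "((\<lambda>y. y powr a * F y) \<longlongrightarrow> \<theta>) at_top" "\<theta> \<noteq> 0"
  shows "F \<sim>[at_top] (\<lambda>y. \<theta> * y powr (- a))"
proof (rule asymp_equivI')
  have "((\<lambda>y. y powr a * F y / \<theta>) \<longlongrightarrow> \<theta> / \<theta>) at_top"
    by (intro tendsto_divide assms tendsto_const)
  moreover have "\<forall>\<^sub>F y in at_top. y powr a * F y / \<theta> = F y / (\<theta> * y powr (- a))"
    using eventually_gt_at_top[of 0]
    by eventually_elim (use assms(2) in \<open>simp add: powr_minus field_simps\<close>)
  ultimately have "((\<lambda>y. F y / (\<theta> * y powr (- a))) \<longlongrightarrow> \<theta> / \<theta>) at_top"
    by (rule Lim_transform_eventually)
  then show "((\<lambda>y. F y / (\<theta> * y powr (- a))) \<longlongrightarrow> 1) at_top"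
    by (simp only: divide_self[OF assms(2)])
qed

theorem lemma3:
  fixes M :: "'w measure" and \<phi> :: "'w \<Rightarrow> plane set" and f :: "plane \<Rightarrow> real"
    and H :: "real measure" and B :: "plane set" and z :: plane
    and \<alpha> lambda_p c :: real
  assumes "prob_space M"
    and "lambda_p > 0" and "c > 0"
    and "isotropic_density f"
    and "neyman_scott_process M lambda_p c f \<phi>"
    and "\<alpha> > 2"
    and "real_distribution H" and "AE \<nu> in H. 0 \<le> \<nu>"
    and "B \<in> sets borel" and "0 < emeasure lborel B" and "emeasure lborel B < \<infinity>"
    and "integrable H (\<lambda>\<nu>. \<nu> powr (2 / \<alpha>))"
    and "isCont (convolve f f) z"
  shows "(\<lambda>y. ccdf_lower M \<phi> lambda_p c B H \<alpha> z y)
           \<sim>[at_top] (\<lambda>y. theta1 lambda_p c f H \<alpha> z * y powr (- 2 / \<alpha>))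
       \<and> (\<lambda>y. ccdf_upper M \<phi> lambda_p c f B H \<alpha> z y)
           \<sim>[at_top] (\<lambda>y. (theta1 lambda_p c f H \<alpha> z + theta2 lambda_p c f H \<alpha> z) * y powr (- 2 / \<alpha>))"
proof -
  obtain X :: "nat \<Rightarrow> 'w \<Rightarrow> plane" and N :: "nat \<Rightarrow> 'w \<Rightarrow> nat" and D :: "nat \<Rightarrow> nat \<Rightarrow> 'w \<Rightarrow> plane" where
    poisson: "poisson_process M lambda_p (\<lambda>\<omega>. range (\<lambda>i. X i \<omega>))" and
    inj: "AE \<omega> in M. inj (\<lambda>i. X i \<omega>)" and
    X: "(\<lambda>\<omega> i. X i \<omega>) \<in> measurable M (\<Pi>\<^sub>M i\<in>UNIV. borel)" and
    marks: "(\<lambda>\<omega> i. (N i \<omega>, \<lambda>j. D i j \<omega>)) \<in> measurable M (\<Pi>\<^sub>M i\<in>UNIV. cluster_law c f)" and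
    joint: "distr M ((\<Pi>\<^sub>M i\<in>UNIV. borel) \<Otimes>\<^sub>M (\<Pi>\<^sub>M i\<in>UNIV. cluster_law c f))
            (\<lambda>\<omega>. (\<lambda>i. X i \<omega>, \<lambda>i. (N i \<omega>, \<lambda>j. D i j \<omega>))) =
          distr M (\<Pi>\<^sub>M i\<in>UNIV. borel) (\<lambda>\<omega> i. X i \<omega>) \<Otimes>\<^sub>M (\<Pi>\<^sub>M i\<in>UNIV. cluster_law c f)" and
    \<phi>: "\<And>\<omega>. \<omega> \<in> space M \<Longrightarrow> \<phi> \<omega> = {X i \<omega> + D i j \<omega> | i j. j < N i \<omega>}"
    using assms(5) unfolding neyman_scott_process_def by blast
  have Xi: "X i \<in> borel_measurable M" for i
    using measurable_compose[OF X measurable_component_singleton[of i]] by simp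
  interpret M: prob_space M by fact
  interpret NS: neyman_scott_points M lambda_p X c f N D
    by unfold_locales (fact assms(2,3,4) poisson inj Xi marks joint)+
  obtain K where K: "0 \<le> K" "\<And>r. 0 < r \<Longrightarrow>
      (\<integral>\<^sup>+x. ennreal (lambda_p * c + c * convolve f f x) * indicator (ball z r) x \<partial>lborel) \<le> ennreal (K * r ^ 2)"
    using NS.palm_weight_ball_bound[OF assms(13)] by blast
  \<comment> \<open>The intensity at \<open>x\<close> seen from the typical point, that is
    \<open>product_density2\<close> divided by \<open>lambda_p * c\<close>.\<close>
  define q where "q = (\<lambda>x. lambda_p * c + c * convolve f f x)"
  interpret H: real_distribution H by fact
  interpret FW: fading_weight H \<alpha> z q K
  proof unfold_locales
    show "q \<in> borel_measurable borel" unfolding q_def by measurable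
    show "isCont q z" unfolding q_def by (intro continuous_intros assms(13))
    show "0 \<le> q x" for x using assms(2,3) NS.ff_nonneg[of x] by (simp add: q_def)
  qed (use assms(6,8,12) K in \<open>auto simp: q_def\<close>)
  define a where "a = 2 / \<alpha>"
  have a: "0 < a" "- 2 / \<alpha> = - a" using assms(6) by (auto simp: a_def)
  define \<theta> where "\<theta> = pi * q z * FW.C\<^sub>\<alpha>"
  have C0: "(LINT \<nu>:{0..}|H. \<nu> powr (2 / \<alpha>)) = FW.C\<^sub>\<alpha>"
    unfolding FW.C\<^sub>\<alpha>_def set_lebesgue_integral_def
    by (rule integral_cong_AE) (use assms(8) in \<open>auto elim!: eventually_mono\<close>)
  have \<theta>1: "theta1 lambda_p c f H \<alpha> z = \<theta>"
    unfolding theta1_def C0 \<theta>_def q_def by (simp add: algebra_simps)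
  \<comment> \<open>At \<open>x = 0\<close> the path loss is 0, so the quotient is 0 by convention,
    and so is the right-hand side.\<close>
  have path: "y / path_loss \<alpha> x = y * norm x powr \<alpha>" for x y
    by (simp add: path_loss_def powr_minus divide_inverse)
  define D1 where "D1 y = ccdf_lower M \<phi> lambda_p c B H \<alpha> z y" for y
  define \<Phi> where "\<Phi> y = y powr (- a) * FW.h y" for y
  have \<Phi>_nonneg: "0 \<le> \<Phi> y" for y by (simp add: \<Phi>_def FW.h_nonneg)

  \<comment> \<open>\<delta> stays free here: its value will come from uniform integrability, which
    in turn uses \<open>U_le\<close>.\<close>
  have bounds: "D1 y \<le> \<Phi> y"
    "\<And>\<delta>. (\<And>s. (\<integral>\<^sup>+b. ennreal (FW.tail (y * norm (s + b - z) powr \<alpha>)) \<partial>NS.\<nu>) \<le> ennreal \<delta>) \<Longrightarrow> 0 \<le> \<delta> \<Longrightarrow>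
      \<Phi> y * (1 - \<Phi> y - c * \<delta>) \<le> D1 y"
    and U_le: "(\<integral>\<^sup>+x. ennreal (FW.tail (y * norm (x - z) powr \<alpha>)) \<partial>lborel) \<le> ennreal (\<Phi> y / (lambda_p * c))"
    if y: "0 < y" for y
  proof -
    let ?t = "\<lambda>x. FW.tail (y * norm (x - z) powr \<alpha>)"
    let ?v = "\<lambda>x. cdf H (y / path_loss \<alpha> (x - z))"
    have v: "?v x = 1 - ?t x" for x by (simp add: path FW.tail_def)
    interpret P: neyman_scott_palm M lambda_p X c f N D \<phi> B ?v
    proof unfold_locales
      show "?v \<in> borel_measurable borel" unfolding v by measurable
      show "0 \<le> ?v x" "?v x \<le> 1" for x unfolding v using FW.tail_nonneg FW.tail_le by simp_all
    qed (use \<phi> assms(9,10,11) in auto)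
    have u: "P.u x = ennreal (?t x)" for x by (subst P.u_def) (simp only: v, simp)
    have [measurable]: "(\<lambda>x. ennreal (?t x)) \<in> borel_measurable borel" by measurable
    have "(\<integral>\<^sup>+a. \<integral>\<^sup>+b. P.u (b - a) \<partial>NS.\<nu> \<partial>NS.\<nu>) = (\<integral>\<^sup>+x. P.u x * ennreal (convolve f f x) \<partial>lborel)"
      by (rule NS.difference_law) measurable
    then have "ennreal lambda_p * ennreal c * (\<integral>\<^sup>+x. P.u x \<partial>lborel) +
        ennreal c * (\<integral>\<^sup>+a. \<integral>\<^sup>+b. P.u (b - a) \<partial>NS.\<nu> \<partial>NS.\<nu>) =
        (\<integral>\<^sup>+x. ennreal lambda_p * ennreal c * P.u x + ennreal c * (P.u x * ennreal (convolve f f x)) \<partial>lborel)"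
      by (simp add: nn_integral_add nn_integral_cmult)
    also have "\<dots> = FW.S y"
      unfolding FW.S_def u using assms(2,3) NS.ff_nonneg
      by (intro nn_integral_cong) (simp add: q_def ennreal_mult distrib_left mult_ac)
    also have "\<dots> = ennreal (\<Phi> y)" using FW.S_eq[OF y] by (simp add: \<Phi>_def a_def)
    finally have \<Phi>: "ennreal lambda_p * ennreal c * (\<integral>\<^sup>+x. P.u x \<partial>lborel) +
        ennreal c * (\<integral>\<^sup>+a. \<integral>\<^sup>+b. P.u (b - a) \<partial>NS.\<nu> \<partial>NS.\<nu>) = ennreal (\<Phi> y)" .
    have D1: "D1 y = 1 - cond_gen_functional M \<phi> (lambda_p * c) B ?v"
      by (simp add: D1_def ccdf_lower_def)
    show "\<Phi> y * (1 - \<Phi> y - c * \<delta>) \<le> D1 y"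
      if "\<And>s. (\<integral>\<^sup>+b. ennreal (FW.tail (y * norm (s + b - z) powr \<alpha>)) \<partial>NS.\<nu>) \<le> ennreal \<delta>" "0 \<le> \<delta>" for \<delta>
      unfolding D1 by (rule P.palm_bounds(2)[OF \<Phi> \<Phi>_nonneg]) (use that in \<open>simp_all add: u\<close>)
    show "D1 y \<le> \<Phi> y"
      unfolding D1
    proof (rule P.palm_bounds(1)[OF \<Phi> \<Phi>_nonneg])
      \<comment> \<open>The trivial choice \<delta> = 1 is admissible since \<open>u\<close> is at
        most 1 and the displacement law is a probability.\<close>
      show "(\<integral>\<^sup>+b. P.u (s + b) \<partial>NS.\<nu>) \<le> ennreal 1" for s
        using NS.displacement_mean_le_1[of P.u s] by (simp add: u FW.tail_le ennreal_le_1)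
    qed simp
    \<comment> \<open>Dropping the nonnegative own-cluster term of \<Phi> bounds the integral of
      \<open>u\<close>.\<close>
    have "ennreal (lambda_p * c) * (\<integral>\<^sup>+x. P.u x \<partial>lborel) \<le> ennreal (\<Phi> y)"
      unfolding \<Phi>[symmetric] using assms(2,3) by (simp add: ennreal_mult)
    then have "ennreal (1 / (lambda_p * c)) * (ennreal (lambda_p * c) * (\<integral>\<^sup>+x. P.u x \<partial>lborel)) \<le>
        ennreal (1 / (lambda_p * c)) * ennreal (\<Phi> y)" by (rule mult_left_mono) simp
    moreover have "ennreal (1 / (lambda_p * c)) * ennreal (lambda_p * c) = 1"
      using assms(2,3) by (simp add: ennreal_mult[symmetric])
    moreover have "ennreal (1 / (lambda_p * c)) * ennreal (\<Phi> y) = ennreal (\<Phi> y / (lambda_p * c))"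
      using assms(2,3) \<Phi>_nonneg by (simp add: ennreal_mult[symmetric])
    ultimately have "(\<integral>\<^sup>+x. P.u x \<partial>lborel) \<le> ennreal (\<Phi> y / (lambda_p * c))"
      by (simp add: mult.assoc[symmetric])
    then show "(\<integral>\<^sup>+x. ennreal (?t x) \<partial>lborel) \<le> ennreal (\<Phi> y / (lambda_p * c))" by (simp add: u)
  qed

  have powr_small: "((\<lambda>y. y powr (- a)) \<longlongrightarrow> 0) at_top"
    by (rule tendsto_neg_powr[OF _ filterlim_ident]) (use a in simp)
  have \<Phi>_lim: "((\<lambda>y. y powr a * \<Phi> y) \<longlongrightarrow> \<theta>) at_top"
  proof (rule Lim_transform_eventually[OF FW.h_tendsto[folded \<theta>_def]])
    show "\<forall>\<^sub>F y in at_top. FW.h y = y powr a * \<Phi> y"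
      using eventually_gt_at_top[of 0] by eventually_elim (simp add: \<Phi>_def powr_minus)
  qed
  have "((\<lambda>y. y powr (- a) * FW.h y) \<longlongrightarrow> 0 * \<theta>) at_top"
    unfolding \<theta>_def by (intro tendsto_mult powr_small FW.h_tendsto)
  then have \<Phi>_0: "(\<Phi> \<longlongrightarrow> 0) at_top" by (simp add: \<Phi>_def[abs_def])

  have D1_lim: "((\<lambda>y. y powr a * D1 y) \<longlongrightarrow> \<theta>) at_top"
  proof (rule powr_scaled_sandwich[OF a(1) \<Phi>_lim bounds(1)])
    fix \<epsilon> :: real assume \<epsilon>: "0 < \<epsilon>"
    \<comment> \<open>Chosen so that \<open>c * \<epsilon>'\<close> is half of \<epsilon>; the other
      half pays for \<Phi> and for the part of \<delta> proportional to \<Phi>.\<close>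
    define \<epsilon>' where "\<epsilon>' = \<epsilon> / (2 * c)"
    have \<epsilon>': "0 < \<epsilon>'" using \<epsilon> assms(3) by (simp add: \<epsilon>'_def)
    obtain R where R: "0 \<le> R" "\<And>u s. u \<in> borel_measurable borel \<Longrightarrow> (\<And>x. u x \<le> 1) \<Longrightarrow>
      (\<integral>\<^sup>+b. u (s + b) \<partial>NS.\<nu>) \<le> ennreal R * (\<integral>\<^sup>+x. u x \<partial>lborel) + ennreal \<epsilon>'"
      using NS.displacement_uniformly_integrable[OF \<epsilon>'] by blast
    have "((\<lambda>y. \<Phi> y + R * \<Phi> y / lambda_p) \<longlongrightarrow> 0 + R * 0 / lambda_p) at_top"
      using assms(2) by (intro tendsto_intros \<Phi>_0) auto
    then have "\<forall>\<^sub>F y in at_top. \<Phi> y + R * \<Phi> y / lambda_p < \<epsilon> / 2"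
      using \<epsilon> by (intro order_tendstoD(2)) auto
    then show "\<forall>\<^sub>F y in at_top. \<Phi> y * (1 - \<epsilon>) \<le> D1 y"
      using eventually_gt_at_top[of 0]
    proof eventually_elim
      case (elim y)
      let ?\<delta> = "R * (\<Phi> y / (lambda_p * c)) + \<epsilon>'"
      have \<delta>: "0 \<le> R * (\<Phi> y / (lambda_p * c))" using R(1) \<Phi>_nonneg[of y] assms(2,3) by simp
      have "\<Phi> y * (1 - \<Phi> y - c * ?\<delta>) \<le> D1 y"
      proof (rule bounds(2)[OF elim(2)])
        fix s
        have "(\<integral>\<^sup>+b. ennreal (FW.tail (y * norm (s + b - z) powr \<alpha>)) \<partial>NS.\<nu>) \<le>
            ennreal R * (\<integral>\<^sup>+x. ennreal (FW.tail (y * norm (x - z) powr \<alpha>)) \<partial>lborel) + ennreal \<epsilon>'"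
          by (rule R(2)) (auto simp: FW.tail_le ennreal_le_1)
        also have "\<dots> \<le> ennreal R * ennreal (\<Phi> y / (lambda_p * c)) + ennreal \<epsilon>'"
          by (intro add_mono mult_left_mono U_le elim) auto
        also have "\<dots> = ennreal ?\<delta>"
          using \<delta> \<epsilon>' R(1) \<Phi>_nonneg[of y] assms(2,3) by (simp add: ennreal_mult[symmetric])
        finally show "(\<integral>\<^sup>+b. ennreal (FW.tail (y * norm (s + b - z) powr \<alpha>)) \<partial>NS.\<nu>) \<le> ennreal ?\<delta>" .
      qed (use \<delta> \<epsilon>' in simp)
      moreover have "c * ?\<delta> = R * \<Phi> y / lambda_p + \<epsilon> / 2"
        using assms(3) by (simp add: \<epsilon>'_def distrib_left)
      then have "1 - \<epsilon> \<le> 1 - \<Phi> y - c * ?\<delta>" using elim(1) by simp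
      then have "\<Phi> y * (1 - \<epsilon>) \<le> \<Phi> y * (1 - \<Phi> y - c * ?\<delta>)"
        by (rule mult_left_mono) (rule \<Phi>_nonneg)
      ultimately show ?case by linarith
    qed
  qed

  define m where "m y = markov_term lambda_p c f H \<alpha> z y" for y
  have m_eq: "m y = y powr (- a) * (FW.h_avg y - FW.h y)" if y: "0 < y" for y
  proof -
    \<comment> \<open>\<open>r\<close> stands for \<open>norm (x - z) powr \<alpha>\<close> and
      \<open>inverse r\<close> for the path loss; at \<open>r = 0\<close>, where
      \<open>x = z\<close>, both sides are 0.\<close>
    have gen: "inverse r * ((lambda_p * c)\<^sup>2 + lambda_p * c * c * w) * L =
        y * (lambda_p * c) * (1 / (y * r) * L * (lambda_p * c + c * w))" for r w L :: real
      using y by (cases "r = 0") (simp_all add: field_simps power2_eq_square)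
    have "path_loss \<alpha> (x - z) * product_density2 lambda_p c f x * (LINT \<nu>:{0..y / path_loss \<alpha> (x - z)}|H. \<nu>) =
        y * (lambda_p * c) * (FW.trunc_mean (y * norm (x - z) powr \<alpha>) * q x)" for x
      unfolding path FW.trunc_mean_def unfolding path_loss_def powr_minus q_def product_density2_def by (rule gen)
    then have "m y = (\<integral>x. FW.trunc_mean (y * norm (x - z) powr \<alpha>) * q x \<partial>lborel)"
      using y assms(2,3) by (simp add: m_def markov_term_def)
    also have "\<dots> = enn2real (\<integral>\<^sup>+x. ennreal (FW.trunc_mean (y * norm (x - z) powr \<alpha>) * q x) \<partial>lborel)"
      using y by (intro integral_eq_nn_integral AE_I2 mult_nonneg_nonneg FW.trunc_mean_nonneg FW.q_nonneg) auto
    also have "\<dots> = enn2real (FW.T y)"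
      unfolding FW.T_def using y
      by (intro arg_cong[where f = enn2real] nn_integral_cong ennreal_mult FW.trunc_mean_nonneg FW.q_nonneg) auto
    finally show ?thesis using FW.T_eq[OF y] by (simp add: a_def)
  qed
  define \<theta>' where "\<theta>' = theta2 lambda_p c f H \<alpha> z"
  have \<theta>': "\<theta>' = \<alpha> / (\<alpha> - 2) * \<theta> - \<theta>"
    using assms(6) by (simp add: \<theta>'_def theta2_def \<theta>1 field_simps)
  have m_lim: "((\<lambda>y. y powr a * m y) \<longlongrightarrow> \<theta>') at_top"
  proof (rule Lim_transform_eventually)
    show "((\<lambda>y. FW.h_avg y - FW.h y) \<longlongrightarrow> \<theta>') at_top"
      unfolding \<theta>' \<theta>_def by (intro tendsto_diff FW.h_avg_tendsto FW.h_tendsto)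
    show "\<forall>\<^sub>F y in at_top. FW.h_avg y - FW.h y = y powr a * m y"
      using eventually_gt_at_top[of 0] by eventually_elim (simp add: m_eq powr_minus)
  qed
  define D2 where "D2 y = ccdf_upper M \<phi> lambda_p c f B H \<alpha> z y" for y
  \<comment> \<open>This expands \<open>1 - (1 - m) * (1 - D1)\<close>; the product of
    \<open>m\<close> and \<open>D1\<close> is of second order and disappears in the limit.\<close>
  have D2: "D2 y = D1 y + m y - m y * D1 y" for y
    by (simp add: D2_def D1_def m_def ccdf_upper_def ccdf_lower_def algebra_simps)
  have D2_lim: "((\<lambda>y. y powr a * D2 y) \<longlongrightarrow> \<theta> + \<theta>') at_top"
  proof -
    have "((\<lambda>y. y powr a * D1 y + y powr a * m y - (y powr a * m y) * ((y powr a * D1 y) * y powr (- a)))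
        \<longlongrightarrow> \<theta> + \<theta>' - \<theta>' * (\<theta> * 0)) at_top"
      by (intro tendsto_intros D1_lim m_lim powr_small)
    moreover have "\<forall>\<^sub>F y in at_top. y powr a * D1 y + y powr a * m y - (y powr a * m y) * ((y powr a * D1 y) * y powr (- a)) = y powr a * D2 y"
      using eventually_gt_at_top[of 0] by eventually_elim (simp add: D2 powr_minus field_simps)
    ultimately have "((\<lambda>y. y powr a * D2 y) \<longlongrightarrow> \<theta> + \<theta>' - \<theta>' * (\<theta> * 0)) at_top"
      by (rule Lim_transform_eventually)
    then show ?thesis by simp
  qed

  have "D1 \<sim>[at_top] (\<lambda>y. \<theta> * y powr (- a)) \<and> D2 \<sim>[at_top] (\<lambda>y. (\<theta> + \<theta>') * y powr (- a))"
  proof (cases "\<theta> = 0")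
    case False
    have "\<theta> + \<theta>' = \<alpha> / (\<alpha> - 2) * \<theta>" by (simp add: \<theta>')
    then have "\<theta> + \<theta>' \<noteq> 0" using False assms(6) by simp
    then show ?thesis using False D1_lim D2_lim by (intro conjI asymp_equiv_powrI)
  next
    \<comment> \<open>As \<open>q z\<close> is positive, the fading moment is 0, so the fading
      vanishes almost surely. Both bounds are then 0 for all positive \<open>y\<close>, and
      functions that agree eventually are equivalent even where their quotient is 0 / 0.\<close>
    case True
    have "0 < q z" using assms(2,3) NS.ff_nonneg[of z] by (simp add: q_def add_pos_nonneg)
    then have C: "FW.C\<^sub>\<alpha> = 0" using True by (simp add: \<theta>_def)
    have h0: "FW.h y = 0" if "0 < y" for y
      using FW.h_le[OF that] FW.h_nonneg[of y] C by simp
    have zero: "D1 y = 0 \<and> D2 y = 0" if y: "0 < y" for y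
    proof -
      have \<Phi>: "\<Phi> y = 0" by (simp add: \<Phi>_def h0[OF y])
      have "(\<integral>\<^sup>+b. ennreal (FW.tail (y * norm (s + b - z) powr \<alpha>)) \<partial>NS.\<nu>) \<le> ennreal 1" for s
        using NS.displacement_mean_le_1[of "\<lambda>x. ennreal (FW.tail (y * norm (x - z) powr \<alpha>))" s]
        by (simp add: FW.tail_le ennreal_le_1)
      then have "D1 y = 0" using bounds(1)[OF y] bounds(2)[OF y, of 1] \<Phi> by simp
      moreover have "FW.h_avg y = 0"
        unfolding FW.h_avg_def
      proof (rule integral_eq_zero_AE, rule AE_I2)
        fix \<tau> :: real
        show "indicator {0<..1} \<tau> * \<tau> powr (- (2 / \<alpha>)) * FW.h (\<tau> * y) = 0"
          using y h0[of "\<tau> * y"] by (auto simp: indicator_def)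
      qed
      ultimately show ?thesis using y by (simp add: D2 m_eq h0)
    qed
    have "\<forall>\<^sub>F y in at_top. D1 y = \<theta> * y powr (- a)" "\<forall>\<^sub>F y in at_top. D2 y = (\<theta> + \<theta>') * y powr (- a)"
      by (rule eventually_mono[OF eventually_gt_at_top[of 0]], simp add: True \<theta>' zero)+
    then show ?thesis by (auto intro: asymp_equiv_refl_ev)
  qed
  then show ?thesis unfolding D1_def D2_def \<theta>1 \<theta>'_def[symmetric] a(2) .
qed

end
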